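(* Let $\phi$ be a trigonometric polynomial. Then $T_\phi$ is analytically symmetric if and only if $T_\phi$ is $C_\lambda$-symmetric for some $\lambda\in\mathbb{T}$.
   Context: $\mathbb{D}$ is the open unit disk in $\mathbb{C}$, $\mathbb{T}$ its boundary with normalized Haar measure $\sigma$. $H^2$ is the Hardy space of $\mathbb{D}$, identified via boundary functions with a closed subspace of $L^2(\mathbb{T},\sigma)$; $P:L^2\to H^2$ is the orthogonal projection; $H^\infty$ is the space of bounded analytic functions on $\mathbb{D}$. For $\phi\in L^\infty(\mathbb{T})$, the Toeplitz operator is $T_\phi f=P(\phi f)$ for $f\in H^2$. A conjugation on $H^2$ is a conjugate-linear map $C:H^2\to H^2$ with $C^2=I$ and $\langle Cx,Cy\rangle=\langle y,x\rangle$ for all $x,y$. A bounded operator $T$ is $C$-symmetric if $CTC=T^*$. For $\lambda\in\mathbb{T}$, $C_\lambda$ is the conjugation on $H^2$ given by $C_\lambda h(z)=\overline{h(\lambda\bar z)}$, i.e. $C_\lambda\big(\sum_{n\ge0} c_nz^n\big)=\sum_{n\ge0}\overline{c_n}\,\overline{\lambda^n}z^n$. For $\phi\in L^\infty(\mathbb{T})$, $T_\phi$ is called analytically symmetric if there exist $f,g\in H^\infty$ and a conjugation $C$ on $H^2$ such that $CT_fC=T_g$ and $\phi=f+\bar g$. A trigonometric polynomial is a finite linear combination of $z^n$, $n\in\mathbb{Z}$, on $\mathbb{T}$. *)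

theory Defs
  imports "HOL-Analysis.Analysis"
begin

section \<open>The circle and \<open>L\<^sup>2\<close>\<close>

definition circle_measure :: "complex measure" where
  "circle_measure =
     distr (uniform_measure lborel {0..<1::real}) (restrict_space borel (sphere 0 1))
       (\<lambda>t. cis (2 * pi * t))"

text \<open>
  Elements of \<open>L\<^sup>2\<close> and \<open>H\<^sup>2\<close> are represented by functions, and equality of elements is
  equality almost everywhere. All equations between such functions are therefore stated
  almost everywhere, and operators act on representatives.
\<close>

abbreviation ae_eq :: "(complex \<Rightarrow> complex) \<Rightarrow> (complex \<Rightarrow> complex) \<Rightarrow> bool"
    (infix \<open>\<approx>\<close> 50) where
  "f \<approx> g \<equiv> AE z in circle_measure. f z = g z"

definition L2 :: "(complex \<Rightarrow> complex) set" where
  "L2 = {f \<in> borel_measurable circle_measure.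
           integrable circle_measure (\<lambda>z. (cmod (f z))\<^sup>2)}"

definition L2_inner :: "(complex \<Rightarrow> complex) \<Rightarrow> (complex \<Rightarrow> complex) \<Rightarrow> complex" where
  "L2_inner f g = (LINT z|circle_measure. f z * cnj (g z))"

definition L2_norm :: "(complex \<Rightarrow> complex) \<Rightarrow> real" where
  "L2_norm f = sqrt (LINT z|circle_measure. (cmod (f z))\<^sup>2)"


section \<open>Hardy spaces\<close>

definition hardy2_disk :: "(complex \<Rightarrow> complex) set" where
  "hardy2_disk = {f. f holomorphic_on ball 0 1 \<and>
     (\<exists>M. \<forall>r\<in>{0..<1::real}.
        (LINT z|circle_measure. (cmod (f (of_real r * z)))\<^sup>2) \<le> M)}"

definition hardy_inf_disk :: "(complex \<Rightarrow> complex) set" where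
  "hardy_inf_disk = {f. f holomorphic_on ball 0 1 \<and> bounded (f ` ball 0 1)}"

definition has_boundary_function :: "(complex \<Rightarrow> complex) \<Rightarrow> (complex \<Rightarrow> complex) \<Rightarrow> bool" where
  "has_boundary_function f F \<longleftrightarrow>
     (AE z in circle_measure. ((\<lambda>r::real. f (of_real r * z)) \<longlongrightarrow> F z) (at_left 1))"

text \<open>
  The Hardy spaces as spaces of boundary functions. By Fatou's theorem every function in
  \<open>hardy2_disk\<close> or \<open>hardy_inf_disk\<close> has a boundary function (radial limits), which is unique
  almost everywhere and determines the function on the disk.
\<close>

definition H2 :: "(complex \<Rightarrow> complex) set" where
  "H2 = {F \<in> L2. \<exists>f\<in>hardy2_disk. has_boundary_function f F}"

definition Hinf :: "(complex \<Rightarrow> complex) set" where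
  "Hinf = {F \<in> borel_measurable circle_measure.
             \<exists>f\<in>hardy_inf_disk. has_boundary_function f F}"


section \<open>Operators on \<open>H\<^sup>2\<close>\<close>

definition op_eq :: "((complex \<Rightarrow> complex) \<Rightarrow> complex \<Rightarrow> complex) \<Rightarrow>
    ((complex \<Rightarrow> complex) \<Rightarrow> complex \<Rightarrow> complex) \<Rightarrow> bool" where
  "op_eq S T \<longleftrightarrow> (\<forall>h\<in>H2. S h \<approx> T h)"

text \<open>
  Linearity and boundedness force such a \<open>T\<close> to respect equality almost everywhere, so \<open>T\<close>
  induces an operator on classes. The same holds for \<open>conjugation\<close> below.
\<close>

definition bounded_operator :: "((complex \<Rightarrow> complex) \<Rightarrow> complex \<Rightarrow> complex) \<Rightarrow> bool" where
  "bounded_operator T \<longleftrightarrow>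
     (\<forall>h\<in>H2. T h \<in> H2) \<and>
     (\<forall>x\<in>H2. \<forall>y\<in>H2. \<forall>a b.
        T (\<lambda>z. a * x z + b * y z) \<approx> (\<lambda>z. a * T x z + b * T y z)) \<and>
     (\<exists>M. \<forall>h\<in>H2. L2_norm (T h) \<le> M * L2_norm h)"

text \<open>The choices in the next two definitions are unique almost everywhere.\<close>

definition adjoint_op :: "((complex \<Rightarrow> complex) \<Rightarrow> complex \<Rightarrow> complex) \<Rightarrow>
    (complex \<Rightarrow> complex) \<Rightarrow> complex \<Rightarrow> complex" where
  "adjoint_op T y = (SOME w. w \<in> H2 \<and> (\<forall>x\<in>H2. L2_inner (T x) y = L2_inner x w))"

definition proj_H2 :: "(complex \<Rightarrow> complex) \<Rightarrow> complex \<Rightarrow> complex" where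
  "proj_H2 f = (SOME h. h \<in> H2 \<and> (\<forall>k\<in>H2. L2_inner (\<lambda>z. f z - h z) k = 0))"

definition toeplitz :: "(complex \<Rightarrow> complex) \<Rightarrow> (complex \<Rightarrow> complex) \<Rightarrow> complex \<Rightarrow> complex" where
  "toeplitz \<phi> f = proj_H2 (\<lambda>z. \<phi> z * f z)"


section \<open>Conjugations and symmetry\<close>

definition conjugation :: "((complex \<Rightarrow> complex) \<Rightarrow> complex \<Rightarrow> complex) \<Rightarrow> bool" where
  "conjugation C \<longleftrightarrow>
     (\<forall>h\<in>H2. C h \<in> H2) \<and>
     (\<forall>x\<in>H2. \<forall>y\<in>H2. \<forall>a b.
        C (\<lambda>z. a * x z + b * y z) \<approx> (\<lambda>z. cnj a * C x z + cnj b * C y z)) \<and>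
     (\<forall>h\<in>H2. C (C h) \<approx> h) \<and>
     (\<forall>x\<in>H2. \<forall>y\<in>H2. L2_inner (C x) (C y) = L2_inner y x)"

definition C_symmetric :: "((complex \<Rightarrow> complex) \<Rightarrow> complex \<Rightarrow> complex) \<Rightarrow>
    ((complex \<Rightarrow> complex) \<Rightarrow> complex \<Rightarrow> complex) \<Rightarrow> bool" where
  "C_symmetric C T \<longleftrightarrow> bounded_operator T \<and> op_eq (C \<circ> T \<circ> C) (adjoint_op T)"

text \<open>
  For \<open>\<bar>\<mu>\<bar> = 1\<close>, the map \<open>z \<mapsto> \<mu> * cnj z\<close> preserves both the disk and the circle, so the
  formula for \<open>C\<^sub>\<mu>\<close> on the disk passes to boundary functions.
\<close>

definition C_rot :: "complex \<Rightarrow> (complex \<Rightarrow> complex) \<Rightarrow> complex \<Rightarrow> complex" where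
  "C_rot \<mu> h = (\<lambda>z. cnj (h (\<mu> * cnj z)))"

text \<open>A property of the symbol \<open>\<phi>\<close> of \<open>T\<^sub>\<phi>\<close>.\<close>

definition analytically_symmetric :: "(complex \<Rightarrow> complex) \<Rightarrow> bool" where
  "analytically_symmetric \<phi> \<longleftrightarrow>
     (\<exists>f\<in>Hinf. \<exists>g\<in>Hinf. \<exists>C. conjugation C \<and>
        op_eq (C \<circ> toeplitz f \<circ> C) (toeplitz g) \<and>
        \<phi> \<approx> (\<lambda>z. f z + cnj (g z)))"

definition trigonometric_polynomial :: "(complex \<Rightarrow> complex) \<Rightarrow> bool" where
  "trigonometric_polynomial \<phi> \<longleftrightarrow>
     (\<exists>(S :: int set) c. finite S \<and> (\<forall>z\<in>sphere 0 1. \<phi> z = (\<Sum>n\<in>S. c n * z powi n)))"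

end

theory Submission
  imports
    Defs
    "HOL-Complex_Analysis.Complex_Analysis"
    "HOL-Probability.Probability_Measure"
    "HOL-Computational_Algebra.Fundamental_Theorem_Algebra"
begin

text \<open>
  Both sides of the equivalence say that \<open>\<phi> (\<mu> * cnj z) = \<phi> z\<close> on the circle for some unimodular \<open>\<mu>\<close>.
  For the right-hand side this is a comparison of symbols: conjugating \<open>T\<^sub>\<phi>\<close> by \<open>C_rot \<mu>\<close> reflects and
  conjugates the symbol (\<open>C_rot_symmetric_iff\<close>). If the symmetry holds, then \<open>\<phi> z = f z + f (\<mu> * cnj z)\<close>
  for an analytic polynomial \<open>f\<close>, and \<open>C_rot \<mu>\<close> itself witnesses analytic symmetry.

  The substance is the converse. Let \<open>\<phi> = f + cnj g\<close> and \<open>C T\<^sub>f C = T\<^sub>g\<close>. Comparing Fourier coefficients,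
  \<open>f\<close> and \<open>g\<close> are polynomials, and the relation says \<open>C (f x) = g C x\<close>. The claim is that
  \<open>g z = cnj (f (\<mu> * cnj z))\<close> (\<open>intertwines_rotation\<close>).

  First, \<open>C\<close> respects degrees up to blocks. For a polynomial \<open>h\<close> the space of all \<open>x\<close> with \<open>cnj h x\<close> in \<open>H2\<close>
  is \<open>z\<^sup>n H2\<close>, where \<open>n\<close> is the degree of \<open>h\<close>, and \<open>C\<close> carries this space for \<open>f\<^sup>k\<close> to the one for \<open>g\<^sup>k\<close>
  (\<open>intertwines_cnj\<close>). Therefore \<open>f\<close> and \<open>g\<close> have the same degree \<open>d\<close>, and the matrix of \<open>C\<close> in the basis
  \<open>z\<^sup>j\<close> is block diagonal with blocks of size \<open>d\<close>.

  Second, \<open>C\<close> carries multiplication by \<open>z\<^sup>d\<close> to multiplication by \<open>\<epsilon> z\<^sup>d\<close> with unimodular \<open>\<epsilon>\<close>: the relation determines each block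
  from the preceding one by a map that is \<open>\<epsilon>\<close> times a unipotent one, so the entries of the blocks
  would grow geometrically if \<open>\<epsilon>\<close> or its inverse had modulus above \<open>1\<close>, and polynomially if the blocks were not constant up to powers of \<open>\<epsilon>\<close> (\<open>block_shift\<close>). But the
  entries of an isometry are bounded.

  Third, fix a point \<open>z\<close>. The functional \<open>p \<mapsto> cnj ((C p) z)\<close> on polynomials turns multiplication by \<open>z\<^sup>d\<close>
  and by \<open>f\<close> into multiplication by scalars \<open>\<sigma>\<close> and \<open>cnj (g z)\<close>. It annihilates all multiples of \<open>z\<^sup>d - \<sigma>\<close>,
  and one of these is the product of the differences \<open>f - f(a)\<close> over the roots \<open>a\<close> of \<open>z\<^sup>d - \<sigma>\<close>
  (\<open>common_eigenfunctional\<close>). Hence \<open>cnj (g z)\<close> is one of the \<open>f(a)\<close>, with \<open>a = \<mu> * cnj z\<close> and \<open>\<mu>\<close> from a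
  finite set that is independent of \<open>z\<close>. One \<open>\<mu>\<close> serves infinitely many \<open>z\<close>, hence all \<open>z\<close>.

  The Hardy space enters through Taylor coefficients: Fatou's lemma applied to the remainders of the
  Taylor series shows that boundary functions are the mean square limits of their Taylor polynomials
  (\<open>fourier_boundary\<close>).
\<close>

section \<open>Arc length on the circle\<close>

(* The symbol is ambiguous with the equipotence of sets. *)
no_notation eqpoll (infixl \<open>\<approx>\<close> 50)

lemma space_circle_measure [simp]: "space circle_measure = sphere 0 1"
  by (simp add: circle_measure_def space_restrict_space)

lemma sets_circle_measure [measurable_cong]:
  "sets circle_measure = sets (restrict_space borel (sphere 0 1))"
  by (simp add: circle_measure_def)

lemma borel_measurable_circle_continuous:
  "continuous_on (sphere 0 1) f \<Longrightarrow> f \<in> borel_measurable circle_measure"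
  for f :: "complex \<Rightarrow> 'b::topological_space"
  by (metis borel_measurable_continuous_on_restrict measurable_cong_sets sets_circle_measure)

lemma cis_measurable_circle:
  "(\<lambda>t. cis (2 * pi * t)) \<in> borel \<rightarrow>\<^sub>M restrict_space borel (sphere 0 1)"
  by (intro measurable_restrict_space2)
     (auto intro!: borel_measurable_continuous_onI continuous_intros)

lemma prob_space_circle: "prob_space circle_measure"
proof -
  have "prob_space (uniform_measure lborel {0..<1::real})"
    by (rule prob_space_uniform_measure) auto
  then show ?thesis
    unfolding circle_measure_def
    by (rule prob_space.prob_space_distr) (use cis_measurable_circle in \<open>simp add: measurable_def\<close>)
qed

interpretation circle: prob_space circle_measure
  by (rule prob_space_circle)

lemma nn_integral_circle:
  assumes "u \<in> borel_measurable circle_measure"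
  shows "(\<integral>\<^sup>+z. u z \<partial>circle_measure) = (\<integral>\<^sup>+t. u (cis (2 * pi * t)) * indicator {0..<1} t \<partial>lborel)"
proof -
  have u: "u \<in> borel_measurable (restrict_space borel (sphere 0 1))"
    using assms measurable_cong_sets[OF sets_circle_measure refl] by blast
  have m: "(\<lambda>t. cis (2 * pi * t)) \<in> uniform_measure lborel {0..<1::real} \<rightarrow>\<^sub>M restrict_space borel (sphere 0 1)"
    using cis_measurable_circle by (simp add: measurable_def)
  have u': "(\<lambda>t. u (cis (2 * pi * t))) \<in> borel_measurable lborel"
    using measurable_compose[OF cis_measurable_circle u] by simp
  show ?thesis
    unfolding circle_measure_def
    by (subst nn_integral_distr[OF m], use u in simp, subst nn_integral_uniform_measure)
       (use u' in \<open>auto simp: divide_ennreal_def\<close>)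
qed

text \<open>Reflection carries the period \<open>{0..<1}\<close> to \<open>{a-1<..a}\<close>; moving the part of it to the left of \<open>0\<close> by
\<open>1\<close> restores \<open>{0..<1}\<close>.\<close>
lemma nn_integral_period:
  fixes p :: "real \<Rightarrow> ennreal"
  assumes [measurable]: "p \<in> borel_measurable borel" and per: "\<And>t. p (t + 1) = p t" and "0 \<le> a" "a < 1"
  shows "(\<integral>\<^sup>+t. p (a - t) * indicator {0..<1} t \<partial>lborel) = (\<integral>\<^sup>+t. p t * indicator {0..<1} t \<partial>lborel)"
proof -
  have "(\<integral>\<^sup>+t. p t * indicator {a-1<..a} t \<partial>lborel)
      = ennreal \<bar>-1\<bar> * (\<integral>\<^sup>+t. p (a + (-1) * t) * indicator {a-1<..a} (a + (-1) * t) \<partial>lborel)"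
    by (rule nn_integral_real_affine) auto
  also have "\<dots> = (\<integral>\<^sup>+t. p (a - t) * indicator {0..<1} t \<partial>lborel)"
    by (auto intro!: nn_integral_cong simp: indicator_def)
  finally have 1: "(\<integral>\<^sup>+t. p (a - t) * indicator {0..<1} t \<partial>lborel) = (\<integral>\<^sup>+t. p t * indicator {a-1<..a} t \<partial>lborel)"
    by simp
  have shift: "(\<integral>\<^sup>+t. p t * indicator {a<..<1} t \<partial>lborel) = (\<integral>\<^sup>+t. p t * indicator {a-1<..<0} t \<partial>lborel)"
  proof -
    have "(\<integral>\<^sup>+t. p t * indicator {a<..<1} t \<partial>lborel)
       = ennreal \<bar>1\<bar> * (\<integral>\<^sup>+t. p (1 + 1 * t) * indicator {a<..<1} (1 + 1 * t) \<partial>lborel)"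
      by (rule nn_integral_real_affine) auto
    also have "\<dots> = (\<integral>\<^sup>+t. p t * indicator {a-1<..<0} t \<partial>lborel)"
      using per by (auto intro!: nn_integral_cong simp: indicator_def add.commute)
    finally show ?thesis .
  qed
  have "(\<integral>\<^sup>+t. p t * indicator {a-1<..a} t \<partial>lborel)
     = (\<integral>\<^sup>+t. p t * indicator {a-1<..<0} t + p t * indicator {0..a} t \<partial>lborel)"
    using assms by (auto intro!: nn_integral_cong simp: indicator_def)
  also have "\<dots> = (\<integral>\<^sup>+t. p t * indicator {a<..<1} t \<partial>lborel) + (\<integral>\<^sup>+t. p t * indicator {0..a} t \<partial>lborel)"
    by (subst nn_integral_add) (auto simp: shift)
  also have "\<dots> = (\<integral>\<^sup>+t. p t * indicator {a<..<1} t + p t * indicator {0..a} t \<partial>lborel)"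
    by (subst nn_integral_add) auto
  also have "\<dots> = (\<integral>\<^sup>+t. p t * indicator {0..<1} t \<partial>lborel)"
    using assms by (auto intro!: nn_integral_cong simp: indicator_def)
  finally show ?thesis using 1 by simp
qed

lemma reflect_measurable:
  assumes "\<mu> \<in> sphere 0 1"
  shows "(\<lambda>z. \<mu> * cnj z) \<in> circle_measure \<rightarrow>\<^sub>M circle_measure"
proof -
  have "(\<lambda>z. \<mu> * cnj z) \<in> restrict_space borel (sphere 0 1) \<rightarrow>\<^sub>M restrict_space borel (sphere 0 1)"
    by (intro measurable_restrict_space2 borel_measurable_continuous_on_restrict continuous_intros)
       (use assms in \<open>auto simp: norm_mult space_restrict_space\<close>)
  then show ?thesis
    using measurable_cong_sets[OF sets_circle_measure sets_circle_measure] by blast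
qed

text \<open>In the angle, measured in turns, the map is \<open>t \<mapsto> a - t\<close> modulo \<open>1\<close>. The composite of a rotation with
complex conjugation is the form in which invariance is used, as it is the substitution in \<open>C_rot\<close>.\<close>
lemma distr_reflect:
  assumes "\<mu> \<in> sphere 0 1"
  shows "distr circle_measure circle_measure (\<lambda>z. \<mu> * cnj z) = circle_measure"
proof (rule measure_eqI)
  fix A assume "A \<in> sets (distr circle_measure circle_measure (\<lambda>z. \<mu> * cnj z))"
  then have A [measurable]: "A \<in> sets circle_measure" by simp
  obtain b where b: "\<mu> = cis b"
    using assms by (metis complex_norm_eq_1_exp dist_0_norm mem_sphere cis_conv_exp)
  define a where "a = frac (b / (2 * pi))"
  have a: "0 \<le> a" "a < 1" by (auto simp: a_def frac_lt_1)
  have \<mu>: "\<mu> = cis (2 * pi * a)"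
  proof -
    have "b = 2 * pi * a + 2 * pi * of_int \<lfloor>b / (2 * pi)\<rfloor>"
      by (simp add: a_def frac_def field_simps)
    then have "cis b = cis (2 * pi * a) * cis (2 * pi * of_int \<lfloor>b / (2 * pi)\<rfloor>)"
      by (metis cis_mult)
    then show ?thesis using b by simp
  qed
  note m = reflect_measurable[OF assms]
  define p :: "real \<Rightarrow> ennreal" where "p = (\<lambda>t. indicator A (cis (2 * pi * t)))"
  have pm: "p \<in> borel_measurable borel"
    unfolding p_def
    by (rule measurable_compose[OF cis_measurable_circle])
       (use A in \<open>simp add: sets_circle_measure\<close>)
  have per: "p (t + 1) = p t" for t
  proof -
    have "cis (2 * pi * (t + 1)) = cis (2 * pi * t) * cis (2 * pi)" by (simp add: cis_mult algebra_simps)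
    then show ?thesis by (simp add: p_def)
  qed
  have "emeasure (distr circle_measure circle_measure (\<lambda>z. \<mu> * cnj z)) A
      = (\<integral>\<^sup>+z. indicator A z \<partial>distr circle_measure circle_measure (\<lambda>z. \<mu> * cnj z))"
    using A by simp
  also have "\<dots> = (\<integral>\<^sup>+z. indicator A (\<mu> * cnj z) \<partial>circle_measure)"
    by (rule nn_integral_distr[OF m]) (use A in simp)
  also have "\<dots> = (\<integral>\<^sup>+t. indicator A (\<mu> * cnj (cis (2 * pi * t))) * indicator {0..<1} t \<partial>lborel)"
    by (rule nn_integral_circle) (use m A in measurable)
  also have "\<dots> = (\<integral>\<^sup>+t. p (a - t) * indicator {0..<1} t \<partial>lborel)"
    by (simp add: p_def \<mu> cis_mult cis_cnj algebra_simps)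
  also have "\<dots> = (\<integral>\<^sup>+t. p t * indicator {0..<1} t \<partial>lborel)"
    by (rule nn_integral_period[OF pm per a])
  also have "\<dots> = (\<integral>\<^sup>+z. indicator A z \<partial>circle_measure)"
    unfolding p_def by (rule nn_integral_circle[symmetric]) (use A in simp)
  also have "\<dots> = emeasure circle_measure A" using A by simp
  finally show "emeasure (distr circle_measure circle_measure (\<lambda>z. \<mu> * cnj z)) A = emeasure circle_measure A" .
qed simp

lemma integral_reflect:
  fixes u :: "complex \<Rightarrow> complex"
  assumes "\<mu> \<in> sphere 0 1" "u \<in> borel_measurable circle_measure"
  shows "(LINT z|circle_measure. u (\<mu> * cnj z)) = (LINT z|circle_measure. u z)"
  using integral_distr[OF reflect_measurable[OF assms(1)] assms(2)] distr_reflect[OF assms(1)] by simp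

lemma AE_reflect:
  assumes "\<mu> \<in> sphere 0 1" "AE z in circle_measure. R z"
  shows "AE z in circle_measure. R (\<mu> * cnj z)"
proof -
  obtain N where N: "N \<in> null_sets circle_measure" "{z \<in> space circle_measure. \<not> R z} \<subseteq> N"
    using assms(2) by (auto simp: eventually_ae_filter)
  define N' where "N' = (\<lambda>z. \<mu> * cnj z) -` N \<inter> space circle_measure"
  note m = reflect_measurable[OF assms(1)]
  have "emeasure circle_measure N' = emeasure (distr circle_measure circle_measure (\<lambda>z. \<mu> * cnj z)) N"
    unfolding N'_def using N m by (subst emeasure_distr) auto
  then have "N' \<in> null_sets circle_measure"
    using N measurable_sets[OF m, of N] distr_reflect[OF assms(1)] unfolding N'_def null_sets_def by simp
  moreover have "{z \<in> space circle_measure. \<not> R (\<mu> * cnj z)} \<subseteq> N'"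
    using subsetD[OF N(2)] assms(1) unfolding N'_def by (auto simp: norm_mult)
  ultimately show ?thesis by (auto simp: eventually_ae_filter)
qed

lemma AE_circleI: "(\<And>z. cmod z = 1 \<Longrightarrow> R z) \<Longrightarrow> AE z in circle_measure. R z"
  by (rule AE_I2) simp

lemma cnj_powi_circle: "cmod z = 1 \<Longrightarrow> cnj (z powi n) = z powi (- n)"
proof -
  assume "cmod z = 1"
  then have "z * cnj z = 1" by (simp flip: complex_norm_square)
  then have "cnj z = inverse z" by (simp add: inverse_unique)
  then show ?thesis by (simp add: power_int_minus power_int_inverse)
qed

lemma continuous_powi_circle: "continuous_on (sphere 0 1) (\<lambda>z::complex. z powi n)"
  by (intro continuous_intros) auto

text \<open>Substituting \<open>\<mu> * cnj z\<close> gives \<open>I = \<mu>\<^sup>n J\<close>, where \<open>J\<close> is the integral of the conjugate and does not depend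
on \<open>\<mu>\<close>. Two choices of \<open>\<mu>\<close> with opposite powers \<open>\<mu>\<^sup>n\<close> force \<open>I = 0\<close>.\<close>
lemma integral_powi_circle:
  "(LINT z|circle_measure. z powi n) = (if n = 0 then 1 else 0)"
proof (cases "n = 0")
  case True
  then show ?thesis using circle.prob_space by simp
next
  case False
  define I where "I = (LINT z|circle_measure. z powi n)"
  define J where "J = (LINT z|circle_measure. cnj z powi n)"
  have meas: "(\<lambda>z. z powi n) \<in> borel_measurable circle_measure"
    by (rule borel_measurable_circle_continuous[OF continuous_powi_circle])
  have sub: "I = \<mu> powi n * J" if "\<mu> \<in> sphere 0 1" for \<mu>
    using integral_reflect[OF that meas] by (simp add: I_def J_def power_int_mult_distrib)
  define \<mu> where "\<mu> = cis (pi / of_int n)"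
  have "\<mu> powi n = -1" using False by (simp add: \<mu>_def cis_power_int)
  then have "I = - J" using sub[of \<mu>] by (simp add: \<mu>_def)
  moreover have "I = J" using sub[of 1] by simp
  ultimately show ?thesis using False by (simp add: I_def)
qed

section \<open>Square integrable functions\<close>

lemma L2_measurable: "F \<in> L2 \<Longrightarrow> F \<in> borel_measurable circle_measure"
  and L2_integrable: "F \<in> L2 \<Longrightarrow> integrable circle_measure (\<lambda>z. (cmod (F z))\<^sup>2)"
  by (auto simp: L2_def)

lemma L2_cong:
  assumes "F \<in> L2" "G \<in> borel_measurable circle_measure" "F \<approx> G"
  shows "G \<in> L2"
proof -
  have "integrable circle_measure (\<lambda>z. (cmod (G z))\<^sup>2)"
    by (rule integrable_cong_AE_imp[OF L2_integrable[OF assms(1)]]) (use assms in auto)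
  then show ?thesis using assms by (simp add: L2_def)
qed

lemma L2_add:
  assumes "F \<in> L2" "G \<in> L2"
  shows "(\<lambda>z. F z + G z) \<in> L2"
proof -
  note [measurable] = L2_measurable[OF assms(1)] L2_measurable[OF assms(2)]
  have "integrable circle_measure (\<lambda>z. (cmod (F z + G z))\<^sup>2)"
  proof (rule Bochner_Integration.integrable_bound)
    show "integrable circle_measure (\<lambda>z. 2 * (cmod (F z))\<^sup>2 + 2 * (cmod (G z))\<^sup>2)"
      using assms by (intro Bochner_Integration.integrable_add integrable_mult_right L2_integrable)
    have "(cmod (F z + G z))\<^sup>2 \<le> 2 * (cmod (F z))\<^sup>2 + 2 * (cmod (G z))\<^sup>2" for z
    proof -
      have "(cmod (F z + G z))\<^sup>2 \<le> (cmod (F z) + cmod (G z))\<^sup>2"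
        by (intro power_mono norm_triangle_ineq) auto
      also have "\<dots> \<le> 2 * (cmod (F z))\<^sup>2 + 2 * (cmod (G z))\<^sup>2"
        using sum_squares_bound[of "cmod (F z)" "cmod (G z)"] by (simp add: power2_sum)
      finally show ?thesis .
    qed
    then show "AE z in circle_measure. norm ((cmod (F z + G z))\<^sup>2) \<le> norm (2 * (cmod (F z))\<^sup>2 + 2 * (cmod (G z))\<^sup>2)"
      by simp
  qed simp
  then show ?thesis by (simp add: L2_def)
qed

lemma L2_mult_bounded:
  assumes "F \<in> L2" "u \<in> borel_measurable circle_measure" "\<And>z. cmod z = 1 \<Longrightarrow> cmod (u z) \<le> B"
  shows "(\<lambda>z. u z * F z) \<in> L2"
proof -
  note [measurable] = L2_measurable[OF assms(1)] assms(2)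
  have "integrable circle_measure (\<lambda>z. (cmod (u z * F z))\<^sup>2)"
  proof (rule Bochner_Integration.integrable_bound)
    show "integrable circle_measure (\<lambda>z. B\<^sup>2 * (cmod (F z))\<^sup>2)"
      using assms by (intro integrable_mult_right L2_integrable)
    show "AE z in circle_measure. norm ((cmod (u z * F z))\<^sup>2) \<le> norm (B\<^sup>2 * (cmod (F z))\<^sup>2)"
      using assms(3) by (intro AE_circleI) (auto simp: norm_mult power_mult_distrib intro!: mult_right_mono power_mono)
  qed simp
  then show ?thesis by (simp add: L2_def)
qed

lemma bounded_on_circle:
  assumes "continuous_on (sphere 0 1) u"
  obtains B where "\<And>z. cmod z = 1 \<Longrightarrow> cmod (u z) \<le> B"
proof -
  have "compact (u ` sphere 0 1)" using assms by (intro compact_continuous_image) auto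
  then obtain B where "\<forall>y\<in>u ` sphere 0 1. norm y \<le> B"
    using compact_imp_bounded bounded_iff by metis
  then show ?thesis using that[of B] by simp
qed

lemma L2_mult_continuous:
  assumes "F \<in> L2" "continuous_on (sphere 0 1) u"
  shows "(\<lambda>z. u z * F z) \<in> L2"
proof -
  obtain B where "\<And>z. cmod z = 1 \<Longrightarrow> cmod (u z) \<le> B"
    using bounded_on_circle[OF assms(2)] by blast
  then show ?thesis
    by (rule L2_mult_bounded[OF assms(1) borel_measurable_circle_continuous[OF assms(2)]])
qed

lemma L2_const: "(\<lambda>z. a) \<in> L2"
  by (simp add: L2_def)

lemma L2_continuous: "continuous_on (sphere 0 1) u \<Longrightarrow> u \<in> L2"
  using L2_mult_continuous[OF L2_const[of 1]] by simp

lemma L2_scale: "F \<in> L2 \<Longrightarrow> (\<lambda>z. a * F z) \<in> L2"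
  by (rule L2_mult_continuous) auto

lemma L2_lincomb: "F \<in> L2 \<Longrightarrow> G \<in> L2 \<Longrightarrow> (\<lambda>z. a * F z + b * G z) \<in> L2"
  by (intro L2_add L2_scale)

lemma L2_diff: "F \<in> L2 \<Longrightarrow> G \<in> L2 \<Longrightarrow> (\<lambda>z. F z - G z) \<in> L2"
  using L2_lincomb[of F G 1 "-1"] by simp

lemma L2_sum: "(\<And>i. i \<in> I \<Longrightarrow> F i \<in> L2) \<Longrightarrow> (\<lambda>z. \<Sum>i\<in>I. F i z) \<in> L2"
  by (induction I rule: infinite_finite_induct) (auto intro: L2_add L2_const)

lemma L2_powi: "(\<lambda>z. z powi n) \<in> L2"
  by (intro L2_continuous continuous_powi_circle)

lemma integrable_inner:
  assumes "F \<in> L2" "G \<in> L2"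
  shows "integrable circle_measure (\<lambda>z. F z * cnj (G z))"
proof (rule Bochner_Integration.integrable_bound)
  note [measurable] = L2_measurable[OF assms(1)] L2_measurable[OF assms(2)]
  show "(\<lambda>z. F z * cnj (G z)) \<in> borel_measurable circle_measure"
  proof (rule borel_measurable_times)
    show "(\<lambda>z. cnj (G z)) \<in> borel_measurable circle_measure"
      by (rule measurable_compose[OF L2_measurable[OF assms(2)] borel_measurable_continuous_onI])
         (intro continuous_intros)
  qed simp
  show "integrable circle_measure (\<lambda>z. (cmod (F z))\<^sup>2 + (cmod (G z))\<^sup>2)"
    using assms by (intro Bochner_Integration.integrable_add L2_integrable)
  have "cmod (F z) * cmod (G z) \<le> (cmod (F z))\<^sup>2 + (cmod (G z))\<^sup>2" for z
    proof -
    have "0 \<le> cmod (F z) * cmod (G z)" by simp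
    then show ?thesis using sum_squares_bound[of "cmod (F z)" "cmod (G z)"] by linarith
  qed
  then show "AE z in circle_measure. norm (F z * cnj (G z)) \<le> norm ((cmod (F z))\<^sup>2 + (cmod (G z))\<^sup>2)"
    by (simp add: norm_mult)
qed

lemma L2_inner_add_left:
  "F \<in> L2 \<Longrightarrow> F' \<in> L2 \<Longrightarrow> G \<in> L2 \<Longrightarrow> L2_inner (\<lambda>z. F z + F' z) G = L2_inner F G + L2_inner F' G"
  by (simp add: L2_inner_def distrib_right integrable_inner)

lemma L2_inner_scale_left: "L2_inner (\<lambda>z. a * F z) G = a * L2_inner F G"
  by (simp add: L2_inner_def mult.assoc)

lemma L2_inner_lincomb_left:
  "F \<in> L2 \<Longrightarrow> F' \<in> L2 \<Longrightarrow> G \<in> L2 \<Longrightarrow>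
    L2_inner (\<lambda>z. a * F z + b * F' z) G = a * L2_inner F G + b * L2_inner F' G"
  by (simp add: L2_inner_add_left L2_scale L2_inner_scale_left)

lemma L2_inner_diff_left:
  "F \<in> L2 \<Longrightarrow> F' \<in> L2 \<Longrightarrow> G \<in> L2 \<Longrightarrow> L2_inner (\<lambda>z. F z - F' z) G = L2_inner F G - L2_inner F' G"
  using L2_inner_lincomb_left[of F F' G 1 "-1"] by simp

lemma L2_inner_sum_left:
  "finite I \<Longrightarrow> (\<And>i. i \<in> I \<Longrightarrow> F i \<in> L2) \<Longrightarrow> G \<in> L2 \<Longrightarrow>
    L2_inner (\<lambda>z. \<Sum>i\<in>I. F i z) G = (\<Sum>i\<in>I. L2_inner (F i) G)"
proof (induction I rule: finite_induct)
  case empty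
  then show ?case by (simp add: L2_inner_def)
next
  case (insert i I)
  then show ?case by (simp add: L2_inner_add_left L2_sum)
qed

lemma L2_inner_commute: "L2_inner G F = cnj (L2_inner F G)"
proof -
  have "cnj (L2_inner F G) = (LINT z|circle_measure. cnj (F z * cnj (G z)))"
    unfolding L2_inner_def by (rule Bochner_Integration.integral_cnj[symmetric])
  then show ?thesis by (simp add: L2_inner_def mult.commute)
qed

lemma L2_inner_diff_right:
  "F \<in> L2 \<Longrightarrow> F' \<in> L2 \<Longrightarrow> G \<in> L2 \<Longrightarrow> L2_inner G (\<lambda>z. F z - F' z) = L2_inner G F - L2_inner G F'"
  by (simp add: L2_inner_commute[of G] L2_inner_diff_left)

lemma L2_inner_mult_left: "L2_inner (\<lambda>z. u z * F z) G = L2_inner F (\<lambda>z. cnj (u z) * G z)"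
  by (simp add: L2_inner_def mult_ac)

lemma L2_inner_cong:
  assumes "F \<in> L2" "G \<in> L2" "F' \<in> L2" "G' \<in> L2" "F \<approx> F'" "G \<approx> G'"
  shows "L2_inner F G = L2_inner F' G'"
  unfolding L2_inner_def
proof (rule integral_cong_AE)
  show "AE z in circle_measure. F z * cnj (G z) = F' z * cnj (G' z)"
    using assms(5,6) by eventually_elim auto
qed (use integrable_inner[OF assms(1,2)] integrable_inner[OF assms(3,4)] in auto)

lemma L2_inner_self: "L2_inner F F = of_real (LINT z|circle_measure. (cmod (F z))\<^sup>2)"
  unfolding L2_inner_def by (simp add: complex_norm_square[symmetric] flip: of_real_power)

lemma L2_inner_self_norm: "L2_inner F F = of_real ((L2_norm F)\<^sup>2)"
  by (simp add: L2_inner_self L2_norm_def)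

lemma AE_zero_if_inner_self_zero:
  assumes "F \<in> L2" "L2_inner F F = 0"
  shows "F \<approx> (\<lambda>z. 0)"
proof -
  have "(LINT z|circle_measure. (cmod (F z))\<^sup>2) = 0"
    using assms(2) by (simp add: L2_inner_self)
  then have "AE z in circle_measure. (cmod (F z))\<^sup>2 = 0"
    using integral_nonneg_eq_0_iff_AE[OF L2_integrable[OF assms(1)]] by simp
  then show ?thesis by simp
qed

lemma L2_inner_powi: "L2_inner (\<lambda>z. z powi m) (\<lambda>z. z powi n) = (if m = n then 1 else 0)"
proof -
  have "L2_inner (\<lambda>z. z powi m) (\<lambda>z. z powi n) = (LINT z|circle_measure. z powi (m - n))"
    unfolding L2_inner_def
  proof (rule Bochner_Integration.integral_cong[OF refl])
    fix z assume "z \<in> space circle_measure"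
    then have "cmod z = 1" by simp
    moreover from this have "z \<noteq> 0" by auto
    ultimately show "z powi m * cnj (z powi n) = z powi (m - n)"
      by (simp only: cnj_powi_circle) (simp flip: power_int_add)
  qed
  then show ?thesis by (simp add: integral_powi_circle)
qed

text \<open>The component of \<open>F\<close> along the unit vector \<open>E\<close> is orthogonal to the remainder, so the squares of the
norms add up.\<close>
lemma bessel_single:
  assumes "F \<in> L2" "E \<in> L2" "L2_inner E E = 1"
  shows "(cmod (L2_inner F E))\<^sup>2 \<le> (LINT z|circle_measure. (cmod (F z))\<^sup>2)"
proof -
  define a where "a = L2_inner F E"
  define G where "G = (\<lambda>z. F z - a * E z)"
  have G: "G \<in> L2" "(\<lambda>z. a * E z) \<in> L2" unfolding G_def using assms by (auto intro: L2_diff L2_scale)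
  have orth: "L2_inner G E = 0"
    unfolding G_def using assms G by (simp add: L2_inner_diff_left L2_inner_scale_left a_def)
  have "L2_inner G G = L2_inner G F - L2_inner G (\<lambda>z. a * E z)"
    using assms G by (subst G_def(1)) (simp add: L2_inner_diff_right G_def)
  also have "L2_inner G (\<lambda>z. a * E z) = 0"
    by (metis L2_inner_commute L2_inner_scale_left complex_cnj_zero mult_zero_right orth)
  also have "L2_inner G F - 0 = L2_inner F F - a * cnj a"
    unfolding G_def using assms G
    by (simp add: L2_inner_diff_left L2_inner_scale_left) (metis L2_inner_commute a_def)
  finally have "of_real (LINT z|circle_measure. (cmod (G z))\<^sup>2) = of_real (LINT z|circle_measure. (cmod (F z))\<^sup>2) - complex_of_real ((cmod a)\<^sup>2)"
    by (simp only: L2_inner_self complex_norm_square)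
  then have "(LINT z|circle_measure. (cmod (G z))\<^sup>2) = (LINT z|circle_measure. (cmod (F z))\<^sup>2) - (cmod a)\<^sup>2"
    by (metis of_real_diff of_real_eq_iff)
  moreover have "(LINT z|circle_measure. (cmod (G z))\<^sup>2) \<ge> 0" by simp
  ultimately show ?thesis by (simp add: a_def)
qed

section \<open>Boundary functions and power series\<close>

lemma AE_summable_powi: "summable (\<lambda>n. cmod (c n)) \<Longrightarrow> AE z in circle_measure. summable (\<lambda>n. norm (c n * z ^ n * w z))"
  if "\<And>z. cmod z = 1 \<Longrightarrow> cmod (w z) \<le> B"
proof (rule AE_circleI)
  fix z :: complex assume c: "summable (\<lambda>n. cmod (c n))" and z: "cmod z = 1"
  have "norm (norm (c n * z ^ n * w z)) \<le> cmod (c n) * B" for n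
    using that[OF z] z by (simp add: norm_mult norm_power mult_left_mono)
  then show "summable (\<lambda>n. norm (c n * z ^ n * w z))"
    by (intro summable_comparison_test'[OF summable_mult2[OF c]])
qed

text \<open>Absolute convergence of the coefficients dominates the series uniformly on the circle, so it may be
integrated term by term.\<close>
lemma inner_abs_series:
  assumes c: "summable (\<lambda>n. cmod (c n))"
    and k: "k \<in> borel_measurable circle_measure" "\<And>z. cmod z = 1 \<Longrightarrow> cmod (k z) \<le> B"
  shows "(\<lambda>n. c n * L2_inner (\<lambda>z. z ^ n) k) sums L2_inner (\<lambda>z. \<Sum>n. c n * z ^ n) k"
proof -
  have kL2: "k \<in> L2"
    using L2_mult_bounded[OF L2_const[of 1] k] by simp
  have pL2: "(\<lambda>z. z ^ n) \<in> L2" for n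
    using L2_powi[of "int n"] by simp
  have int: "integrable circle_measure (\<lambda>z. c n * z ^ n * cnj (k z))" for n
    using integrable_mult_right[OF integrable_inner[OF pL2[of n] kL2], of "c n"] by (simp add: mult.assoc)
  have bd: "(LINT z|circle_measure. norm (c n * z ^ n * cnj (k z))) \<le> cmod (c n) * B" for n
  proof -
    have "(LINT z|circle_measure. norm (c n * z ^ n * cnj (k z))) \<le> (LINT z|circle_measure. cmod (c n) * B)"
      using k(2) by (intro integral_mono_AE integrable_norm int) (auto intro!: AE_circleI mult_left_mono simp: norm_mult norm_power)
    then show ?thesis using circle.prob_space by simp
  qed
  have S: "summable (\<lambda>n. LINT z|circle_measure. norm (c n * z ^ n * cnj (k z)))"
    by (rule summable_comparison_test'[OF summable_mult2[OF c, of B]]) (use bd in simp)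
  have A: "AE z in circle_measure. summable (\<lambda>n. norm (c n * z ^ n * cnj (k z)))"
    by (rule AE_summable_powi[OF _ c, of _ B]) (use k in simp)
  have "(\<lambda>n. LINT z|circle_measure. c n * z ^ n * cnj (k z)) sums (LINT z|circle_measure. (\<Sum>n. c n * z ^ n * cnj (k z)))"
    by (rule sums_integral[OF int A S])
  moreover have "(LINT z|circle_measure. (\<Sum>n. c n * z ^ n * cnj (k z))) = L2_inner (\<lambda>z. \<Sum>n. c n * z ^ n) k"
    unfolding L2_inner_def
  proof (rule Bochner_Integration.integral_cong[OF refl])
    fix z assume "z \<in> space circle_measure"
    then have "cmod z = 1" by simp
    then have "summable (\<lambda>n. c n * z ^ n)"
      by (intro summable_norm_cancel[OF summable_comparison_test'[OF c]]) (simp add: norm_mult norm_power)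
    then show "(\<Sum>n. c n * z ^ n * cnj (k z)) = (\<Sum>n. c n * z ^ n) * cnj (k z)"
      by (rule suminf_mult2[symmetric])
  qed
  ultimately show ?thesis
    by (simp add: L2_inner_def mult.assoc)
qed

text \<open>Parseval's identity, by integrating the series term by term against its own sum.\<close>
lemma norm_abs_series:
  assumes c: "summable (\<lambda>n. cmod (c n))"
  shows "(\<lambda>n. (cmod (c n))\<^sup>2) sums (LINT z|circle_measure. (cmod (\<Sum>n. c n * z ^ n))\<^sup>2)"
proof -
  define G where "G = (\<lambda>z. \<Sum>n. c n * z ^ n)"
  have summ: "summable (\<lambda>n. c n * z ^ n)" and bnd: "cmod (G z) \<le> (\<Sum>n. cmod (c n))" if "cmod z = 1" for z
  proof -
    have s: "summable (\<lambda>n. norm (c n * z ^ n))"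
      using that c by (simp add: norm_mult norm_power)
    then show "summable (\<lambda>n. c n * z ^ n)" by (rule summable_norm_cancel)
    show "cmod (G z) \<le> (\<Sum>n. cmod (c n))"
      unfolding G_def using summable_norm[OF s] that by (simp add: norm_mult norm_power)
  qed
  have pm: "(\<lambda>z. c n * z ^ n) \<in> borel_measurable circle_measure" for n
    by (intro borel_measurable_circle_continuous continuous_intros)
  have Gm: "G \<in> borel_measurable circle_measure"
    unfolding G_def by (rule borel_measurable_suminf[OF pm])
  have coeff: "L2_inner G (\<lambda>z. z ^ m) = c m" for m
  proof -
    have "(\<lambda>n. c n * L2_inner (\<lambda>z. z ^ n) (\<lambda>z. z ^ m)) sums L2_inner G (\<lambda>z. z ^ m)"
      unfolding G_def
      by (rule inner_abs_series[OF c, of _ 1])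
         (auto intro!: borel_measurable_circle_continuous continuous_intros simp: norm_power)
    moreover have "(\<lambda>n. c n * L2_inner (\<lambda>z. z ^ n) (\<lambda>z. z ^ m)) = (\<lambda>n. if n = m then c n else 0)"
      using L2_inner_powi[of "int n" "int m" for n] by auto
    ultimately show ?thesis
      using sums_single[of m c] sums_unique2 by auto
  qed
  have "(\<lambda>n. c n * L2_inner (\<lambda>z. z ^ n) G) sums L2_inner G G"
    by (subst (2) G_def, rule inner_abs_series[OF c Gm bnd])
  then have "(\<lambda>n. c n * cnj (c n)) sums L2_inner G G"
    by (subst (asm) L2_inner_commute) (simp add: coeff)
  then have "(\<lambda>n. Re (c n * cnj (c n))) sums Re (L2_inner G G)"
    by (rule sums_Re)
  then show ?thesis
    by (simp add: L2_inner_self G_def complex_norm_square[symmetric] flip: of_real_power)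
qed

lemma radial_mean:
  assumes a: "\<And>w. cmod w < 1 \<Longrightarrow> (\<lambda>n. a n * w ^ n) sums f w" and r: "0 \<le> r" "r < 1"
  shows "(\<lambda>n. (cmod (a n))\<^sup>2 * (r\<^sup>2) ^ n) sums (LINT z|circle_measure. (cmod (f (of_real r * z)))\<^sup>2)"
proof -
  obtain s where s: "r < s" "s < 1" using r dense by blast
  have "summable (\<lambda>n. a n * of_real s ^ n)"
    using a[of "of_real s"] s r by (auto simp: sums_iff)
  then have c: "summable (\<lambda>n. norm (a n * of_real r ^ n))"
    by (rule powser_insidea) (use s r in auto)
  have "(\<lambda>n. (cmod (a n * of_real r ^ n))\<^sup>2) sums
      (LINT z|circle_measure. (cmod (\<Sum>n. a n * of_real r ^ n * z ^ n))\<^sup>2)"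
    by (rule norm_abs_series[OF c])
  moreover have "(\<Sum>n. a n * of_real r ^ n * z ^ n) = f (of_real r * z)" if "z \<in> sphere 0 1" for z
    using a[of "of_real r * z"] that r
    by (simp add: sums_iff norm_mult power_mult_distrib mult.assoc)
  then have "(LINT z|circle_measure. (cmod (\<Sum>n. a n * of_real r ^ n * z ^ n))\<^sup>2)
     = (LINT z|circle_measure. (cmod (f (of_real r * z)))\<^sup>2)"
    by (intro Bochner_Integration.integral_cong) auto
  moreover have "(cmod (a n * of_real r ^ n))\<^sup>2 = (cmod (a n))\<^sup>2 * (r\<^sup>2) ^ n" for n
    using r by (simp add: norm_mult norm_power power_mult_distrib mult.commute flip: power_mult)
  ultimately show ?thesis by simp
qed

text \<open>The description of \<open>hardy2_disk\<close> by square summable Taylor coefficients. It turns linear combinations,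
shifts and division by powers of the variable into operations on coefficient sequences.\<close>
definition hardy_series :: "(complex \<Rightarrow> complex) \<Rightarrow> (nat \<Rightarrow> complex) \<Rightarrow> bool" where
  "hardy_series f a \<longleftrightarrow> (\<forall>w. cmod w < 1 \<longrightarrow> (\<lambda>n. a n * w ^ n) sums f w) \<and> summable (\<lambda>n. (cmod (a n))\<^sup>2)"

lemma hardy_series_mean_le:
  assumes "hardy_series f a" "0 \<le> r" "r < 1"
  shows "(LINT z|circle_measure. (cmod (f (of_real r * z)))\<^sup>2) \<le> (\<Sum>n. (cmod (a n))\<^sup>2)"
proof -
  have 1: "(\<lambda>n. (cmod (a n))\<^sup>2 * (r\<^sup>2) ^ n) sums (LINT z|circle_measure. (cmod (f (of_real r * z)))\<^sup>2)"
    by (rule radial_mean) (use assms in \<open>auto simp: hardy_series_def\<close>)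
  have "(cmod (a n))\<^sup>2 * (r\<^sup>2) ^ n \<le> (cmod (a n))\<^sup>2" for n
    using assms by (intro mult_left_le) (auto simp: power_le_one)
  then show ?thesis
    using suminf_le[OF _ sums_summable[OF 1]] assms(1) sums_unique[OF 1] by (simp add: hardy_series_def)
qed

text \<open>By Parseval on the circle of radius \<open>r\<close>, the mean is \<open>\<Sum>n. |a\<^sub>n|\<^sup>2 r\<^sup>2\<^sup>n\<close>; letting \<open>r\<close> tend to \<open>1\<close> in its
partial sums, a bound on the means becomes a bound on the sums of \<open>|a\<^sub>n|\<^sup>2\<close>.\<close>
lemma hardy2_disk_iff: "f \<in> hardy2_disk \<longleftrightarrow> (\<exists>a. hardy_series f a)"
proof
  assume f: "f \<in> hardy2_disk"
  define a where "a = (\<lambda>n. (deriv ^^ n) f 0 / fact n)"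
  have a: "(\<lambda>n. a n * w ^ n) sums f w" if "cmod w < 1" for w
    using holomorphic_power_series[of f 0 1 w] f that by (simp add: hardy2_disk_def a_def)
  obtain M where "\<forall>r\<in>{0..<1::real}. (LINT z|circle_measure. (cmod (f (of_real r * z)))\<^sup>2) \<le> M"
    using f unfolding hardy2_disk_def by blast
  then have M: "(LINT z|circle_measure. (cmod (f (of_real r * z)))\<^sup>2) \<le> M" if "0 \<le> r" "r < 1" for r
    using that by simp
  have "(\<Sum>n<N. (cmod (a n))\<^sup>2) \<le> M" for N
  proof (rule tendsto_upperbound)
    show "((\<lambda>r::real. \<Sum>n<N. (cmod (a n))\<^sup>2 * (r\<^sup>2) ^ n) \<longlongrightarrow> (\<Sum>n<N. (cmod (a n))\<^sup>2)) (at_left 1)"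
      by (rule tendsto_eq_intros refl)+ simp
    have "eventually (\<lambda>r::real. 0 \<le> r \<and> r < 1) (at_left 1)"
      using eventually_at_left_real[of 0 "1::real"] by (auto elim: eventually_mono)
    then show "\<forall>\<^sub>F r in at_left 1. (\<Sum>n<N. (cmod (a n))\<^sup>2 * (r\<^sup>2) ^ n) \<le> M"
    proof eventually_elim
      case (elim r)
      have 1: "(\<lambda>n. (cmod (a n))\<^sup>2 * (r\<^sup>2) ^ n) sums (LINT z|circle_measure. (cmod (f (of_real r * z)))\<^sup>2)"
        by (rule radial_mean) (use a elim in auto)
      have "(\<Sum>n<N. (cmod (a n))\<^sup>2 * (r\<^sup>2) ^ n) \<le> (\<Sum>n. (cmod (a n))\<^sup>2 * (r\<^sup>2) ^ n)"
        by (rule sum_le_suminf[OF sums_summable[OF 1]]) auto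
      also have "\<dots> \<le> M" using M[of r] elim sums_unique[OF 1] by linarith
      finally show ?case .
    qed
  qed simp
  then have "summable (\<lambda>n. (cmod (a n))\<^sup>2)"
    by (intro summableI_nonneg_bounded) auto
  with a show "\<exists>a. hardy_series f a" by (auto simp: hardy_series_def)
next
  assume "\<exists>a. hardy_series f a"
  then obtain a where a: "hardy_series f a" ..
  have "f holomorphic_on ball 0 1"
    by (rule power_series_holomorphic[where a=a]) (use a in \<open>auto simp: hardy_series_def\<close>)
  moreover have "\<forall>r\<in>{0..<1::real}. (LINT z|circle_measure. (cmod (f (of_real r * z)))\<^sup>2) \<le> (\<Sum>n. (cmod (a n))\<^sup>2)"
    using hardy_series_mean_le[OF a] by auto
  ultimately show "f \<in> hardy2_disk"
    unfolding hardy2_disk_def by blast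
qed

text \<open>Fatou's lemma along a sequence of radii tending to \<open>1\<close>.\<close>
lemma boundary_mean_le:
  assumes f: "hardy_series f a" "has_boundary_function f F" and F: "F \<in> borel_measurable circle_measure"
  shows "F \<in> L2" "(LINT z|circle_measure. (cmod (F z))\<^sup>2) \<le> (\<Sum>n. (cmod (a n))\<^sup>2)"
proof -
  define r where "r = (\<lambda>k::nat. 1 - inverse (real (Suc k)))"
  have r: "0 \<le> r k" "r k < 1" for k by (auto simp: r_def field_simps)
  have "r \<longlonglongrightarrow> 1" unfolding r_def using tendsto_diff[OF tendsto_const LIMSEQ_inverse_real_of_nat, of 1] by simp
  then have rlim: "filterlim r (at_left 1) sequentially"
    using r by (intro tendsto_imp_filterlim_at_left) auto
  define u where "u = (\<lambda>k z. ennreal ((cmod (f (of_real (r k) * z)))\<^sup>2))"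
  have fhol: "f holomorphic_on ball 0 1"
    using f(1) hardy2_disk_iff unfolding hardy2_disk_def by blast
  have fc: "continuous_on (sphere 0 1) (\<lambda>z. f (of_real (r k) * z))" for k
  proof (rule continuous_on_compose2[OF holomorphic_on_imp_continuous_on[OF fhol]])
    show "continuous_on (sphere 0 1) (\<lambda>z. complex_of_real (r k) * z)" by (intro continuous_intros)
    show "(\<lambda>z. complex_of_real (r k) * z) ` sphere 0 1 \<subseteq> ball 0 1" using r[of k] by (auto simp: norm_mult)
  qed
  have um [measurable]: "u k \<in> borel_measurable circle_measure" for k
  proof -
    note [measurable] = borel_measurable_circle_continuous[OF fc[of k]]
    show ?thesis unfolding u_def by measurable
  qed
  have ub: "(\<integral>\<^sup>+z. u k z \<partial>circle_measure) \<le> ennreal (\<Sum>n. (cmod (a n))\<^sup>2)" for k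
  proof -
    have "(\<integral>\<^sup>+z. u k z \<partial>circle_measure) = ennreal (LINT z|circle_measure. (cmod (f (of_real (r k) * z)))\<^sup>2)"
      unfolding u_def by (rule nn_integral_eq_integral[OF L2_integrable[OF L2_continuous[OF fc]]]) simp
    then show ?thesis using hardy_series_mean_le[OF f(1) r] by (simp add: ennreal_leI)
  qed
  have lim: "AE z in circle_measure. ennreal ((cmod (F z))\<^sup>2) = liminf (\<lambda>k. u k z)"
    using f(2) unfolding has_boundary_function_def
  proof eventually_elim
    case (elim z)
    have "(\<lambda>k. f (of_real (r k) * z)) \<longlonglongrightarrow> F z"
      using filterlim_compose[OF elim rlim] .
    then have "(\<lambda>k. u k z) \<longlonglongrightarrow> ennreal ((cmod (F z))\<^sup>2)"
      unfolding u_def by (intro tendsto_intros)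
    then show ?case by (simp add: lim_imp_Liminf)
  qed
  have "(\<integral>\<^sup>+z. ennreal ((cmod (F z))\<^sup>2) \<partial>circle_measure) = (\<integral>\<^sup>+z. liminf (\<lambda>k. u k z) \<partial>circle_measure)"
    by (rule nn_integral_cong_AE[OF lim])
  also have "\<dots> \<le> liminf (\<lambda>k. \<integral>\<^sup>+z. u k z \<partial>circle_measure)"
    by (rule nn_integral_liminf) simp
  also have "\<dots> \<le> liminf (\<lambda>k. ennreal (\<Sum>n. (cmod (a n))\<^sup>2))"
    by (intro Liminf_mono always_eventually allI ub)
  also have "\<dots> = ennreal (\<Sum>n. (cmod (a n))\<^sup>2)" by (simp add: Liminf_const)
  finally have le: "(\<integral>\<^sup>+z. ennreal ((cmod (F z))\<^sup>2) \<partial>circle_measure) \<le> ennreal (\<Sum>n. (cmod (a n))\<^sup>2)" .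
  have "integrable circle_measure (\<lambda>z. (cmod (F z))\<^sup>2)"
  proof (rule integrableI_bounded)
    show "(\<integral>\<^sup>+z. ennreal (norm ((cmod (F z))\<^sup>2)) \<partial>circle_measure) < \<infinity>"
      using le by (simp add: order_le_less_trans)
  qed (use F in measurable)
  then show L2: "F \<in> L2" using F by (simp add: L2_def)
  have "ennreal (LINT z|circle_measure. (cmod (F z))\<^sup>2) \<le> ennreal (\<Sum>n. (cmod (a n))\<^sup>2)"
    using le nn_integral_eq_integral[OF L2_integrable[OF L2]] by simp
  then show "(LINT z|circle_measure. (cmod (F z))\<^sup>2) \<le> (\<Sum>n. (cmod (a n))\<^sup>2)"
    using f(1) by (subst (asm) ennreal_le_iff) (auto intro!: suminf_nonneg simp: hardy_series_def)
qed

lemma H2_iff: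
  "F \<in> H2 \<longleftrightarrow> F \<in> borel_measurable circle_measure \<and> (\<exists>f a. hardy_series f a \<and> has_boundary_function f F)"
proof
  assume "F \<in> H2"
  then show "F \<in> borel_measurable circle_measure \<and> (\<exists>f a. hardy_series f a \<and> has_boundary_function f F)"
    unfolding H2_def Bex_def hardy2_disk_iff using L2_measurable by blast
next
  assume *: "F \<in> borel_measurable circle_measure \<and> (\<exists>f a. hardy_series f a \<and> has_boundary_function f F)"
  then obtain f a where f: "hardy_series f a" "has_boundary_function f F" by blast
  then have "F \<in> L2" using * boundary_mean_le(1) by blast
  moreover have "f \<in> hardy2_disk" using f hardy2_disk_iff by blast
  ultimately show "F \<in> H2" using f(2) unfolding H2_def by blast
qed

section \<open>The Hardy space and Fourier coefficients\<close>

definition fourier :: "(complex \<Rightarrow> complex) \<Rightarrow> int \<Rightarrow> complex" where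
  "fourier F n = L2_inner F (\<lambda>z. z powi n)"

lemma sums_finite_powers: "(\<lambda>n. (if n < N then a n else 0) * w ^ n) sums (\<Sum>n<N. a n * w ^ n)"
  for a :: "nat \<Rightarrow> complex"
proof -
  have "(\<lambda>n. (if n < N then a n else 0) * w ^ n) sums (\<Sum>n\<in>{..<N}. (if n < N then a n else 0) * w ^ n)"
    by (rule sums_finite) auto
  then show ?thesis by simp
qed

lemma hardy_series_truncated: "hardy_series (\<lambda>w. \<Sum>n<N. a n * w ^ n) (\<lambda>n. if n < N then a n else 0)"
proof -
  have "summable (\<lambda>n. (cmod (if n < N then a n else 0))\<^sup>2)"
    by (rule summable_finite[of "{..<N}"]) auto
  then show ?thesis
    unfolding hardy_series_def using sums_finite_powers by blast
qed

lemma hardy_series_lincomb: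
  assumes "hardy_series f a" "hardy_series g b"
  shows "hardy_series (\<lambda>w. x * f w + y * g w) (\<lambda>n. x * a n + y * b n)"
  unfolding hardy_series_def
proof (intro conjI allI impI)
  fix w :: complex assume "cmod w < 1"
  then show "(\<lambda>n. (x * a n + y * b n) * w ^ n) sums (x * f w + y * g w)"
    using sums_add[OF sums_mult[of "\<lambda>n. a n * w ^ n" "f w" x] sums_mult[of "\<lambda>n. b n * w ^ n" "g w" y]] assms
    by (simp add: hardy_series_def algebra_simps)
next
  have s: "summable (\<lambda>n. 2 * (cmod x)\<^sup>2 * (cmod (a n))\<^sup>2 + 2 * (cmod y)\<^sup>2 * (cmod (b n))\<^sup>2)"
    using assms by (intro summable_add summable_mult) (auto simp: hardy_series_def)
  have "norm ((cmod (x * a n + y * b n))\<^sup>2) \<le> 2 * (cmod x)\<^sup>2 * (cmod (a n))\<^sup>2 + 2 * (cmod y)\<^sup>2 * (cmod (b n))\<^sup>2" for n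
  proof -
    have "(cmod (x * a n + y * b n))\<^sup>2 \<le> (cmod (x * a n) + cmod (y * b n))\<^sup>2"
      by (intro power_mono norm_triangle_ineq) auto
    also have "\<dots> \<le> 2 * (cmod (x * a n))\<^sup>2 + 2 * (cmod (y * b n))\<^sup>2"
      using sum_squares_bound[of "cmod (x * a n)" "cmod (y * b n)"] by (simp add: power2_sum)
    finally show ?thesis by (simp add: norm_mult power_mult_distrib)
  qed
  then show "summable (\<lambda>n. (cmod (x * a n + y * b n))\<^sup>2)"
    by (intro summable_comparison_test'[OF s]) auto
qed

lemma hardy_series_mult_var:
  assumes "hardy_series f a"
  shows "hardy_series (\<lambda>w. w * f w) (\<lambda>n. case n of 0 \<Rightarrow> 0 | Suc m \<Rightarrow> a m)"
  unfolding hardy_series_def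
proof (intro conjI allI impI)
  fix w :: complex assume "cmod w < 1"
  then have "(\<lambda>n. w * (a n * w ^ n)) sums (w * f w)"
    using assms by (intro sums_mult) (auto simp: hardy_series_def)
  then show "(\<lambda>n. (case n of 0 \<Rightarrow> 0 | Suc m \<Rightarrow> a m) * w ^ n) sums (w * f w)"
    by (subst sums_Suc_iff[symmetric, where f="\<lambda>n. (case n of 0 \<Rightarrow> 0 | Suc m \<Rightarrow> a m) * w ^ n", simplified])
       (simp add: mult_ac)
next
  show "summable (\<lambda>n. (cmod (case n of 0 \<Rightarrow> 0 | Suc m \<Rightarrow> a m))\<^sup>2)"
    using assms by (subst summable_Suc_iff[symmetric]) (simp add: hardy_series_def)
qed

text \<open>A zero of order \<open>k\<close> at the origin can be divided out; on coefficients this is a shift.\<close>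
lemma hardy_series_divide_power:
  assumes f: "hardy_series f a" and z: "\<And>j. j < k \<Longrightarrow> a j = 0"
  defines "g \<equiv> \<lambda>w. \<Sum>n. a (n + k) * w ^ n"
  shows "hardy_series g (\<lambda>n. a (n + k))" "cmod w < 1 \<Longrightarrow> f w = w ^ k * g w"
proof -
  have s: "summable (\<lambda>n. a (n + k) * w ^ n)" and eq: "f w = w ^ k * g w" if w: "cmod w < 1" for w
  proof -
    have sf: "(\<lambda>n. a n * w ^ n) sums f w" using f w by (simp add: hardy_series_def)
    show s: "summable (\<lambda>n. a (n + k) * w ^ n)"
    proof (cases "w = 0")
      case True
      then show ?thesis by simp
    next
      case False
      have "summable (\<lambda>n. inverse (w ^ k) * (a (n + k) * w ^ (n + k)))"
        using sf by (intro summable_mult) (simp add: summable_iff_shift[of "\<lambda>n. a n * w ^ n"] sums_iff)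
      then show ?thesis using False by (simp add: power_add field_simps)
    qed
    have "f w = (\<Sum>n. a (n + k) * w ^ (n + k)) + (\<Sum>j<k. a j * w ^ j)"
      using suminf_split_initial_segment[OF sums_summable[OF sf]] sums_unique[OF sf] by simp
    also have "(\<Sum>j<k. a j * w ^ j) = 0" using z by simp
    also have "(\<Sum>n. a (n + k) * w ^ (n + k)) = w ^ k * g w"
      unfolding g_def by (subst suminf_mult[OF s, symmetric]) (simp add: power_add mult_ac)
    finally show "f w = w ^ k * g w" by simp
  qed
  have "summable (\<lambda>n. (cmod (a (n + k)))\<^sup>2)"
    using f by (simp add: hardy_series_def summable_iff_shift[of "\<lambda>n. (cmod (a n))\<^sup>2"])
  then show "hardy_series g (\<lambda>n. a (n + k))"
    using s unfolding hardy_series_def g_def by (simp add: summable_sums)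
  show "cmod w < 1 \<Longrightarrow> f w = w ^ k * g w" by (rule eq)
qed

lemma hardy_series_reflect:
  assumes "hardy_series f a" "\<mu> \<in> sphere 0 1"
  shows "hardy_series (\<lambda>w. cnj (f (\<mu> * cnj w))) (\<lambda>n. cnj (a n) * cnj \<mu> ^ n)"
  unfolding hardy_series_def
proof (intro conjI allI impI)
  fix w :: complex assume "cmod w < 1"
  then have "(\<lambda>n. a n * (\<mu> * cnj w) ^ n) sums f (\<mu> * cnj w)"
    using assms by (simp add: hardy_series_def norm_mult)
  then have "(\<lambda>n. cnj (a n * (\<mu> * cnj w) ^ n)) sums cnj (f (\<mu> * cnj w))"
    by (simp only: sums_cnj)
  then show "(\<lambda>n. cnj (a n) * cnj \<mu> ^ n * w ^ n) sums cnj (f (\<mu> * cnj w))"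
    by (simp add: power_mult_distrib mult_ac)
next
  show "summable (\<lambda>n. (cmod (cnj (a n) * cnj \<mu> ^ n))\<^sup>2)"
    using assms by (simp add: hardy_series_def norm_mult norm_power)
qed

lemma H2I:
  "F \<in> borel_measurable circle_measure \<Longrightarrow> hardy_series f a \<Longrightarrow> has_boundary_function f F \<Longrightarrow> F \<in> H2"
  using H2_iff by blast

lemma H2E:
  assumes "F \<in> H2"
  obtains f a where "hardy_series f a" "has_boundary_function f F"
  using assms H2_iff by blast

lemma H2_L2: "F \<in> H2 \<Longrightarrow> F \<in> L2"
  by (simp add: H2_def)

lemma H2_measurable: "F \<in> H2 \<Longrightarrow> F \<in> borel_measurable circle_measure"
  by (simp add: H2_L2 L2_measurable)

lemma H2_cong:
  assumes "F \<in> H2" "G \<in> borel_measurable circle_measure" "F \<approx> G"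
  shows "G \<in> H2"
proof -
  obtain f a where f: "hardy_series f a" "has_boundary_function f F" using assms(1) by (rule H2E)
  have "has_boundary_function f G"
    using f(2) assms(3) unfolding has_boundary_function_def by eventually_elim simp
  then show ?thesis using H2I[OF assms(2) f(1)] by blast
qed

lemma H2_lincomb:
  assumes "F \<in> H2" "G \<in> H2"
  shows "(\<lambda>z. x * F z + y * G z) \<in> H2"
proof -
  obtain f a where f: "hardy_series f a" "has_boundary_function f F" using assms(1) by (rule H2E)
  obtain g b where g: "hardy_series g b" "has_boundary_function g G" using assms(2) by (rule H2E)
  have "has_boundary_function (\<lambda>w. x * f w + y * g w) (\<lambda>z. x * F z + y * G z)"
    using f(2) g(2) unfolding has_boundary_function_def by eventually_elim (intro tendsto_intros)
  then show ?thesis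
    by (rule H2I[OF L2_measurable[OF L2_lincomb[OF H2_L2[OF assms(1)] H2_L2[OF assms(2)]]] hardy_series_lincomb[OF f(1) g(1)]])
qed

lemma H2_diff: "F \<in> H2 \<Longrightarrow> G \<in> H2 \<Longrightarrow> (\<lambda>z. F z - G z) \<in> H2"
  using H2_lincomb[of F G 1 "-1"] by simp

lemma H2_add: "F \<in> H2 \<Longrightarrow> G \<in> H2 \<Longrightarrow> (\<lambda>z. F z + G z) \<in> H2"
  using H2_lincomb[of F G 1 1] by simp

lemma H2_scale: "F \<in> H2 \<Longrightarrow> (\<lambda>z. a * F z) \<in> H2"
  using H2_lincomb[of F F a 0] by simp

lemma H2_mult_var:
  assumes "F \<in> H2"
  shows "(\<lambda>z. z * F z) \<in> H2"
proof -
  obtain f a where f: "hardy_series f a" "has_boundary_function f F" using assms by (rule H2E)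
  have "((\<lambda>r::real. of_real r * z * f (of_real r * z)) \<longlongrightarrow> of_real 1 * z * F z) (at_left 1)"
    if "((\<lambda>r::real. f (of_real r * z)) \<longlongrightarrow> F z) (at_left 1)" for z
    using that by (intro tendsto_intros)
  then have "has_boundary_function (\<lambda>w. w * f w) (\<lambda>z. z * F z)"
    using f(2) unfolding has_boundary_function_def by (auto elim: eventually_mono)
  moreover have "(\<lambda>z. z * F z) \<in> L2"
    using L2_mult_continuous[OF H2_L2[OF assms], of "\<lambda>z. z"] by simp
  ultimately show ?thesis
    using H2I[OF _ hardy_series_mult_var[OF f(1)]] L2_measurable by blast
qed

lemma H2_truncated: "(\<lambda>z. \<Sum>n<N. a n * z ^ n) \<in> H2"
proof (rule H2I[OF _ hardy_series_truncated])
  show "(\<lambda>z. \<Sum>n<N. a n * z ^ n) \<in> borel_measurable circle_measure"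
    by (intro borel_measurable_circle_continuous continuous_intros)
  have "((\<lambda>r::real. \<Sum>n<N. a n * (of_real r * z) ^ n) \<longlongrightarrow> (\<Sum>n<N. a n * (of_real 1 * z) ^ n)) (at_left 1)" for z
    by (intro tendsto_intros)
  then show "has_boundary_function (\<lambda>w. \<Sum>n<N. a n * w ^ n) (\<lambda>z. \<Sum>n<N. a n * z ^ n)"
    unfolding has_boundary_function_def by simp
qed

lemma H2_zero: "(\<lambda>z. 0) \<in> H2"
  using H2_truncated[where N=0] by simp

lemma H2_const: "(\<lambda>z. a) \<in> H2"
  using H2_truncated[where N=1 and a="\<lambda>_. a"] by simp

lemma H2_sum: "(\<And>i. i \<in> I \<Longrightarrow> F i \<in> H2) \<Longrightarrow> (\<lambda>z. \<Sum>i\<in>I. F i z) \<in> H2"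
  by (induction I rule: infinite_finite_induct) (auto intro: H2_add H2_zero)

lemma H2_poly_mult: "F \<in> H2 \<Longrightarrow> (\<lambda>z. poly p z * F z) \<in> H2"
proof (induction p)
  case 0
  then show ?case by (simp add: H2_zero)
next
  case (pCons a p)
  then have "(\<lambda>z. a * F z + z * (poly p z * F z)) \<in> H2"
    by (intro H2_add H2_scale H2_mult_var)
  then show ?case by (simp add: algebra_simps)
qed

lemma H2_poly: "poly p \<in> H2"
  using H2_poly_mult[OF H2_const[of 1]] by simp

lemma H2_power: "(\<lambda>z. z ^ n) \<in> H2"
  using H2_poly[of "monom 1 n"] by (simp add: poly_monom[abs_def])

lemma H2_C_rot:
  assumes "F \<in> H2" "\<mu> \<in> sphere 0 1"
  shows "C_rot \<mu> F \<in> H2"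
proof -
  obtain f a where f: "hardy_series f a" "has_boundary_function f F" using assms(1) by (rule H2E)
  have "AE z in circle_measure. ((\<lambda>r::real. f (of_real r * (\<mu> * cnj z))) \<longlongrightarrow> F (\<mu> * cnj z)) (at_left 1)"
    using AE_reflect[OF assms(2)] f(2) unfolding has_boundary_function_def by blast
  then have "has_boundary_function (\<lambda>w. cnj (f (\<mu> * cnj w))) (C_rot \<mu> F)"
    unfolding has_boundary_function_def C_rot_def
  proof eventually_elim
    case (elim z)
    then have "((\<lambda>r::real. cnj (f (of_real r * (\<mu> * cnj z)))) \<longlongrightarrow> cnj (F (\<mu> * cnj z))) (at_left 1)"
      by (rule tendsto_cnj)
    then show ?case by (simp add: mult_ac)
  qed
  moreover have "C_rot \<mu> F \<in> borel_measurable circle_measure"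
    unfolding C_rot_def
    by (rule measurable_compose[OF measurable_compose[OF reflect_measurable[OF assms(2)] H2_measurable[OF assms(1)]] borel_measurable_continuous_onI])
       (intro continuous_intros)
  ultimately show ?thesis
    using H2I[OF _ hardy_series_reflect[OF f(1) assms(2)]] by blast
qed

lemma fourier_lincomb:
  "F \<in> L2 \<Longrightarrow> G \<in> L2 \<Longrightarrow> fourier (\<lambda>z. a * F z + b * G z) n = a * fourier F n + b * fourier G n"
  by (simp add: fourier_def L2_inner_lincomb_left L2_powi)

lemma fourier_diff: "F \<in> L2 \<Longrightarrow> G \<in> L2 \<Longrightarrow> fourier (\<lambda>z. F z - G z) n = fourier F n - fourier G n"
  by (simp add: fourier_def L2_inner_diff_left L2_powi)

lemma fourier_cong: "F \<in> L2 \<Longrightarrow> G \<in> L2 \<Longrightarrow> F \<approx> G \<Longrightarrow> fourier F n = fourier G n"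
  unfolding fourier_def by (rule L2_inner_cong) (auto intro: L2_powi)

lemma fourier_powi_mult: "fourier (\<lambda>z. z powi m * F z) n = fourier F (n - m)"
  unfolding fourier_def L2_inner_def
proof (rule Bochner_Integration.integral_cong[OF refl])
  fix z assume "z \<in> space circle_measure"
  then have z: "cmod z = 1" by simp
  moreover from this have "z \<noteq> 0" by auto
  ultimately show "z powi m * F z * cnj (z powi n) = F z * cnj (z powi (n - m))"
    by (simp only: cnj_powi_circle) (simp add: power_int_add[symmetric] mult.commute mult.left_commute)
qed

lemma fourier_powi: "fourier (\<lambda>z. z powi m) n = (if m = n then 1 else 0)"
  by (simp add: fourier_def L2_inner_powi)

lemma fourier_power: "fourier (\<lambda>z. z ^ k) n = (if int k = n then 1 else 0)"
  using fourier_powi[of "int k" n] by simp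

lemma fourier_truncated:
  "fourier (\<lambda>z. \<Sum>k<N. a k * z ^ k) n = (if 0 \<le> n \<and> nat n < N then a (nat n) else 0)"
proof -
  have L: "(\<lambda>z. z ^ k) \<in> L2" for k using L2_powi[of "int k"] by simp
  have "fourier (\<lambda>z. \<Sum>k<N. a k * z ^ k) n = (\<Sum>k<N. a k * fourier (\<lambda>z. z powi int k) n)"
    unfolding fourier_def
    by (subst L2_inner_sum_left) (auto intro!: L2_powi L2_scale L simp: L2_inner_scale_left)
  also have "\<dots> = (\<Sum>k<N. if k = nat n \<and> 0 \<le> n then a k else 0)"
    by (intro sum.cong) (auto simp: fourier_power)
  also have "\<dots> = (if 0 \<le> n \<and> nat n < N then a (nat n) else 0)"
    by (cases "0 \<le> n") (auto simp: sum.delta)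
  finally show ?thesis .
qed

text \<open>The function minus its Taylor polynomial of degree below \<open>N\<close> is again a Hardy function, with boundary
values \<open>F - P N\<close>. The Fatou bound for it is the tail of \<open>\<Sum>n. |a\<^sub>n|\<^sup>2\<close>, so the Taylor polynomials converge
to \<open>F\<close> in mean square, and their Fourier coefficients converge to those of \<open>F\<close>.\<close>
lemma fourier_boundary:
  assumes f: "hardy_series f a" "has_boundary_function f F" and F: "F \<in> borel_measurable circle_measure"
  shows "fourier F n = (if 0 \<le> n then a (nat n) else 0)"
proof -
  define P where "P = (\<lambda>N z. \<Sum>k<N. a k * z ^ k)"
  define b where "b = (\<lambda>n. (cmod (a n))\<^sup>2)"
  have b: "summable b" using f by (simp add: hardy_series_def b_def)
  have FL: "F \<in> L2" using boundary_mean_le(1)[OF f F] .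
  have PH: "P N \<in> H2" for N unfolding P_def by (rule H2_truncated)
  have dist: "(LINT z|circle_measure. (cmod (F z - P N z))\<^sup>2) \<le> suminf b - (\<Sum>k<N. b k)" for N
  proof -
    have 1: "hardy_series (\<lambda>w. 1 * f w + (-1) * P N w) (\<lambda>n. 1 * a n + (-1) * (if n < N then a n else 0))"
      unfolding P_def by (rule hardy_series_lincomb[OF f(1) hardy_series_truncated])
    have "((\<lambda>r::real. P N (of_real r * z)) \<longlongrightarrow> P N (of_real 1 * z)) (at_left 1)" for z
      unfolding P_def by (intro tendsto_intros)
    then have "((\<lambda>r::real. 1 * f (of_real r * z) + (-1) * P N (of_real r * z)) \<longlongrightarrow> 1 * F z + (-1) * P N (of_real 1 * z)) (at_left 1)"
      if "((\<lambda>r::real. f (of_real r * z)) \<longlongrightarrow> F z) (at_left 1)" for z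
      using that by (intro tendsto_intros)
    then have "has_boundary_function (\<lambda>w. 1 * f w + (-1) * P N w) (\<lambda>z. F z - P N z)"
      using f(2) unfolding has_boundary_function_def by (auto elim: eventually_mono)
    then have "(LINT z|circle_measure. (cmod (F z - P N z))\<^sup>2)
        \<le> (\<Sum>n. (cmod (1 * a n + (-1) * (if n < N then a n else 0)))\<^sup>2)"
      using 1 FL PH by (intro boundary_mean_le(2)) (auto intro: L2_measurable L2_diff H2_L2)
    also have "\<dots> = (\<Sum>n. b n - (if n < N then b n else 0))"
      by (intro suminf_cong) (auto simp: b_def)
    also have "\<dots> = suminf b - (\<Sum>k<N. b k)"
    proof -
      have "(\<lambda>n. if n \<in> {..<N} then b n else 0) sums (\<Sum>k\<in>{..<N}. b k)"
        by (rule sums_If_finite_set) simp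
      then show ?thesis using sums_diff[OF summable_sums[OF b]] sums_unique by fastforce
    qed
    finally show ?thesis .
  qed
  define v where "v = (if 0 \<le> n then a (nat n) else 0)"
  have "(cmod (fourier F n - v))\<^sup>2 \<le> suminf b - (\<Sum>k<N. b k)" if "N \<ge> Suc (nat n)" for N
  proof -
    have "fourier F n - v = fourier (\<lambda>z. F z - P N z) n"
      using that FL PH[of N] by (subst fourier_diff) (auto simp: H2_L2 fourier_truncated P_def v_def)
    then have "(cmod (fourier F n - v))\<^sup>2 \<le> (LINT z|circle_measure. (cmod (F z - P N z))\<^sup>2)"
      unfolding fourier_def using FL PH
      by (metis bessel_single L2_diff H2_L2 L2_powi L2_inner_powi)
    then show ?thesis using dist[of N] by simp
  qed
  moreover have "(\<lambda>N. suminf b - (\<Sum>k<N. b k)) \<longlonglongrightarrow> suminf b - suminf b"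
    by (intro tendsto_intros summable_LIMSEQ b)
  ultimately have "(cmod (fourier F n - v))\<^sup>2 \<le> suminf b - suminf b"
    using LIMSEQ_le_const by blast
  then show ?thesis by (simp add: v_def)
qed

lemma fourier_H2_neg: "F \<in> H2 \<Longrightarrow> n < 0 \<Longrightarrow> fourier F n = 0"
  using H2E fourier_boundary H2_measurable by (metis not_less)

text \<open>The Fourier coefficients are the Taylor coefficients of the extension to the disk; if they all vanish,
the Fatou bound on the norm of \<open>F\<close> is zero.\<close>
lemma H2_fourier_zero:
  assumes "F \<in> H2" "\<And>n. fourier F (int n) = 0"
  shows "F \<approx> (\<lambda>z. 0)"
proof -
  obtain f a where f: "hardy_series f a" "has_boundary_function f F" using assms(1) by (rule H2E)
  have "a n = 0" for n
    using fourier_boundary[OF f H2_measurable[OF assms(1)], of "int n"] assms(2) by simp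
  then have "(LINT z|circle_measure. (cmod (F z))\<^sup>2) \<le> 0"
    using boundary_mean_le(2)[OF f H2_measurable[OF assms(1)]] by simp
  moreover have "(LINT z|circle_measure. (cmod (F z))\<^sup>2) \<ge> 0" by simp
  ultimately have "L2_inner F F = 0" by (simp add: L2_inner_self)
  then show ?thesis by (rule AE_zero_if_inner_self_zero[OF H2_L2[OF assms(1)]])
qed

text \<open>The extension to the disk has a zero of order \<open>k\<close> at the origin, and dividing it out changes the
radial limits by the factor \<open>z\<^sup>-\<^sup>k\<close>.\<close>
lemma H2_divide_power:
  assumes "F \<in> H2" "\<And>j. j < k \<Longrightarrow> fourier F (int j) = 0"
  shows "(\<lambda>z. z powi (- int k) * F z) \<in> H2"
proof -
  obtain f a where f: "hardy_series f a" "has_boundary_function f F" using assms(1) by (rule H2E)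
  have z: "a j = 0" if "j < k" for j
    using fourier_boundary[OF f H2_measurable[OF assms(1)], of "int j"] assms(2)[OF that] by simp
  define g where "g = (\<lambda>w. \<Sum>n. a (n + k) * w ^ n)"
  have g: "hardy_series g (\<lambda>n. a (n + k))" "\<And>w. cmod w < 1 \<Longrightarrow> f w = w ^ k * g w"
    using hardy_series_divide_power[OF f(1) z] unfolding g_def by blast+
  have "AE z in circle_measure. cmod z = 1" by (rule AE_circleI)
  with f(2) have "has_boundary_function g (\<lambda>z. z powi (- int k) * F z)"
    unfolding has_boundary_function_def
  proof eventually_elim
    case (elim z)
    then have z0: "z \<noteq> 0" by auto
    have "((\<lambda>r::real. inverse ((of_real r * z) ^ k) * f (of_real r * z)) \<longlongrightarrow> inverse ((of_real 1 * z) ^ k) * F z) (at_left 1)"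
      using elim z0 by (intro tendsto_intros) auto
    moreover have "eventually (\<lambda>r::real. 0 < r \<and> r < 1) (at_left 1)"
      using eventually_at_left_real[of 0 "1::real"] by (auto elim: eventually_mono)
    then have "eventually (\<lambda>r::real. inverse ((of_real r * z) ^ k) * f (of_real r * z) = g (of_real r * z)) (at_left 1)"
    proof eventually_elim
      case (elim r)
      then have "f (of_real r * z) = (of_real r * z) ^ k * g (of_real r * z)"
        using \<open>cmod z = 1\<close> by (intro g(2)) (simp add: norm_mult)
      then show ?case using elim z0 by (simp add: field_simps)
    qed
    ultimately show ?case
      by (simp add: power_int_minus tendsto_cong)
  qed
  then show ?thesis
    by (rule H2I[OF L2_measurable[OF L2_mult_continuous[OF H2_L2[OF assms(1)] continuous_powi_circle]] g(1)])
qed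

lemma H2_mult_powi: "F \<in> H2 \<Longrightarrow> (\<lambda>z. z ^ k * F z) \<in> H2"
  using H2_poly_mult[of F "monom 1 k"] by (simp add: poly_monom)

section \<open>Functionals on polynomials\<close>

text \<open>The linear functional with prescribed values \<open>v j\<close> on the powers \<open>z\<^sup>j\<close>.\<close>
definition functional_of :: "(nat \<Rightarrow> complex) \<Rightarrow> complex poly \<Rightarrow> complex" where
  "functional_of v p = (\<Sum>j\<le>degree p. coeff p j * v j)"

lemma functional_of_bound: "degree p \<le> N \<Longrightarrow> functional_of v p = (\<Sum>j\<le>N. coeff p j * v j)"
  unfolding functional_of_def
  by (rule sum.mono_neutral_left) (auto simp: coeff_eq_0)

lemma functional_of_add: "functional_of v (p + q) = functional_of v p + functional_of v q"
  using functional_of_bound[of p "max (degree p) (degree q)" v]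
    functional_of_bound[of q "max (degree p) (degree q)" v]
    functional_of_bound[of "p + q" "max (degree p) (degree q)" v]
  by (simp add: degree_add_le sum.distrib distrib_right)

lemma functional_of_smult: "functional_of v (smult a p) = a * functional_of v p"
  using functional_of_bound[of "smult a p" "degree p" v]
  by (simp add: functional_of_def degree_smult_le sum_distrib_left mult.assoc)

lemma functional_of_diff: "functional_of v (p - q) = functional_of v p - functional_of v q"
  using functional_of_add[of v p "smult (-1) q"] functional_of_smult[of v "-1" q] by simp

lemma functional_of_pCons: "functional_of v (pCons a p) = a * v 0 + functional_of (\<lambda>j. v (Suc j)) p"
proof -
  have "functional_of v (pCons a p) = (\<Sum>j\<le>Suc (degree p). coeff (pCons a p) j * v j)"
    by (rule functional_of_bound) (rule degree_pCons_le)
  then show ?thesis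
    by (subst (asm) sum.atMost_Suc_shift) (simp add: functional_of_def)
qed

text \<open>The assumption is the conclusion for \<open>p = z\<^sup>j\<close>. Multiplication of \<open>p\<close> by the variable shifts \<open>v\<close>, and the
assumption is stable under this shift, so the induction runs over \<open>p\<close> for all \<open>v\<close> at once.\<close>
lemma functional_of_mult:
  assumes "\<And>j. (\<Sum>n\<le>degree f. coeff f n * v (j + n)) = \<gamma> * v j"
  shows "functional_of v (f * p) = \<gamma> * functional_of v p"
  using assms
proof (induction p arbitrary: v)
  case 0
  then show ?case by (simp add: functional_of_def)
next
  case (pCons a p)
  have "functional_of v f = \<gamma> * v 0"
    using pCons.prems[of 0] by (simp add: functional_of_def)
  moreover have "functional_of (\<lambda>j. v (Suc j)) (f * p) = \<gamma> * functional_of (\<lambda>j. v (Suc j)) p"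
    using pCons.prems[of "Suc j" for j] by (intro pCons.IH) simp
  ultimately show ?case
    by (simp add: functional_of_add functional_of_smult functional_of_pCons algebra_simps)
qed

text \<open>Multiplication by \<open>z\<^sup>d\<close> and by \<open>f\<close> act on the functional \<open>v\<close> as the scalars \<open>\<sigma>\<close> and \<open>\<gamma>\<close>. Hence \<open>v\<close> vanishes
on the multiples of \<open>z\<^sup>d - \<sigma>\<close>, in particular on the product of the \<open>f - f(a)\<close> over the roots \<open>a\<close> of this
polynomial. On that product its value is also \<open>v 0\<close> times the product of the \<open>\<gamma> - f(a)\<close>, so one of
these factors is zero.\<close>
lemma common_eigenfunctional:
  fixes f :: "complex poly" and v :: "nat \<Rightarrow> complex"
  assumes f: "\<And>j. (\<Sum>n\<le>degree f. coeff f n * v (j + n)) = \<gamma> * v j"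
    and shift: "\<And>j. v (j + d) = \<sigma> * v j" and v0: "v 0 \<noteq> 0" and d: "d > 0"
  shows "\<exists>a. a ^ d = \<sigma> \<and> poly f a = \<gamma>"
proof -
  define P where "P = monom (1::complex) d - [:\<sigma>:]"
  have "coeff P d = 1" using d by (simp add: P_def coeff_pCons split: nat.split)
  then have P0: "P \<noteq> 0" by auto
  obtain A where A: "P = smult (lead_coeff P) (\<Prod>a\<in>#A. [:-a, 1:])"
    using alg_closed_imp_factorization[OF P0] by blast
  have root: "a ^ d = \<sigma>" if "a \<in># A" for a
  proof -
    have "poly (\<Prod>a\<in>#A. [:-a, 1:]) a = 0"
      using that by (induction A) auto
    then have "poly P a = 0" by (metis A mult_zero_right poly_smult)
    then show ?thesis by (simp add: P_def poly_monom)
  qed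
  define Q where "Q = (\<lambda>A. \<Prod>a\<in>#A. f - [:poly f a:])"
  have "(\<Prod>a\<in>#A. [:-a, 1:]) dvd Q A" for A
  proof (induction A)
    case (add a A)
    have "[:-a, 1:] dvd f - [:poly f a:]" by (simp flip: poly_eq_0_iff_dvd)
    then have "[:-a, 1:] * (\<Prod>a\<in>#A. [:-a, 1:]) dvd (f - [:poly f a:]) * Q A"
      using add by (rule mult_dvd_mono)
    then show ?case by (simp add: Q_def)
  qed (simp add: Q_def)
  then have "P dvd Q A"
    using P0 by (metis A leading_coeff_0_iff smult_dvd_iff)
  then obtain R where R: "Q A = P * R" by blast
  have "functional_of v (monom 1 d * R) = \<sigma> * functional_of v R"
    by (rule functional_of_mult) (simp add: degree_monom_eq shift coeff_monom if_distrib if_distribR sum.delta cong: if_cong)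
  then have zero: "functional_of v (Q A) = 0"
    by (simp add: R P_def left_diff_distrib functional_of_diff functional_of_smult)
  have "functional_of v (Q A) = (\<Prod>a\<in>#A. \<gamma> - poly f a) * v 0" for A
  proof (induction A)
    case empty
    then show ?case by (simp add: Q_def functional_of_def)
  next
    case (add a A)
    have "functional_of v (Q (add_mset a A)) = functional_of v (f * Q A) - poly f a * functional_of v (Q A)"
      by (simp add: Q_def left_diff_distrib functional_of_diff functional_of_smult)
    then show ?case
      using add by (simp add: functional_of_mult[OF f] algebra_simps)
  qed
  with zero v0 have "(\<Prod>a\<in>#A. \<gamma> - poly f a) = 0" by simp
  then obtain a where "a \<in># A" "\<gamma> = poly f a"
    by (auto simp: prod_mset_zero_iff)
  then show ?thesis using root by auto
qed

section \<open>Block diagonal intertwining matrices\<close>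

lemma geometric_growth_zero:
  fixes x :: "nat \<Rightarrow> complex"
  assumes "\<And>k. cmod (x k) \<le> 1" "\<And>k. x (Suc k) = \<epsilon> * x k" "cmod \<epsilon> > 1"
  shows "x 0 = 0"
proof (rule ccontr)
  assume "x 0 \<noteq> 0"
  then have pos: "cmod (x 0) > 0" by simp
  obtain k where k: "1 / cmod (x 0) < cmod \<epsilon> ^ k"
    using real_arch_pow[OF assms(3)] by blast
  have "x k = \<epsilon> ^ k * x 0" by (induction k) (simp_all add: assms(2))
  then have "cmod (x k) = cmod \<epsilon> ^ k * cmod (x 0)" by (simp add: norm_mult norm_power)
  then show False using assms(1)[of k] k pos by (simp add: field_simps)
qed

text \<open>A forcing term in resonance with the homogeneous solution makes \<open>x\<close> grow linearly.\<close>
lemma resonance_zero: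
  fixes x r :: "nat \<Rightarrow> complex"
  assumes "\<And>k. cmod (x k) \<le> 1" "\<And>k. x (Suc k) = \<epsilon> * x k + r k" "\<And>k. r (Suc k) = \<epsilon> * r k" "cmod \<epsilon> = 1"
  shows "r 0 = 0"
proof (rule ccontr)
  assume r0: "r 0 \<noteq> 0"
  have e0: "\<epsilon> \<noteq> 0" using assms(4) by auto
  have r: "r k = \<epsilon> ^ k * r 0" for k by (induction k) (simp_all add: assms(3))
  have x: "\<epsilon> * x k = \<epsilon> ^ k * (\<epsilon> * x 0 + of_nat k * r 0)" for k
  proof (induction k)
    case (Suc k)
    have "\<epsilon> * x (Suc k) = \<epsilon> * (\<epsilon> * x k) + \<epsilon> * r k"
      by (simp add: assms(2) algebra_simps)
    also have "\<dots> = \<epsilon> ^ Suc k * (\<epsilon> * x 0 + of_nat (Suc k) * r 0)"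
      unfolding Suc.IH r[of k] by (simp add: algebra_simps)
    finally show ?case .
  qed simp
  have bound: "real k * cmod (r 0) \<le> 2" for k
  proof -
    have "cmod (\<epsilon> * x k) = cmod (\<epsilon> * x 0 + of_nat k * r 0)"
      by (subst x) (simp add: norm_mult norm_power assms(4))
    then have "cmod (\<epsilon> * x 0 + of_nat k * r 0) \<le> 1"
      using assms(1)[of k] assms(4) by (simp add: norm_mult)
    moreover have "cmod (of_nat k * r 0) \<le> cmod (\<epsilon> * x 0 + of_nat k * r 0) + cmod (\<epsilon> * x 0)"
      using norm_triangle_ineq4[of "\<epsilon> * x 0 + of_nat k * r 0" "\<epsilon> * x 0"] by simp
    ultimately show ?thesis using assms(1)[of 0] assms(4) by (simp add: norm_mult)
  qed
  obtain k where "2 < real k * cmod (r 0)"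
    using reals_Archimedean3[of "cmod (r 0)"] r0 by auto
  then show False using bound[of k] by simp
qed

text \<open>The matrix of a conjugation carrying multiplication by \<open>f\<close> to multiplication by \<open>g\<close>: the entry \<open>c i j\<close>
is the coefficient of \<open>z\<^sup>i\<close> in the image of \<open>z\<^sup>j\<close>, and \<open>relation\<close> compares the coefficients of \<open>z\<^sup>i\<close> in the
images of \<open>f z\<^sup>j\<close>. The conjugates come from antilinearity.\<close>
locale intertwining_matrix =
  fixes c :: "nat \<Rightarrow> nat \<Rightarrow> complex" and f g :: "complex poly" and d :: nat
  assumes d: "d > 0" "degree f = d" "degree g = d"
    and block: "\<And>i j. i div d \<noteq> j div d \<Longrightarrow> c i j = 0"
    and bounded: "\<And>i j. cmod (c i j) \<le> 1"
    and relation: "\<And>i j. (\<Sum>n\<le>d. cnj (coeff f n) * c i (j + n)) = (\<Sum>n\<le>i. coeff g n * c (i - n) j)"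
begin

lemma lead: "coeff f d \<noteq> 0" "coeff g d \<noteq> 0"
  using d leading_coeff_0_iff[of f] leading_coeff_0_iff[of g] by auto

text \<open>The relation at \<open>(i + d, j)\<close>, read from the top coefficients downwards. For \<open>i\<close> and \<open>j\<close> in the same block
it compares this block with the next one.\<close>
lemma relation_shifted:
  "cnj (coeff f d) * c (i + d) (j + d) + (\<Sum>m=1..d. cnj (coeff f (d - m)) * c (i + d) (j + d - m))
     = coeff g d * c i j + (\<Sum>m=1..d. coeff g (d - m) * c (i + m) j)"
proof -
  have split: "(\<Sum>m\<le>d. h m) = h 0 + (\<Sum>m=1..d. h m)" for h :: "nat \<Rightarrow> complex"
    by (simp add: atMost_atLeast0 sum.atLeast_Suc_atMost)
  have rev: "(\<Sum>n\<le>d. h n) = (\<Sum>m\<le>d. h (d - m))" for h :: "nat \<Rightarrow> complex"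
    using sum.nat_diff_reindex[of h "Suc d"] by (simp add: lessThan_Suc_atMost)
  have "(\<Sum>n\<le>d. cnj (coeff f n) * c (i + d) (j + n)) = (\<Sum>m\<le>d. cnj (coeff f (d - m)) * c (i + d) (j + d - m))"
    by (subst rev) (auto intro!: sum.cong)
  moreover have "(\<Sum>n\<le>i + d. coeff g n * c (i + d - n) j) = (\<Sum>n\<le>d. coeff g n * c (i + d - n) j)"
    by (rule sum.mono_neutral_right) (auto simp: coeff_eq_0 d)
  moreover have "\<dots> = (\<Sum>m\<le>d. coeff g (d - m) * c (i + m) j)"
    by (subst rev) (auto intro!: sum.cong)
  ultimately show ?thesis
    using relation[of "i + d" j] by (simp add: split)
qed

text \<open>The distance from the lower left corner of a block. The terms with \<open>m \<ge> 1\<close> in \<open>relation_shifted\<close> either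
lie outside the diagonal blocks or are strictly closer to that corner.\<close>
definition height :: "nat \<Rightarrow> nat \<Rightarrow> nat" where
  "height i j = j mod d + (d - 1 - i mod d)"

lemma height_shift [simp]: "height (i + k * d) (j + k * d) = height i j" "height (i + d) (j + d) = height i j"
  by (simp_all add: height_def)

lemma height_lower_row:
  assumes "i div d = j div d" "(i + m) div d = j div d" "m \<ge> 1"
  shows "height (i + m) j < height i j"
proof -
  have "d * (j div d) + i mod d = i" "d * (j div d) + (i + m) mod d = i + m"
    using mult_div_mod_eq[of d i] mult_div_mod_eq[of d "i + m"] unfolding assms(1,2) by blast+
  then have "(i + m) mod d = i mod d + m" by linarith
  moreover have "(i + m) mod d < d" using d by simp
  ultimately show ?thesis using assms(3) by (simp add: height_def)
qed

lemma height_earlier_column: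
  assumes "i div d = j div d" "(j + d - m) div d = (i + d) div d" "m \<ge> 1" "m \<le> d"
  shows "height (i + d) (j + d - m) < height i j"
proof -
  have "(i + d) div d = j div d + 1" using assms(1) d by simp
  with assms(2) have "(j + d - m) div d = j div d + 1" by simp
  then have "d * (j div d + 1) + (j + d - m) mod d = j + d - m"
    using mult_div_mod_eq[of d "j + d - m"] by simp
  moreover have "d * (j div d) + j mod d = j" by simp
  moreover have "d * (j div d + 1) = d * (j div d) + d" by simp
  ultimately have "(j + d - m) mod d + m = j mod d" using assms(4) by linarith
  then show ?thesis using assms(3) by (simp add: height_def)
qed

text \<open>If the leading coefficient of \<open>g\<close> were larger, then by induction on the height only the leading terms
of the relation would survive, and the entries would grow geometrically from block to block.\<close>
lemma lead_le:
  assumes "c i0 j0 \<noteq> 0"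
  shows "cmod (coeff g d) \<le> cmod (coeff f d)"
proof (rule ccontr)
  assume gt: "\<not> ?thesis"
  define \<epsilon> where "\<epsilon> = coeff g d / cnj (coeff f d)"
  have \<epsilon>: "cmod \<epsilon> > 1" using gt lead by (simp add: \<epsilon>_def norm_divide)
  have "c i j = 0" for i j
  proof (induction "height i j" arbitrary: i j rule: less_induct)
    case less
    show ?case
    proof (cases "i div d = j div d")
      case True
      have step: "c (i + Suc k * d) (j + Suc k * d) = \<epsilon> * c (i + k * d) (j + k * d)" for k
      proof -
        define i' j' where "i' = i + k * d" and "j' = j + k * d"
        have same: "i' div d = j' div d" and h: "height i' j' = height i j"
          using True d by (auto simp: i'_def j'_def)
        have 1: "c (i' + m) j' = 0" if "m \<in> {1..d}" for m
          using block[of "i' + m" j'] height_lower_row[OF same, of m] less h that by fastforce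
        have 2: "c (i' + d) (j' + d - m) = 0" if "m \<in> {1..d}" for m
          using block[of "i' + d" "j' + d - m"] height_earlier_column[OF same, of m] less h that by fastforce
        have "cnj (coeff f d) * c (i' + d) (j' + d) = coeff g d * c i' j'"
          using relation_shifted[of i' j'] 1 2 by simp
        then show ?thesis
          using lead by (simp add: \<epsilon>_def i'_def j'_def field_simps)
      qed
      show ?thesis
        using geometric_growth_zero[of "\<lambda>k. c (i + k * d) (j + k * d)", OF bounded step \<epsilon>] by simp
    qed (rule block)
  qed
  then show False using assms by simp
qed

text \<open>By induction on the height, the correction \<open>r\<close> in the relation between consecutive blocks is itself
multiplied by \<open>\<epsilon>\<close> on passing to the next block. This is a resonance, which boundedness of the entries
excludes unless \<open>r\<close> vanishes. The antilinear map thus carries multiplication by \<open>z\<^sup>d\<close> to multiplication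
by \<open>\<epsilon> z\<^sup>d\<close>.\<close>
lemma block_shift:
  assumes eq: "cmod (coeff g d) = cmod (coeff f d)"
  shows "c (i + d) (j + d) = coeff g d / cnj (coeff f d) * c i j"
proof (induction "height i j" arbitrary: i j rule: less_induct)
  case less
  define \<epsilon> where "\<epsilon> = coeff g d / cnj (coeff f d)"
  have \<epsilon>: "cmod \<epsilon> = 1" using eq lead by (simp add: \<epsilon>_def norm_divide)
  show ?case
  proof (cases "i div d = j div d")
    case True
    define r where "r = (\<lambda>i j. ((\<Sum>m=1..d. coeff g (d - m) * c (i + m) j)
        - (\<Sum>m=1..d. cnj (coeff f (d - m)) * c (i + d) (j + d - m))) / cnj (coeff f d))"
    have rel: "c (i + d) (j + d) = \<epsilon> * c i j + r i j" for i j
      using relation_shifted[of i j] lead by (simp add: \<epsilon>_def r_def field_simps)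
    have r_shift: "r (i + Suc k * d) (j + Suc k * d) = \<epsilon> * r (i + k * d) (j + k * d)" for k
    proof -
      define i' j' where "i' = i + k * d" and "j' = j + k * d"
      have same: "i' div d = j' div d" and h: "height i' j' = height i j"
        using True d by (auto simp: i'_def j'_def)
      have 1: "c (i' + d + m) (j' + d) = \<epsilon> * c (i' + m) j'" if m: "m \<in> {1..d}" for m
      proof (cases "(i' + m) div d = j' div d")
        case True
        then have "height (i' + m) j' < height i j" using height_lower_row[OF same] m h by fastforce
        from less[OF this] show ?thesis by (simp add: \<epsilon>_def add_ac)
      next
        case False
        then have "(i' + m + d) div d \<noteq> (j' + d) div d" using d by simp
        then show ?thesis using False block by (simp add: add_ac)
      qed
      have 2: "c (i' + d + d) (j' + d + d - m) = \<epsilon> * c (i' + d) (j' + d - m)" if m: "m \<in> {1..d}" for m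
      proof -
        have e: "j' + d + d - m = j' + d - m + d" using m by simp
        show ?thesis
        proof (cases "(j' + d - m) div d = (i' + d) div d")
          case True
          then have "height (i' + d) (j' + d - m) < height i j" using height_earlier_column[OF same] m h by fastforce
          from less[OF this] show ?thesis by (simp add: \<epsilon>_def e)
        next
          case False
          then have "(i' + d + d) div d \<noteq> (j' + d - m + d) div d" using d by simp
          then show ?thesis using False block[of "i' + d" "j' + d - m"] block by (simp add: e)
        qed
      qed
      have S1: "(\<Sum>m=1..d. coeff g (d - m) * c (i' + d + m) (j' + d)) = \<epsilon> * (\<Sum>m=1..d. coeff g (d - m) * c (i' + m) j')"
        unfolding sum_distrib_left by (intro sum.cong refl) (simp add: 1)
      have S2: "(\<Sum>m=1..d. cnj (coeff f (d - m)) * c (i' + d + d) (j' + d + d - m))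
          = \<epsilon> * (\<Sum>m=1..d. cnj (coeff f (d - m)) * c (i' + d) (j' + d - m))"
        unfolding sum_distrib_left by (intro sum.cong refl) (simp add: 2)
      have "r (i' + d) (j' + d) = \<epsilon> * r i' j'"
        unfolding r_def S1 S2 by (simp add: right_diff_distrib)
      then show ?thesis by (simp add: i'_def j'_def add_ac)
    qed
    have "r i j = 0"
      using resonance_zero[of "\<lambda>k. c (i + k * d) (j + k * d)" \<epsilon> "\<lambda>k. r (i + k * d) (j + k * d)",
          OF bounded _ r_shift \<epsilon>] rel[of "i + k * d" "j + k * d" for k]
      by (simp add: add_ac)
    then show ?thesis using rel[of i j] by (simp add: \<epsilon>_def)
  next
    case False
    then show ?thesis using block d by simp
  qed
qed

text \<open>The sum stops at the end of the block of \<open>j\<close>, beyond which the entries vanish.\<close>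
definition column :: "nat \<Rightarrow> complex poly" where
  "column j = (\<Sum>i<(j div d + 1) * d. monom (c i j) i)"

lemma coeff_column: "coeff (column j) i = c i j"
proof (cases "i < (j div d + 1) * d")
  case True
  then show ?thesis by (simp add: column_def coeff_sum coeff_monom sum.delta)
next
  case False
  then have "j div d + 1 \<le> i div d" using d by (simp add: less_eq_div_iff_mult_less_eq)
  then show ?thesis using False block[of i j] by (simp add: column_def coeff_sum coeff_monom)
qed

lemma column_relation: "(\<Sum>n\<le>d. smult (cnj (coeff f n)) (column (j + n))) = g * column j"
  by (rule poly_eqI) (simp add: coeff_sum coeff_column relation coeff_mult)

lemma column_shift:
  assumes eq: "cmod (coeff g d) = cmod (coeff f d)"
  shows "column (j + d) = smult (coeff g d / cnj (coeff f d)) (monom 1 d * column j)"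
proof (rule poly_eqI)
  fix i
  show "coeff (column (j + d)) i = coeff (smult (coeff g d / cnj (coeff f d)) (monom 1 d * column j)) i"
  proof (cases "i < d")
    case True
    then show ?thesis using block[of i "j + d"] d by (simp add: coeff_column coeff_monom_mult)
  next
    case False
    then show ?thesis using block_shift[OF eq, of "i - d" j] by (simp add: coeff_column coeff_monom_mult)
  qed
qed

text \<open>For fixed \<open>z\<close>, conjugating the values at \<open>z\<close> of the columns gives a functional on which \<open>z\<^sup>d\<close> and \<open>f\<close> act
as scalars, so \<open>cnj (g(z))\<close> is the value of \<open>f\<close> at a point \<open>\<mu> * cnj z\<close> with \<open>\<mu>\<^sup>d = cnj \<epsilon>\<close>. There are
finitely many such \<open>\<mu>\<close>, and one of them serves infinitely many \<open>z\<close>; for it the two polynomials agree.\<close>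
theorem rotation:
  assumes eq: "cmod (coeff g d) = cmod (coeff f d)" and nz: "c i0 0 \<noteq> 0"
  shows "\<exists>\<mu>. cmod \<mu> = 1 \<and> (\<forall>z. poly g z = cnj (poly f (\<mu> * cnj z)))"
proof -
  define \<epsilon> where "\<epsilon> = coeff g d / cnj (coeff f d)"
  have \<epsilon>: "cmod \<epsilon> = 1" using eq lead by (simp add: \<epsilon>_def norm_divide)
  define \<Lambda> where "\<Lambda> = {\<mu>. \<mu> ^ d = cnj \<epsilon>}"
  have fin: "finite \<Lambda>" unfolding \<Lambda>_def using d by (intro finite_nth_roots) auto
  define Z where "Z = {z. z \<noteq> 0 \<and> poly (column 0) z \<noteq> 0}"
  have "column 0 \<noteq> 0" using nz coeff_column[of 0 i0] by auto
  then have "finite ({0} \<union> {z. poly (column 0) z = 0})" by (simp add: poly_roots_finite)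
  moreover have "Z = - ({0} \<union> {z. poly (column 0) z = 0})" by (auto simp: Z_def)
  ultimately have "infinite Z"
    by (simp add: infinite_UNIV_char_0 Compl_eq_Diff_UNIV)
  define h where "h = (\<lambda>\<mu>. pcompose (map_poly cnj f) [:0, cnj \<mu>:])"
  have h: "poly (h \<mu>) z = cnj (poly f (\<mu> * cnj z))" for \<mu> z
    by (simp add: h_def poly_pcompose mult.commute)
  have "\<exists>\<mu>\<in>\<Lambda>. poly (g - h \<mu>) z = 0" if z: "z \<in> Z" for z
  proof -
    define v where "v = (\<lambda>j. cnj (poly (column j) z))"
    have "(\<Sum>n\<le>degree f. coeff f n * v (j + n)) = cnj (poly g z) * v j" for j
    proof -
      have "(\<Sum>n\<le>degree f. coeff f n * v (j + n)) = cnj (poly (\<Sum>n\<le>d. smult (cnj (coeff f n)) (column (j + n))) z)"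
        by (simp add: v_def poly_sum d)
      then show ?thesis by (simp add: column_relation v_def)
    qed
    moreover have "v (j + d) = cnj (\<epsilon> * z ^ d) * v j" for j
      by (simp add: v_def column_shift[OF eq] \<epsilon>_def poly_monom)
    moreover have "v 0 \<noteq> 0" using z by (simp add: Z_def v_def)
    ultimately obtain a where a: "a ^ d = cnj (\<epsilon> * z ^ d)" "poly f a = cnj (poly g z)"
      using common_eigenfunctional[of f v] d(1) by blast
    define \<mu> where "\<mu> = a / cnj z"
    have az: "\<mu> * cnj z = a" using z by (simp add: \<mu>_def Z_def)
    have "\<mu> \<in> \<Lambda>" using a(1) z by (simp add: \<Lambda>_def \<mu>_def Z_def power_divide)
    moreover have "poly (g - h \<mu>) z = 0" using a(2) az h by simp
    ultimately show ?thesis by blast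
  qed
  then have "Z \<subseteq> (\<Union>\<mu>\<in>\<Lambda>. {z. poly (g - h \<mu>) z = 0})" by blast
  then have "infinite (\<Union>\<mu>\<in>\<Lambda>. {z. poly (g - h \<mu>) z = 0})"
    using \<open>infinite Z\<close> finite_subset by blast
  then obtain \<mu> where \<mu>: "\<mu> \<in> \<Lambda>" "infinite {z. poly (g - h \<mu>) z = 0}"
    using fin finite_UN_I[of \<Lambda> "\<lambda>\<mu>. {z. poly (g - h \<mu>) z = 0}"] by blast
  then have "g = h \<mu>" using poly_roots_finite[of "g - h \<mu>"] by auto
  moreover have "cmod \<mu> ^ d = 1" using \<mu>(1) \<epsilon> by (simp add: \<Lambda>_def flip: norm_power)
  then have "cmod \<mu> = 1" using d(1) power_eq_iff_eq_base[of d "cmod \<mu>" 1] by simp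
  ultimately show ?thesis using h by metis
qed

end

section \<open>Trigonometric polynomials and Toeplitz operators\<close>

lemma trig_continuous:
  assumes "trigonometric_polynomial \<phi>"
  shows "continuous_on (sphere 0 1) \<phi>"
proof -
  obtain S c where S: "finite S" "\<forall>z\<in>sphere 0 1. \<phi> z = (\<Sum>n\<in>S. c n * z powi n)"
    using assms unfolding trigonometric_polynomial_def by blast
  have "continuous_on (sphere 0 1) (\<lambda>z. \<Sum>n\<in>S. c n * z powi n)"
    by (intro continuous_on_sum continuous_on_mult continuous_on_const continuous_powi_circle)
  then show ?thesis by (rule continuous_on_eq) (use S in simp)
qed

lemma trig_L2_mult: "trigonometric_polynomial \<phi> \<Longrightarrow> F \<in> L2 \<Longrightarrow> (\<lambda>z. \<phi> z * F z) \<in> L2"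
  by (rule L2_mult_continuous[OF _ trig_continuous])

lemma trig_L2: "trigonometric_polynomial \<phi> \<Longrightarrow> \<phi> \<in> L2"
  by (rule L2_continuous[OF trig_continuous])

lemma trig_monomial: "trigonometric_polynomial (\<lambda>z. a * z powi n)"
  unfolding trigonometric_polynomial_def
  by (intro exI[of _ "{n}"] exI[of _ "\<lambda>_. a"]) auto

lemma trig_cong:
  "trigonometric_polynomial \<phi> \<Longrightarrow> (\<And>z. cmod z = 1 \<Longrightarrow> \<psi> z = \<phi> z) \<Longrightarrow> trigonometric_polynomial \<psi>"
  unfolding trigonometric_polynomial_def by simp

lemma trig_add:
  assumes "trigonometric_polynomial \<phi>" "trigonometric_polynomial \<psi>"
  shows "trigonometric_polynomial (\<lambda>z. \<phi> z + \<psi> z)"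
proof -
  obtain S c where S: "finite S" "\<forall>z\<in>sphere 0 1. \<phi> z = (\<Sum>n\<in>S. c n * z powi n)"
    using assms unfolding trigonometric_polynomial_def by blast
  obtain T e where T: "finite T" "\<forall>z\<in>sphere 0 1. \<psi> z = (\<Sum>n\<in>T. e n * z powi n)"
    using assms unfolding trigonometric_polynomial_def by blast
  have 1: "(\<Sum>n\<in>S. c n * z powi n) = (\<Sum>n\<in>S \<union> T. (if n \<in> S then c n else 0) * z powi n)" for z
    using S T by (intro sum.mono_neutral_cong_left) auto
  have 2: "(\<Sum>n\<in>T. e n * z powi n) = (\<Sum>n\<in>S \<union> T. (if n \<in> T then e n else 0) * z powi n)" for z
    using S T by (intro sum.mono_neutral_cong_left) auto
  show ?thesis
    unfolding trigonometric_polynomial_def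
    using S T by (intro exI[of _ "S \<union> T"] exI[of _ "\<lambda>n. (if n \<in> S then c n else 0) + (if n \<in> T then e n else 0)"])
      (simp add: 1 2 distrib_right sum.distrib)
qed

lemma trig_sum:
  "finite I \<Longrightarrow> (\<And>i. i \<in> I \<Longrightarrow> trigonometric_polynomial (\<phi> i)) \<Longrightarrow> trigonometric_polynomial (\<lambda>z. \<Sum>i\<in>I. \<phi> i z)"
proof (induction I rule: finite_induct)
  case empty
  then show ?case using trig_monomial[of 0 0] by simp
next
  case (insert i I)
  then show ?case by (simp add: trig_add)
qed

text \<open>Closure under operations that act on each monomial separately.\<close>
lemma trig_termwise:
  assumes "trigonometric_polynomial \<phi>" "\<And>n a. trigonometric_polynomial (h n a)"
    "\<And>S c. finite S \<Longrightarrow> (\<And>z. cmod z = 1 \<Longrightarrow> \<phi> z = (\<Sum>n\<in>S. c n * z powi n)) \<Longrightarrow>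
       (\<And>z. cmod z = 1 \<Longrightarrow> \<psi> z = (\<Sum>n\<in>S. h n (c n) z))"
  shows "trigonometric_polynomial \<psi>"
proof -
  obtain S c where S: "finite S" "\<forall>z\<in>sphere 0 1. \<phi> z = (\<Sum>n\<in>S. c n * z powi n)"
    using assms unfolding trigonometric_polynomial_def by blast
  show ?thesis
    by (rule trig_cong[OF trig_sum[OF S(1) assms(2)]]) (use assms(3)[OF S(1)] S(2) in simp)
qed

lemma trig_cnj:
  assumes "trigonometric_polynomial \<phi>"
  shows "trigonometric_polynomial (\<lambda>z. cnj (\<phi> z))"
proof -
  have pt: "cnj (a * z powi n) = cnj a * z powi (- n)" if "cmod z = 1" for a z n
    by (simp only: complex_cnj_mult cnj_powi_circle[OF that])
  show ?thesis
    by (rule trig_termwise[OF assms trig_monomial[of "cnj a" "- n" for a n]])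
       (simp add: pt del: complex_cnj_mult complex_cnj_power_int)
qed

lemma trig_reflect:
  assumes "trigonometric_polynomial \<phi>" "\<mu> \<in> sphere 0 1"
  shows "trigonometric_polynomial (\<lambda>z. \<phi> (\<mu> * cnj z))"
proof -
  have pt: "a * (\<mu> * cnj z) powi n = a * \<mu> powi n * z powi (- n)" if "cmod z = 1" for a z n
    using cnj_powi_circle[OF that, of n] by (simp add: power_int_mult_distrib)
  show ?thesis
    by (rule trig_termwise[OF assms(1) trig_monomial[of "a * \<mu> powi n" "- n" for a n]])
       (use assms(2) in \<open>simp add: norm_mult pt\<close>)
qed

lemma trig_poly: "trigonometric_polynomial (poly p)"
  by (rule trig_cong[OF trig_sum[of "{..degree p}" "\<lambda>n z. coeff p n * z powi int n"]])
     (use trig_monomial[of "coeff p n" "int n" for n] in \<open>auto simp: poly_altdef\<close>)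

lemma fourier_scale: "fourier (\<lambda>z. a * F z) n = a * fourier F n"
  by (simp add: fourier_def L2_inner_scale_left)

lemma fourier_sum:
  "finite I \<Longrightarrow> (\<And>i. i \<in> I \<Longrightarrow> F i \<in> L2) \<Longrightarrow> fourier (\<lambda>z. \<Sum>i\<in>I. F i z) n = (\<Sum>i\<in>I. fourier (F i) n)"
  by (simp add: fourier_def L2_inner_sum_left L2_powi)

lemma fourier_trig:
  assumes "finite S"
  shows "fourier (\<lambda>z. \<Sum>n\<in>S. c n * z powi n) m = (if m \<in> S then c m else 0)"
proof -
  have "fourier (\<lambda>z. \<Sum>n\<in>S. c n * z powi n) m = (\<Sum>n\<in>S. if n = m then c n else 0)"
    using assms by (subst fourier_sum) (auto intro!: L2_scale L2_powi simp: fourier_scale fourier_powi mult_delta_right)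
  then show ?thesis using assms by simp
qed

text \<open>A trigonometric polynomial is the finite Fourier series of its own coefficients.\<close>
lemma trig_eqI:
  assumes "trigonometric_polynomial \<phi>" "trigonometric_polynomial \<psi>"
    and eq: "\<And>n. fourier \<phi> n = fourier \<psi> n" and z: "cmod z = 1"
  shows "\<phi> z = \<psi> z"
proof -
  have "trigonometric_polynomial (\<lambda>z. \<phi> z + (\<lambda>z. -1) z * \<psi> z)"
    by (rule trig_add[OF assms(1)], rule trig_termwise[OF assms(2) trig_monomial[of "-a" n for a n]])
       (simp add: sum_negf)
  then obtain S c where S: "finite S" "\<forall>z\<in>sphere 0 1. \<phi> z + (-1) * \<psi> z = (\<Sum>n\<in>S. c n * z powi n)"
    unfolding trigonometric_polynomial_def by auto
  have "c n = 0" if "n \<in> S" for n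
  proof -
    have "fourier (\<lambda>z. 1 * \<phi> z + (-1) * \<psi> z) n = 1 * fourier \<phi> n + (-1) * fourier \<psi> n"
      by (rule fourier_lincomb) (auto intro: trig_L2 assms)
    moreover have "fourier (\<lambda>z. 1 * \<phi> z + (-1) * \<psi> z) n = fourier (\<lambda>z. \<Sum>n\<in>S. c n * z powi n) n"
      unfolding fourier_def L2_inner_def using S(2)
      by (intro Bochner_Integration.integral_cong refl) auto
    ultimately show ?thesis using that S(1) eq by (simp add: fourier_trig)
  qed
  then show ?thesis using S(2) z by auto
qed

lemma trig_eq_if_AE:
  "trigonometric_polynomial \<phi> \<Longrightarrow> trigonometric_polynomial \<psi> \<Longrightarrow> \<phi> \<approx> \<psi> \<Longrightarrow> cmod z = 1 \<Longrightarrow> \<phi> z = \<psi> z"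
  by (rule trig_eqI) (auto intro: fourier_cong trig_L2)

lemma fourier_reflect:
  assumes "u \<in> L2" "\<mu> \<in> sphere 0 1"
  shows "fourier (\<lambda>z. u (\<mu> * cnj z)) n = \<mu> powi (- n) * fourier u (- n)"
proof -
  have \<mu>: "cmod \<mu> = 1" "\<mu> \<noteq> 0" using assms(2) by auto
  define v where "v = (\<lambda>z. u z * cnj (z powi (- n)))"
  have vm: "v \<in> borel_measurable circle_measure"
    unfolding v_def using integrable_inner[OF assms(1) L2_powi] by (rule borel_measurable_integrable)
  have "fourier (\<lambda>z. u (\<mu> * cnj z)) n = (LINT z|circle_measure. \<mu> powi (- n) * v (\<mu> * cnj z))"
    unfolding fourier_def L2_inner_def
  proof (rule Bochner_Integration.integral_cong[OF refl])
    fix z assume "z \<in> space circle_measure"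
    then have z: "cmod z = 1" by simp
    have "cnj ((\<mu> * cnj z) powi (- n)) = (\<mu> * cnj z) powi n"
      using cnj_powi_circle[of "\<mu> * cnj z" "-n"] z \<mu> by (simp add: norm_mult)
    then have "\<mu> powi (- n) * cnj ((\<mu> * cnj z) powi (- n)) = cnj z powi n"
      using \<mu> by (simp add: power_int_mult_distrib power_int_minus)
    then show "u (\<mu> * cnj z) * cnj (z powi n) = \<mu> powi (- n) * v (\<mu> * cnj z)"
      unfolding v_def by (metis complex_cnj_power_int mult.commute mult.left_commute)
  qed
  also have "\<dots> = \<mu> powi (- n) * fourier u (- n)"
    using integral_reflect[OF assms(2) vm] by (simp add: v_def fourier_def L2_inner_def)
  finally show ?thesis .
qed

text \<open>Two elements are equal if no \<open>k\<close> separates them: take for \<open>k\<close> their difference.\<close>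
lemma H2_eqI:
  assumes "F \<in> H2" "G \<in> H2" "\<And>k. k \<in> H2 \<Longrightarrow> L2_inner F k = L2_inner G k"
  shows "F \<approx> G"
proof -
  have D: "(\<lambda>z. F z - G z) \<in> H2" using assms by (intro H2_diff)
  then have "L2_inner (\<lambda>z. F z - G z) (\<lambda>z. F z - G z) = 0"
    using assms(3)[OF D] assms by (simp add: L2_inner_diff_left H2_L2)
  then have "(\<lambda>z. F z - G z) \<approx> (\<lambda>z. 0)"
    using D by (intro AE_zero_if_inner_self_zero H2_L2)
  then show ?thesis by simp
qed

text \<open>Multiplication by \<open>z\<^sup>-\<^sup>N\<close> creates only finitely many negative frequencies, which come from the Taylor
polynomial of degree below \<open>N\<close>. Dropping them leaves an element of \<open>H2\<close>, and they are orthogonal to \<open>H2\<close>.\<close>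
lemma monomial_projection:
  assumes F: "F \<in> H2"
  shows "\<exists>w\<in>H2. \<forall>k\<in>H2. L2_inner w k = L2_inner (\<lambda>z. z powi n * F z) k"
proof (cases "n \<ge> 0")
  case True
  then have "(\<lambda>z. z powi n * F z) \<in> H2"
    using H2_mult_powi[OF F, of "nat n"] by (simp add: power_int_def)
  then show ?thesis by blast
next
  case False
  define N where "N = nat (- n)"
  have N: "n = - int N" using False by (simp add: N_def)
  define T where "T = (\<lambda>z. \<Sum>j<N. fourier F (int j) * z ^ j)"
  have T: "T \<in> H2" unfolding T_def by (rule H2_truncated)
  define w where "w = (\<lambda>z. z powi n * (F z - T z))"
  have "fourier (\<lambda>z. F z - T z) (int j) = 0" if "j < N" for j
    using that F T by (subst fourier_diff) (auto simp: H2_L2 T_def fourier_truncated)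
  then have w: "w \<in> H2"
    unfolding w_def N using F T by (intro H2_divide_power H2_diff) auto
  have "L2_inner w k = L2_inner (\<lambda>z. z powi n * F z) k" if k: "k \<in> H2" for k
  proof -
    have pL: "(\<lambda>z. z powi n * u z) \<in> L2" if "u \<in> L2" for u
      by (rule L2_mult_continuous[OF that continuous_powi_circle])
    have "L2_inner w k = L2_inner (\<lambda>z. z powi n * F z) k - L2_inner (\<lambda>z. z powi n * T z) k"
      unfolding w_def right_diff_distrib using F T k by (intro L2_inner_diff_left pL H2_L2)
    also have "L2_inner (\<lambda>z. z powi n * T z) k = (\<Sum>j<N. fourier F (int j) * L2_inner (\<lambda>z. z powi (n + int j)) k)"
    proof -
      have "L2_inner (\<lambda>z. z powi n * T z) k = L2_inner (\<lambda>z. \<Sum>j<N. fourier F (int j) * z powi (n + int j)) k"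
        unfolding L2_inner_def
      proof (rule Bochner_Integration.integral_cong[OF refl])
        fix z assume "z \<in> space circle_measure"
        then have "z \<noteq> 0" by auto
        then show "z powi n * T z * cnj (k z) = (\<Sum>j<N. fourier F (int j) * z powi (n + int j)) * cnj (k z)"
          by (simp add: T_def sum_distrib_left power_int_add mult_ac)
      qed
      also have "\<dots> = (\<Sum>j<N. fourier F (int j) * L2_inner (\<lambda>z. z powi (n + int j)) k)"
        using k by (subst L2_inner_sum_left) (auto intro!: L2_scale L2_powi simp: H2_L2 L2_inner_scale_left)
      finally show ?thesis .
    qed
    also have "\<dots> = 0"
    proof (rule sum.neutral, rule ballI)
      fix j assume "j \<in> {..<N}"
      then have "fourier k (n + int j) = 0" using fourier_H2_neg[OF k] N by simp
      then have "L2_inner (\<lambda>z. z powi (n + int j)) k = 0"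
        unfolding fourier_def by (metis L2_inner_commute complex_cnj_zero)
      then show "fourier F (int j) * L2_inner (\<lambda>z. z powi (n + int j)) k = 0" by simp
    qed
    finally show ?thesis by simp
  qed
  then show ?thesis using w by blast
qed

lemma trig_projection:
  assumes "trigonometric_polynomial \<phi>" "F \<in> H2"
  shows "\<exists>w\<in>H2. \<forall>k\<in>H2. L2_inner w k = L2_inner (\<lambda>z. \<phi> z * F z) k"
proof -
  obtain S c where S: "finite S" "\<forall>z\<in>sphere 0 1. \<phi> z = (\<Sum>n\<in>S. c n * z powi n)"
    using assms unfolding trigonometric_polynomial_def by blast
  obtain w where w: "\<And>n. w n \<in> H2" "\<And>n k. k \<in> H2 \<Longrightarrow> L2_inner (w n) k = L2_inner (\<lambda>z. z powi n * F z) k"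
    using monomial_projection[OF assms(2)] by metis
  have pL: "(\<lambda>z. z powi n * F z) \<in> L2" for n
    by (rule L2_mult_continuous[OF H2_L2[OF assms(2)] continuous_powi_circle])
  have "L2_inner (\<lambda>z. \<Sum>n\<in>S. c n * w n z) k = L2_inner (\<lambda>z. \<phi> z * F z) k" if k: "k \<in> H2" for k
  proof -
    have "L2_inner (\<lambda>z. \<phi> z * F z) k = L2_inner (\<lambda>z. \<Sum>n\<in>S. c n * (z powi n * F z)) k"
      unfolding L2_inner_def
    proof (rule Bochner_Integration.integral_cong[OF refl])
      fix z assume "z \<in> space circle_measure"
      then have "\<phi> z = (\<Sum>n\<in>S. c n * z powi n)" using S(2) by simp
      then show "\<phi> z * F z * cnj (k z) = (\<Sum>n\<in>S. c n * (z powi n * F z)) * cnj (k z)"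
        by (simp add: sum_distrib_right mult.assoc)
    qed
    also have "\<dots> = (\<Sum>n\<in>S. c n * L2_inner (\<lambda>z. z powi n * F z) k)"
      using k S by (subst L2_inner_sum_left) (auto intro!: L2_scale pL simp: H2_L2 L2_inner_scale_left)
    also have "\<dots> = (\<Sum>n\<in>S. c n * L2_inner (w n) k)" using w(2)[OF k] by simp
    also have "\<dots> = L2_inner (\<lambda>z. \<Sum>n\<in>S. c n * w n z) k"
      using k S w by (subst L2_inner_sum_left) (auto intro!: L2_scale simp: H2_L2 L2_inner_scale_left)
    finally show ?thesis by simp
  qed
  moreover have "(\<lambda>z. \<Sum>n\<in>S. c n * w n z) \<in> H2" using w by (intro H2_sum H2_scale)
  ultimately show ?thesis by blast
qed

text \<open>The value chosen by \<open>proj_H2\<close> is known only through its inner products with \<open>H2\<close>. The symbol \<open>\<phi>\<close> may be an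
arbitrary representative of a trigonometric polynomial, as arises from boundary functions.\<close>
lemma toeplitz_spec:
  assumes \<phi>: "\<phi> \<in> borel_measurable circle_measure" "\<phi> \<approx> \<psi>" and \<psi>: "trigonometric_polynomial \<psi>" and F: "F \<in> H2"
  shows "toeplitz \<phi> F \<in> H2"
    and "k \<in> H2 \<Longrightarrow> L2_inner (toeplitz \<phi> F) k = L2_inner (\<lambda>z. \<psi> z * F z) k"
proof -
  have L: "(\<lambda>z. \<psi> z * F z) \<in> L2" by (rule trig_L2_mult[OF \<psi> H2_L2[OF F]])
  have AE: "(\<lambda>z. \<psi> z * F z) \<approx> (\<lambda>z. \<phi> z * F z)" using \<phi>(2) by eventually_elim simp
  have L': "(\<lambda>z. \<phi> z * F z) \<in> L2"
    by (rule L2_cong[OF L _ AE]) (use \<phi>(1) H2_measurable[OF F] in measurable)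
  have inner: "L2_inner (\<lambda>z. \<phi> z * F z) k = L2_inner (\<lambda>z. \<psi> z * F z) k" if "k \<in> H2" for k
    using AE by (intro L2_inner_cong) (use L L' H2_L2[OF that] in auto)
  obtain w where w: "w \<in> H2" "\<And>k. k \<in> H2 \<Longrightarrow> L2_inner w k = L2_inner (\<lambda>z. \<psi> z * F z) k"
    using trig_projection[OF \<psi> F] by blast
  have "w \<in> H2 \<and> (\<forall>k\<in>H2. L2_inner (\<lambda>z. \<phi> z * F z - w z) k = 0)"
    using w L' inner by (simp add: L2_inner_diff_left H2_L2)
  then have *: "toeplitz \<phi> F \<in> H2 \<and> (\<forall>k\<in>H2. L2_inner (\<lambda>z. \<phi> z * F z - toeplitz \<phi> F z) k = 0)"
    unfolding toeplitz_def proj_H2_def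
    by (rule someI[where P="\<lambda>h. h \<in> H2 \<and> (\<forall>k\<in>H2. L2_inner (\<lambda>z. \<phi> z * F z - h z) k = 0)"])
  then show "toeplitz \<phi> F \<in> H2" by blast
  show "L2_inner (toeplitz \<phi> F) k = L2_inner (\<lambda>z. \<psi> z * F z) k" if "k \<in> H2"
  proof -
    have "L2_inner (\<lambda>z. \<phi> z * F z - toeplitz \<phi> F z) k = L2_inner (\<lambda>z. \<phi> z * F z) k - L2_inner (toeplitz \<phi> F) k"
      using L' * that by (intro L2_inner_diff_left) (auto simp: H2_L2)
    then show ?thesis using * that inner[OF that] by simp
  qed
qed

lemma toeplitz_trig:
  assumes "trigonometric_polynomial \<phi>" "F \<in> H2"
  shows "toeplitz \<phi> F \<in> H2" "k \<in> H2 \<Longrightarrow> L2_inner (toeplitz \<phi> F) k = L2_inner (\<lambda>z. \<phi> z * F z) k"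
  using toeplitz_spec[OF L2_measurable[OF trig_L2[OF assms(1)]] _ assms] by simp_all

text \<open>An analytic polynomial keeps \<open>H2\<close> invariant, so the projection acts as the identity.\<close>
lemma toeplitz_poly:
  assumes "\<phi> \<in> borel_measurable circle_measure" "\<phi> \<approx> poly p" "F \<in> H2"
  shows "toeplitz \<phi> F \<approx> (\<lambda>z. poly p z * F z)"
  by (rule H2_eqI) (use toeplitz_spec[OF assms(1,2) trig_poly assms(3)] H2_poly_mult[OF assms(3)] in auto)

text \<open>Multiplications by \<open>\<phi>\<close> and \<open>cnj \<phi>\<close> are adjoint on \<open>L2\<close>, and inner products with elements of \<open>H2\<close> do not see
the projection.\<close>
lemma adjoint_toeplitz:
  assumes \<phi>: "trigonometric_polynomial \<phi>" and F: "F \<in> H2"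
  shows "adjoint_op (toeplitz \<phi>) F \<approx> toeplitz (\<lambda>z. cnj (\<phi> z)) F"
proof -
  note \<phi>' = trig_cnj[OF \<phi>]
  have flip: "L2_inner (toeplitz \<phi> x) F = L2_inner x (toeplitz (\<lambda>z. cnj (\<phi> z)) F)" if x: "x \<in> H2" for x
  proof -
    have "L2_inner x (toeplitz (\<lambda>z. cnj (\<phi> z)) F) = cnj (L2_inner (\<lambda>z. cnj (\<phi> z) * F z) x)"
      using toeplitz_trig(2)[OF \<phi>' F x] L2_inner_commute by metis
    also have "\<dots> = L2_inner x (\<lambda>z. cnj (\<phi> z) * F z)"
      by (rule L2_inner_commute[symmetric])
    also have "\<dots> = L2_inner (\<lambda>z. \<phi> z * x z) F" by (rule L2_inner_mult_left[symmetric])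
    finally show ?thesis using toeplitz_trig(2)[OF \<phi> x F] by simp
  qed
  then have "toeplitz (\<lambda>z. cnj (\<phi> z)) F \<in> H2 \<and> (\<forall>x\<in>H2. L2_inner (toeplitz \<phi> x) F = L2_inner x (toeplitz (\<lambda>z. cnj (\<phi> z)) F))"
    using toeplitz_trig(1)[OF \<phi>' F] by blast
  then have *: "adjoint_op (toeplitz \<phi>) F \<in> H2 \<and> (\<forall>x\<in>H2. L2_inner (toeplitz \<phi> x) F = L2_inner x (adjoint_op (toeplitz \<phi>) F))"
    unfolding adjoint_op_def
    by (rule someI[where P="\<lambda>w. w \<in> H2 \<and> (\<forall>x\<in>H2. L2_inner (toeplitz \<phi> x) F = L2_inner x w)"])
  show ?thesis
  proof (rule H2_eqI)
    fix k assume "k \<in> H2"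
    then have "L2_inner k (adjoint_op (toeplitz \<phi>) F) = L2_inner k (toeplitz (\<lambda>z. cnj (\<phi> z)) F)"
      using * flip by simp
    then show "L2_inner (adjoint_op (toeplitz \<phi>) F) k = L2_inner (toeplitz (\<lambda>z. cnj (\<phi> z)) F) k"
      by (metis L2_inner_commute)
  qed (use * toeplitz_trig(1)[OF \<phi>' F] in auto)
qed

lemma L2_norm_sq: "(L2_norm F)\<^sup>2 = Re (L2_inner F F)"
  by (simp add: L2_inner_self_norm)

text \<open>The projection does not increase the norm, and \<open>\<phi>\<close> is bounded on the circle.\<close>
lemma bounded_operator_toeplitz:
  assumes \<phi>: "trigonometric_polynomial \<phi>"
  shows "bounded_operator (toeplitz \<phi>)"
  unfolding bounded_operator_def
proof (intro conjI ballI allI)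
  show "toeplitz \<phi> h \<in> H2" if "h \<in> H2" for h by (rule toeplitz_trig(1)[OF \<phi> that])
next
  fix x y a b assume x: "x \<in> H2" and y: "y \<in> H2"
  note T = toeplitz_trig[OF \<phi> x] toeplitz_trig[OF \<phi> y] toeplitz_trig[OF \<phi> H2_lincomb[OF x y]]
  show "toeplitz \<phi> (\<lambda>z. a * x z + b * y z) \<approx> (\<lambda>z. a * toeplitz \<phi> x z + b * toeplitz \<phi> y z)"
  proof (rule H2_eqI)
    fix k assume k: "k \<in> H2"
    have "L2_inner (toeplitz \<phi> (\<lambda>z. a * x z + b * y z)) k = L2_inner (\<lambda>z. a * (\<phi> z * x z) + b * (\<phi> z * y z)) k"
      by (subst T(6)[OF k]) (simp add: algebra_simps)
    then show "L2_inner (toeplitz \<phi> (\<lambda>z. a * x z + b * y z)) k = L2_inner (\<lambda>z. a * toeplitz \<phi> x z + b * toeplitz \<phi> y z) k"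
      using T k x y by (simp add: L2_inner_lincomb_left H2_L2 trig_L2_mult[OF \<phi>])
  qed (use T H2_lincomb in auto)
next
  obtain B where B: "\<And>z. cmod z = 1 \<Longrightarrow> cmod (\<phi> z) \<le> B"
    using bounded_on_circle[OF trig_continuous[OF \<phi>]] by blast
  have B0: "B \<ge> 0" using order_trans[OF norm_ge_zero B[of 1]] by simp
  show "\<exists>M. \<forall>h\<in>H2. L2_norm (toeplitz \<phi> h) \<le> M * L2_norm h"
  proof (intro exI ballI)
    fix h assume h: "h \<in> H2"
    define w where "w = toeplitz \<phi> h"
    define V where "V = (\<lambda>z. \<phi> z * h z)"
    have w: "w \<in> L2" "w \<in> H2" "L2_inner V w = L2_inner w w" and V: "V \<in> L2"
      using toeplitz_trig[OF \<phi> h] trig_L2_mult[OF \<phi> H2_L2[OF h]] by (auto simp: w_def V_def H2_L2)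
    define D where "D = (\<lambda>z. V z - w z)"
    have D: "D \<in> L2" unfolding D_def by (intro L2_diff V w)
    have wV: "L2_inner w V = L2_inner w w" using w(3) L2_inner_commute by metis
    have "L2_inner D D = L2_inner V V - L2_inner w w"
      using V w wV D unfolding D_def by (simp add: L2_inner_diff_left L2_inner_diff_right)
    then have "(L2_norm D)\<^sup>2 = (L2_norm V)\<^sup>2 - (L2_norm w)\<^sup>2"
      by (simp add: L2_norm_sq)
    then have "(L2_norm w)\<^sup>2 \<le> (L2_norm V)\<^sup>2" by (smt (verit) zero_le_power2)
    also have "\<dots> = (LINT z|circle_measure. (cmod (V z))\<^sup>2)" by (simp add: L2_norm_def)
    also have "\<dots> \<le> (LINT z|circle_measure. B\<^sup>2 * (cmod (h z))\<^sup>2)"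
    proof (rule integral_mono_AE)
      show "AE z in circle_measure. (cmod (V z))\<^sup>2 \<le> B\<^sup>2 * (cmod (h z))\<^sup>2"
        using B by (intro AE_circleI) (auto simp: V_def norm_mult power_mult_distrib intro!: mult_right_mono power_mono)
    qed (use V h in \<open>auto intro: L2_integrable H2_L2 integrable_mult_right\<close>)
    also have "\<dots> = (B * L2_norm h)\<^sup>2" by (simp add: L2_norm_def power_mult_distrib)
    finally show "L2_norm (toeplitz \<phi> h) \<le> B * L2_norm h"
      using B0 by (intro power2_le_imp_le[of "L2_norm (toeplitz \<phi> h)"]) (auto simp: w_def L2_norm_def)
  qed
qed

section \<open>Multiplication by a conjugate polynomial\<close>

lemma fourier_poly_mult:
  assumes "F \<in> L2"
  shows "fourier (\<lambda>z. poly h z * F z) m = (\<Sum>i\<le>degree h. coeff h i * fourier F (m - int i))"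
proof -
  have "(\<lambda>z. poly h z * F z) = (\<lambda>z. \<Sum>i\<le>degree h. coeff h i * (z powi int i * F z))"
    by (simp add: poly_altdef sum_distrib_right mult.assoc)
  then show ?thesis
    using assms by (simp only:) (subst fourier_sum; auto intro!: L2_scale L2_mult_continuous continuous_powi_circle simp: fourier_scale fourier_powi_mult simp del: power_int_of_nat)
qed

lemma cnj_poly_circle:
  "cmod z = 1 \<Longrightarrow> cnj (poly h z) = (\<Sum>i\<le>degree h. cnj (coeff h i) * z powi (- int i))"
  using cnj_powi_circle[of z "int i" for i] by (simp add: poly_altdef)

lemma fourier_cnj_poly_mult:
  assumes "F \<in> L2"
  shows "fourier (\<lambda>z. cnj (poly h z) * F z) m = (\<Sum>i\<le>degree h. cnj (coeff h i) * fourier F (m + int i))"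
proof -
  have L: "(\<lambda>z. cnj (coeff h i) * (z powi (- int i) * F z)) \<in> L2" for i
    using assms by (intro L2_scale L2_mult_continuous continuous_powi_circle)
  have "fourier (\<lambda>z. cnj (poly h z) * F z) m = fourier (\<lambda>z. \<Sum>i\<le>degree h. cnj (coeff h i) * (z powi (- int i) * F z)) m"
    unfolding fourier_def L2_inner_def
  proof (rule Bochner_Integration.integral_cong[OF refl])
    fix z assume "z \<in> space circle_measure"
    then have "cmod z = 1" by simp
    then show "cnj (poly h z) * F z * cnj (z powi m) = (\<Sum>i\<le>degree h. cnj (coeff h i) * (z powi (- int i) * F z)) * cnj (z powi m)"
      by (simp only: cnj_poly_circle sum_distrib_right mult.assoc)
  qed
  also have "\<dots> = (\<Sum>i\<le>degree h. fourier (\<lambda>z. cnj (coeff h i) * (z powi (- int i) * F z)) m)"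
    by (rule fourier_sum) (use L in auto)
  also have "\<dots> = (\<Sum>i\<le>degree h. cnj (coeff h i) * fourier F (m + int i))"
    by (simp only: fourier_scale fourier_powi_mult) simp
  finally show ?thesis .
qed

lemma continuous_cnj_poly: "continuous_on (sphere 0 1) (\<lambda>z. cnj (poly h z))"
  by (intro continuous_intros)

text \<open>With \<open>n = degree h\<close>, the coefficients of \<open>cnj h F\<close> at the frequencies \<open>-n, \<dots>, -1\<close> form a triangular system
in the first \<open>n\<close> coefficients of \<open>F\<close>, with the conjugate of the leading coefficient of \<open>h\<close> on the diagonal.
Conversely, \<open>cnj h\<close> is \<open>z\<^sup>-\<^sup>n\<close> times an analytic polynomial on the circle.\<close>
lemma cnj_poly_mult_H2_iff:
  assumes F: "F \<in> H2"
  shows "(\<lambda>z. cnj (poly h z) * F z) \<in> H2 \<longleftrightarrow> (\<forall>j<degree h. fourier F (int j) = 0)"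
proof
  assume cF: "(\<lambda>z. cnj (poly h z) * F z) \<in> H2"
  have "j < degree h \<longrightarrow> fourier F (int j) = 0" for j
  proof (induction j rule: less_induct)
    case (less j)
    show ?case
    proof
      assume j: "j < degree h"
      have "0 = fourier (\<lambda>z. cnj (poly h z) * F z) (int j - int (degree h))"
        using fourier_H2_neg[OF cF] j by simp
      also have "\<dots> = (\<Sum>i\<le>degree h. cnj (coeff h i) * fourier F (int j - int (degree h) + int i))"
        by (rule fourier_cnj_poly_mult[OF H2_L2[OF F]])
      also have "\<dots> = (\<Sum>i\<in>{degree h}. cnj (coeff h i) * fourier F (int j - int (degree h) + int i))"
      proof (rule sum.mono_neutral_right)
        show "\<forall>i\<in>{..degree h} - {degree h}. cnj (coeff h i) * fourier F (int j - int (degree h) + int i) = 0"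
        proof
          fix i assume i: "i \<in> {..degree h} - {degree h}"
          have "fourier F (int j - int (degree h) + int i) = 0"
          proof (cases "int j - int (degree h) + int i < 0")
            case True
            then show ?thesis by (rule fourier_H2_neg[OF F])
          next
            case False
            then have e: "int j - int (degree h) + int i = int (j + i - degree h)" by auto
            have "j + i - degree h < j" using i False by auto
            then show ?thesis unfolding e using less.IH j by simp
          qed
          then show "cnj (coeff h i) * fourier F (int j - int (degree h) + int i) = 0" by simp
        qed
      qed auto
      finally have "cnj (lead_coeff h) * fourier F (int j) = 0" by simp
      moreover have "lead_coeff h \<noteq> 0" using j by auto
      ultimately show "fourier F (int j) = 0" by simp
    qed
  qed
  then show "\<forall>j<degree h. fourier F (int j) = 0" by blast
next
  assume zero: "\<forall>j<degree h. fourier F (int j) = 0"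
  define n where "n = degree h"
  define q where "q = (\<Sum>i\<le>n. monom (cnj (coeff h i)) (n - i))"
  have Y: "(\<lambda>z. poly q z * (z powi (- int n) * F z)) \<in> H2"
    using zero by (intro H2_poly_mult H2_divide_power F) (simp add: n_def)
  have "poly q z * (z powi (- int n) * F z) = cnj (poly h z) * F z" if z: "cmod z = 1" for z
  proof -
    have "z \<noteq> 0" using z by auto
    then have "z ^ (n - i) * z powi (- int n) = z powi (- int i)" if "i \<le> n" for i
      using that by (simp add: power_int_minus power_diff field_simps)
    then have "poly q z * z powi (- int n) = cnj (poly h z)"
      unfolding cnj_poly_circle[OF z] q_def n_def[symmetric]
      by (simp add: poly_sum poly_monom sum_distrib_right mult.assoc del: power_int_minus)
    then show ?thesis by (metis mult.assoc)
  qed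
  then have "(\<lambda>z. poly q z * (z powi (- int n) * F z)) \<approx> (\<lambda>z. cnj (poly h z) * F z)"
    by (intro AE_circleI)
  then show "(\<lambda>z. cnj (poly h z) * F z) \<in> H2"
    by (rule H2_cong[OF Y L2_measurable[OF L2_mult_continuous[OF H2_L2[OF F] continuous_cnj_poly]]])
qed

section \<open>Conjugations intertwining two polynomials\<close>

locale H2_conjugation =
  fixes C :: "(complex \<Rightarrow> complex) \<Rightarrow> complex \<Rightarrow> complex"
  assumes conj: "conjugation C"
begin

lemma C_H2: "h \<in> H2 \<Longrightarrow> C h \<in> H2"
  and C_lincomb: "x \<in> H2 \<Longrightarrow> y \<in> H2 \<Longrightarrow> C (\<lambda>z. a * x z + b * y z) \<approx> (\<lambda>z. cnj a * C x z + cnj b * C y z)"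
  and C_C: "h \<in> H2 \<Longrightarrow> C (C h) \<approx> h"
  and C_inner: "x \<in> H2 \<Longrightarrow> y \<in> H2 \<Longrightarrow> L2_inner (C x) (C y) = L2_inner y x"
  using conj by (auto simp: conjugation_def)

text \<open>By the isometry property, \<open>C (x - y)\<close> has the norm of \<open>x - y\<close>.\<close>
lemma C_cong:
  assumes "x \<in> H2" "y \<in> H2" "x \<approx> y"
  shows "C x \<approx> C y"
proof -
  define u where "u = (\<lambda>z. 1 * x z + (-1) * y z)"
  have u: "u \<in> H2" unfolding u_def by (intro H2_lincomb assms)
  have "u \<approx> (\<lambda>z. 0)" using assms(3) unfolding u_def by eventually_elim simp
  then have "L2_inner u u = L2_inner (\<lambda>z. 0) (\<lambda>z. 0)"
    using u by (intro L2_inner_cong) (auto simp: H2_L2 H2_zero)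
  then have "L2_inner (C u) (C u) = 0" using C_inner[OF u u] by (simp add: L2_inner_def)
  then have "C u \<approx> (\<lambda>z. 0)" by (rule AE_zero_if_inner_self_zero[OF H2_L2[OF C_H2[OF u]]])
  with C_lincomb[OF assms(1,2), of 1 "-1"] show ?thesis
    unfolding u_def by eventually_elim simp
qed

lemma C_inner_swap:
  assumes "x \<in> H2" "y \<in> H2"
  shows "L2_inner (C x) y = L2_inner (C y) x"
proof -
  have "L2_inner (C x) y = L2_inner (C x) (C (C y))"
  proof (rule L2_inner_cong)
    show "y \<approx> C (C y)" using C_C[OF assms(2)] by eventually_elim simp
  qed (use assms in \<open>auto intro: H2_L2 C_H2\<close>)
  also have "\<dots> = L2_inner (C y) x" by (intro C_inner assms C_H2)
  finally show ?thesis .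
qed

lemma C_scale:
  assumes "x \<in> H2"
  shows "C (\<lambda>z. a * x z) \<approx> (\<lambda>z. cnj a * C x z)"
  using C_lincomb[OF assms assms, of a 0] by simp

lemma C_sum:
  assumes "finite I" "\<And>i. i \<in> I \<Longrightarrow> x i \<in> H2"
  shows "C (\<lambda>z. \<Sum>i\<in>I. a i * x i z) \<approx> (\<lambda>z. \<Sum>i\<in>I. cnj (a i) * C (x i) z)"
  using assms
proof (induction I rule: finite_induct)
  case empty
  then show ?case using C_scale[OF H2_zero, of 0] by simp
next
  case (insert i I)
  have IH: "C (\<lambda>z. \<Sum>i\<in>I. a i * x i z) \<approx> (\<lambda>z. \<Sum>i\<in>I. cnj (a i) * C (x i) z)" using insert by simp
  have S: "(\<lambda>z. \<Sum>i\<in>I. a i * x i z) \<in> H2" using insert by (intro H2_sum H2_scale) auto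
  have "C (\<lambda>z. a i * x i z + 1 * (\<Sum>i\<in>I. a i * x i z)) \<approx> (\<lambda>z. cnj (a i) * C (x i) z + cnj 1 * C (\<lambda>z. \<Sum>i\<in>I. a i * x i z) z)"
    using insert S by (intro C_lincomb) auto
  then have "C (\<lambda>z. a i * x i z + 1 * (\<Sum>i\<in>I. a i * x i z)) \<approx> (\<lambda>z. cnj (a i) * C (x i) z + (\<Sum>i\<in>I. cnj (a i) * C (x i) z))"
    using IH by eventually_elim simp
  then show ?case using insert.hyps by simp
qed

definition intertwines :: "complex poly \<Rightarrow> complex poly \<Rightarrow> bool" where
  "intertwines f g \<longleftrightarrow> (\<forall>x\<in>H2. C (\<lambda>z. poly f z * x z) \<approx> (\<lambda>z. poly g z * C x z))"

text \<open>Apply the relation to \<open>C y\<close>, and then apply \<open>C\<close>.\<close>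
lemma intertwines_sym:
  assumes "intertwines f g"
  shows "intertwines g f"
  unfolding intertwines_def
proof
  fix y assume y: "y \<in> H2"
  note Cy = C_H2[OF y]
  have 1: "C (\<lambda>z. poly f z * C y z) \<approx> (\<lambda>z. poly g z * C (C y) z)"
    using assms Cy by (simp add: intertwines_def)
  have 2: "C (\<lambda>z. poly f z * C y z) \<approx> (\<lambda>z. poly g z * y z)"
    using 1 C_C[OF y] by eventually_elim simp
  have "C (C (\<lambda>z. poly f z * C y z)) \<approx> C (\<lambda>z. poly g z * y z)"
    using 2 by (intro C_cong C_H2 H2_poly_mult Cy y)
  with C_C[OF H2_poly_mult[OF Cy, of f]] show "C (\<lambda>z. poly g z * y z) \<approx> (\<lambda>z. poly f z * C y z)"
    by eventually_elim simp
qed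

lemma intertwines_power:
  assumes "intertwines f g"
  shows "intertwines (f ^ k) (g ^ k)"
proof (induction k)
  case 0
  then show ?case by (simp add: intertwines_def)
next
  case (Suc k)
  show ?case
    unfolding intertwines_def
  proof
    fix x assume x: "x \<in> H2"
    have 1: "C (\<lambda>z. poly f z * (poly (f ^ k) z * x z)) \<approx> (\<lambda>z. poly g z * C (\<lambda>z. poly (f ^ k) z * x z) z)"
      using assms H2_poly_mult[OF x, of "f ^ k"] unfolding intertwines_def by (rule bspec)
    have 2: "C (\<lambda>z. poly (f ^ k) z * x z) \<approx> (\<lambda>z. poly (g ^ k) z * C x z)"
      using Suc x unfolding intertwines_def by blast
    have 3: "(\<lambda>z. poly (f ^ Suc k) z * x z) = (\<lambda>z. poly f z * (poly (f ^ k) z * x z))"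
      by (simp add: mult.assoc)
    show "C (\<lambda>z. poly (f ^ Suc k) z * x z) \<approx> (\<lambda>z. poly (g ^ Suc k) z * C x z)"
      unfolding 3 using 1 2 by eventually_elim (simp add: mult.assoc)
  qed
qed

text \<open>The function \<open>W\<close>, the image under \<open>C\<close> of \<open>cnj f x\<close>, has the same inner products with \<open>H2\<close> as
\<open>V = cnj g C x\<close>, so it is the projection of \<open>V\<close>. Its norm is that of \<open>f x\<close>, hence of \<open>C (f x) = g C x\<close>,
hence of \<open>V\<close>; a projection that keeps the norm keeps the vector, so \<open>V\<close> lies in \<open>H2\<close>.\<close>
lemma intertwines_cnj:
  assumes fg: "intertwines f g" and x: "x \<in> H2" and fx: "(\<lambda>z. cnj (poly f z) * x z) \<in> H2"
  shows "(\<lambda>z. cnj (poly g z) * C x z) \<in> H2"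
proof -
  define W where "W = C (\<lambda>z. cnj (poly f z) * x z)"
  define V where "V = (\<lambda>z. cnj (poly g z) * C x z)"
  have W: "W \<in> H2" unfolding W_def by (intro C_H2 fx)
  have V: "V \<in> L2" unfolding V_def by (intro L2_mult_continuous continuous_cnj_poly H2_L2 C_H2 x)
  have WV: "L2_inner V y = L2_inner W y" if y: "y \<in> H2" for y
  proof -
    have "L2_inner V y = L2_inner (C x) (\<lambda>z. poly g z * y z)"
      unfolding V_def by (subst L2_inner_mult_left) simp
    also have "\<dots> = L2_inner (C (\<lambda>z. poly g z * y z)) x"
      by (intro C_inner_swap H2_poly_mult x y)
    also have "\<dots> = L2_inner (\<lambda>z. poly f z * C y z) x"
      using intertwines_sym[OF fg] y x
      by (intro L2_inner_cong) (auto intro: H2_L2 C_H2 H2_poly_mult simp: intertwines_def)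
    also have "\<dots> = L2_inner (C y) (\<lambda>z. cnj (poly f z) * x z)"
      by (rule L2_inner_mult_left)
    also have "\<dots> = L2_inner W y"
      unfolding W_def by (intro C_inner_swap fx y)
    finally show ?thesis .
  qed
  have WWV: "L2_inner W V = L2_inner W W"
    using WV[OF W] L2_inner_commute by metis
  have fx': "(\<lambda>z. poly f z * x z) \<in> H2" by (rule H2_poly_mult[OF x])
  have "L2_inner W W = L2_inner (\<lambda>z. cnj (poly f z) * x z) (\<lambda>z. cnj (poly f z) * x z)"
    unfolding W_def by (rule C_inner[OF fx fx])
  also have "\<dots> = L2_inner (\<lambda>z. poly f z * x z) (\<lambda>z. poly f z * x z)"
    by (simp add: L2_inner_def mult_ac)
  also have "\<dots> = L2_inner (C (\<lambda>z. poly f z * x z)) (C (\<lambda>z. poly f z * x z))"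
    by (rule C_inner[OF fx' fx', symmetric])
  also have "\<dots> = L2_inner (\<lambda>z. poly g z * C x z) (\<lambda>z. poly g z * C x z)"
    using fg x by (intro L2_inner_cong) (auto intro: H2_L2 C_H2 H2_poly_mult simp: intertwines_def)
  also have "\<dots> = L2_inner V V"
    by (simp add: L2_inner_def V_def mult_ac)
  finally have eq: "L2_inner W W = L2_inner V V" .
  have D: "(\<lambda>z. W z - V z) \<in> L2" by (intro L2_diff V H2_L2 W)
  have "L2_inner (\<lambda>z. W z - V z) (\<lambda>z. W z - V z) = 0"
    using D V H2_L2[OF W] eq WWV WV[OF W] by (simp add: L2_inner_diff_left L2_inner_diff_right)
  then have "(\<lambda>z. W z - V z) \<approx> (\<lambda>z. 0)" by (rule AE_zero_if_inner_self_zero[OF D])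
  then have "W \<approx> V" by simp
  then have "V \<in> H2" by (rule H2_cong[OF W L2_measurable[OF V]])
  then show ?thesis unfolding V_def .
qed

text \<open>Multiplication by \<open>cnj (f ^ k)\<close> leaves \<open>x\<close> in \<open>H2\<close> exactly when the first \<open>k * degree f\<close> coefficients of \<open>x\<close>
vanish, and \<open>C\<close> preserves this property of \<open>x\<close> on replacing \<open>f\<close> by \<open>g\<close>.\<close>
lemma intertwines_vanishing:
  assumes fg: "intertwines f g" and x: "x \<in> H2" and z: "\<And>j. j < k * degree f \<Longrightarrow> fourier x (int j) = 0"
    and j: "j < k * degree g"
  shows "fourier (C x) (int j) = 0"
proof -
  have deg: "degree (h ^ k) = k * degree h" for h :: "complex poly"
    using j by (cases "h = 0") (auto simp: degree_power_eq power_0_left)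
  have "(\<lambda>z. cnj (poly (f ^ k) z) * x z) \<in> H2"
    using z cnj_poly_mult_H2_iff[OF x, of "f ^ k"] by (simp only: deg) simp
  then have "(\<lambda>z. cnj (poly (g ^ k) z) * C x z) \<in> H2"
    by (rule intertwines_cnj[OF intertwines_power[OF fg] x])
  then show ?thesis
    using j cnj_poly_mult_H2_iff[OF C_H2[OF x], of "g ^ k"] by (simp only: deg)
qed

definition entry :: "nat \<Rightarrow> nat \<Rightarrow> complex" where
  "entry i j = fourier (C (\<lambda>z. z ^ j)) (int i)"

lemma entry_sym: "entry i j = entry j i"
  using C_inner_swap[OF H2_power[of i] H2_power[of j]] by (simp add: entry_def fourier_def)

lemma norm_C_power: "L2_inner (C (\<lambda>z. z ^ j)) (C (\<lambda>z. z ^ j)) = 1"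
  using C_inner[OF H2_power[of j] H2_power[of j]] fourier_power[of j "int j"] by (simp add: fourier_def)

lemma entry_bounded: "cmod (entry i j) \<le> 1"
proof -
  have "(cmod (entry i j))\<^sup>2 \<le> (LINT z|circle_measure. (cmod (C (\<lambda>z. z ^ j) z))\<^sup>2)"
    unfolding entry_def fourier_def
    by (rule bessel_single) (auto intro: H2_L2 C_H2 H2_power L2_powi simp: L2_inner_powi simp del: power_int_of_nat)
  also have "\<dots> = 1" using norm_C_power[of j] unfolding L2_inner_self by (metis of_real_eq_1_iff)
  finally show ?thesis by (simp add: power_le_one_iff)
qed

text \<open>If column \<open>j\<close> is finite, then \<open>C z\<^sup>j\<close> is a polynomial, and its norm is that of \<open>z\<^sup>j\<close>.\<close>
lemma entry_column_norm:
  assumes "\<And>i. i \<ge> N \<Longrightarrow> entry i j = 0"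
  shows "(\<Sum>i<N. (cmod (entry i j))\<^sup>2) = 1"
proof -
  define E where "E = C (\<lambda>z. z ^ j)"
  define T where "T = (\<lambda>z. \<Sum>i<N. entry i j * z ^ i)"
  have E: "E \<in> H2" and T: "T \<in> H2" unfolding E_def T_def by (intro C_H2 H2_power H2_truncated)+
  have "fourier (\<lambda>z. E z - T z) (int n) = 0" for n
    using assms[of n] E T by (subst fourier_diff) (auto simp: H2_L2 T_def fourier_truncated E_def entry_def)
  then have "(\<lambda>z. E z - T z) \<approx> (\<lambda>z. 0)" by (intro H2_fourier_zero H2_diff E T)
  then have ET: "T \<approx> E" by eventually_elim simp
  have "1 = L2_inner E E" by (simp add: E_def norm_C_power)
  also have "\<dots> = L2_inner T E"
    by (intro L2_inner_cong H2_L2 E T) (use ET in auto)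
  also have "\<dots> = (\<Sum>i<N. entry i j * L2_inner (\<lambda>z. z ^ i) E)"
    unfolding T_def using E by (subst L2_inner_sum_left) (auto intro!: H2_L2 H2_scale H2_power simp: L2_inner_scale_left)
  also have "\<dots> = (\<Sum>i<N. entry i j * cnj (entry i j))"
    by (subst L2_inner_commute) (simp add: entry_def fourier_def E_def)
  also have "\<dots> = of_real (\<Sum>i<N. (cmod (entry i j))\<^sup>2)"
    by (simp only: of_real_sum complex_norm_square)
  finally show ?thesis by (metis of_real_eq_1_iff)
qed

text \<open>By symmetry of the matrix, this is a statement about the image of \<open>z\<^sup>i\<close>, whose first \<open>k * degree g\<close>
coefficients vanish.\<close>
lemma entry_zero:
  assumes "intertwines f g" "j < k * degree f" "i \<ge> k * degree g"
  shows "entry i j = 0"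
proof -
  have "fourier (C (\<lambda>z. z ^ i)) (int j) = 0"
    by (rule intertwines_vanishing[OF intertwines_sym[OF assms(1)] H2_power _ assms(2)])
       (use assms(3) in \<open>auto simp: fourier_power\<close>)
  then show ?thesis using entry_sym[of i j] by (simp add: entry_def)
qed

text \<open>The squared entries with row below \<open>degree g\<close> and column below \<open>degree f\<close> sum to \<open>1\<close> along each column and
each row, so there are as many columns as rows.\<close>
lemma intertwines_degree:
  assumes "intertwines f g"
  shows "degree f = degree g"
proof -
  have "real (degree f) = (\<Sum>j<degree f. \<Sum>i<degree g. (cmod (entry i j))\<^sup>2)"
    using entry_zero[OF assms, of _ 1] by (simp add: entry_column_norm)
  also have "\<dots> = (\<Sum>i<degree g. \<Sum>j<degree f. (cmod (entry j i))\<^sup>2)"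
    by (subst sum.swap) (simp add: entry_sym)
  also have "\<dots> = real (degree g)"
    using entry_zero[OF intertwines_sym[OF assms], of _ 1] by (simp add: entry_column_norm)
  finally show ?thesis by simp
qed

lemma entry_relation:
  assumes "intertwines f g"
  shows "(\<Sum>n\<le>degree f. cnj (coeff f n) * entry i (j + n)) = (\<Sum>n\<le>i. coeff g n * entry (i - n) j)"
proof -
  define E where "E = C (\<lambda>z. z ^ j)"
  have E: "E \<in> H2" unfolding E_def by (intro C_H2 H2_power)
  have "(\<lambda>z. poly f z * z ^ j) = (\<lambda>z. \<Sum>n\<le>degree f. coeff f n * z ^ (j + n))"
    by (simp add: poly_altdef sum_distrib_left power_add mult_ac)
  then have 1: "C (\<lambda>z. poly f z * z ^ j) \<approx> (\<lambda>z. \<Sum>n\<le>degree f. cnj (coeff f n) * C (\<lambda>z. z ^ (j + n)) z)"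
    using C_sum[of "{..degree f}" "\<lambda>n z. z ^ (j + n)" "coeff f"] H2_power by simp
  have 2: "C (\<lambda>z. poly f z * z ^ j) \<approx> (\<lambda>z. poly g z * E z)"
    using assms H2_power[of j] unfolding intertwines_def E_def by (rule bspec)
  have L: "(\<lambda>z. \<Sum>n\<le>degree f. cnj (coeff f n) * C (\<lambda>z. z ^ (j + n)) z) \<in> H2"
    by (intro H2_sum H2_scale C_H2 H2_power)
  have "(\<Sum>n\<le>degree f. cnj (coeff f n) * entry i (j + n))
      = fourier (\<lambda>z. \<Sum>n\<le>degree f. cnj (coeff f n) * C (\<lambda>z. z ^ (j + n)) z) (int i)"
    by (subst fourier_sum) (auto intro!: H2_L2 H2_scale C_H2 H2_power simp: fourier_scale entry_def)
  also have "\<dots> = fourier (\<lambda>z. poly g z * E z) (int i)"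
  proof (rule fourier_cong[OF H2_L2[OF L] H2_L2[OF H2_poly_mult[OF E]]])
    show "(\<lambda>z. \<Sum>n\<le>degree f. cnj (coeff f n) * C (\<lambda>z. z ^ (j + n)) z) \<approx> (\<lambda>z. poly g z * E z)"
      using 1 2 by eventually_elim simp
  qed
  also have "\<dots> = (\<Sum>n\<le>degree g. coeff g n * fourier E (int i - int n))"
    by (rule fourier_poly_mult[OF H2_L2[OF E]])
  also have "\<dots> = (\<Sum>n\<le>i. coeff g n * entry (i - n) j)"
  proof -
    have "(\<Sum>n\<le>degree g. coeff g n * fourier E (int i - int n)) = (\<Sum>n\<in>{..degree g} \<inter> {..i}. coeff g n * fourier E (int i - int n))"
      using fourier_H2_neg[OF E] by (intro sum.mono_neutral_right) auto
    also have "\<dots> = (\<Sum>n\<le>i. coeff g n * fourier E (int i - int n))"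
      by (intro sum.mono_neutral_left) (auto simp: coeff_eq_0)
    also have "\<dots> = (\<Sum>n\<le>i. coeff g n * entry (i - n) j)"
      by (intro sum.cong refl) (simp add: entry_def E_def of_nat_diff)
    finally show ?thesis .
  qed
  finally show ?thesis .
qed

lemma column_nonzero: "\<exists>i. entry i j \<noteq> 0"
proof (rule ccontr)
  assume "\<not> ?thesis"
  then have "(\<Sum>i<0. (cmod (entry i j))\<^sup>2) = 1" by (intro entry_column_norm) auto
  then show False by simp
qed

lemma entry_intertwining:
  assumes fg: "intertwines f g" and d: "degree f > 0"
  shows "intertwining_matrix entry f g (degree f)"
proof
  note deg = intertwines_degree[OF fg]
  show "degree f > 0" "degree f = degree f" "degree g = degree f" using d deg by auto
  show "entry i j = 0" if "i div degree f \<noteq> j div degree f" for i j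
  proof -
    \<comment> \<open>The boundary between the two blocks is at \<open>k * degree f\<close>, with \<open>k\<close> the index of the later block.\<close>
    have key: "entry i j = 0" if lt: "j div degree f < i div degree f" for i j
    proof (rule entry_zero[OF fg, where k="i div degree f"])
      show "j < i div degree f * degree f"
        using lt d by (simp add: div_less_iff_less_mult)
      show "i div degree f * degree g \<le> i" by (simp flip: deg)
    qed
    show ?thesis using key[of j i] key[of i j] entry_sym[of i j] that by (cases "j div degree f < i div degree f") auto
  qed
  show "cmod (entry i j) \<le> 1" for i j by (rule entry_bounded)
  show "(\<Sum>n\<le>degree f. cnj (coeff f n) * entry i (j + n)) = (\<Sum>n\<le>i. coeff g n * entry (i - n) j)" for i j
    by (rule entry_relation[OF fg])
qed

text \<open>The leading coefficients have equal modulus by \<open>lead_le\<close> for \<open>(f, g)\<close> and for \<open>(g, f)\<close>. Constants are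
treated apart, since there are no blocks of size \<open>0\<close>.\<close>
theorem intertwines_rotation:
  assumes fg: "intertwines f g"
  shows "\<exists>\<mu>. cmod \<mu> = 1 \<and> (\<forall>z. poly g z = cnj (poly f (\<mu> * cnj z)))"
proof (cases "degree f = 0")
  case True
  then have deg: "degree f = 0" "degree g = 0" using intertwines_degree[OF fg] by auto
  then obtain a b where ab: "f = [:a:]" "g = [:b:]" by (metis degree_eq_zeroE)
  obtain i where i: "entry i 0 \<noteq> 0" using column_nonzero by blast
  have "(\<Sum>n\<le>i. coeff g n * entry (i - n) 0) = (\<Sum>n\<in>{0}. coeff g n * entry (i - n) 0)"
    using deg by (intro sum.mono_neutral_right) (auto simp: coeff_eq_0)
  then have "cnj a * entry i 0 = b * entry i 0"
    using entry_relation[OF fg, of i 0] ab by simp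
  then have "b = cnj a" using i by simp
  then show ?thesis using ab by (intro exI[of _ 1]) simp
next
  case False
  then have d: "degree f > 0" "degree g > 0" using intertwines_degree[OF fg] by auto
  interpret fg: intertwining_matrix entry f g "degree f" by (rule entry_intertwining[OF fg d(1)])
  interpret gf: intertwining_matrix entry g f "degree g" by (rule entry_intertwining[OF intertwines_sym[OF fg] d(2)])
  obtain i where i: "entry i 0 \<noteq> 0" using column_nonzero by blast
  have "cmod (coeff g (degree f)) = cmod (coeff f (degree f))"
    using fg.lead_le[OF i] gf.lead_le[OF i] intertwines_degree[OF fg] by simp
  then show ?thesis using i by (rule fg.rotation)
qed

end

section \<open>Rotational symmetry of the symbol\<close>

lemma C_rot_inner:
  assumes "\<mu> \<in> sphere 0 1" "F \<in> L2" "G \<in> L2"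
  shows "L2_inner (C_rot \<mu> F) (C_rot \<mu> G) = L2_inner G F"
proof -
  have m: "(\<lambda>z. G z * cnj (F z)) \<in> borel_measurable circle_measure"
    by (rule borel_measurable_integrable[OF integrable_inner[OF assms(3,2)]])
  have "L2_inner (C_rot \<mu> F) (C_rot \<mu> G) = (LINT z|circle_measure. G (\<mu> * cnj z) * cnj (F (\<mu> * cnj z)))"
    by (simp add: L2_inner_def C_rot_def mult.commute)
  also have "\<dots> = L2_inner G F"
    unfolding L2_inner_def by (rule integral_reflect[OF assms(1) m])
  finally show ?thesis .
qed

lemma C_rot_C_rot: "\<mu> \<in> sphere 0 1 \<Longrightarrow> C_rot \<mu> (C_rot \<mu> F) = F"
proof -
  assume "\<mu> \<in> sphere 0 1"
  then have "\<mu> * cnj \<mu> = 1" by (simp flip: complex_norm_square)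
  then show ?thesis by (simp add: C_rot_def fun_eq_iff flip: mult.assoc)
qed

lemma conjugation_C_rot:
  assumes "\<mu> \<in> sphere 0 1"
  shows "conjugation (C_rot \<mu>)"
  unfolding conjugation_def
  using assms by (auto simp: H2_C_rot C_rot_C_rot C_rot_inner H2_L2) (simp add: C_rot_def)

text \<open>Applying \<open>C_rot \<mu>\<close> to a product conjugates and reflects both factors, and undoes the inner \<open>C_rot \<mu>\<close>.\<close>
lemma C_rot_toeplitz:
  assumes \<phi>: "trigonometric_polynomial \<phi>" and \<mu>: "\<mu> \<in> sphere 0 1" and F: "F \<in> H2"
  shows "C_rot \<mu> (toeplitz \<phi> (C_rot \<mu> F)) \<approx> toeplitz (\<lambda>z. cnj (\<phi> (\<mu> * cnj z))) F"
proof (rule H2_eqI)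
  note \<phi>' = trig_cnj[OF trig_reflect[OF \<phi> \<mu>]]
  note CF = H2_C_rot[OF F \<mu>]
  note T = toeplitz_trig[OF \<phi> CF]
  show "C_rot \<mu> (toeplitz \<phi> (C_rot \<mu> F)) \<in> H2" by (rule H2_C_rot[OF T(1) \<mu>])
  show "toeplitz (\<lambda>z. cnj (\<phi> (\<mu> * cnj z))) F \<in> H2" by (rule toeplitz_trig(1)[OF \<phi>' F])
  fix k assume k: "k \<in> H2"
  note Ck = H2_C_rot[OF k \<mu>]
  have "L2_inner (C_rot \<mu> (toeplitz \<phi> (C_rot \<mu> F))) k = L2_inner (C_rot \<mu> (toeplitz \<phi> (C_rot \<mu> F))) (C_rot \<mu> (C_rot \<mu> k))"
    by (simp add: C_rot_C_rot[OF \<mu>])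
  also have "\<dots> = L2_inner (C_rot \<mu> k) (toeplitz \<phi> (C_rot \<mu> F))"
    by (rule C_rot_inner[OF \<mu> H2_L2[OF T(1)] H2_L2[OF Ck]])
  also have "\<dots> = L2_inner (C_rot \<mu> k) (\<lambda>z. \<phi> z * C_rot \<mu> F z)"
    using T(2)[OF Ck] L2_inner_commute by metis
  also have "\<dots> = L2_inner (C_rot \<mu> (\<lambda>z. \<phi> z * C_rot \<mu> F z)) (C_rot \<mu> (C_rot \<mu> k))"
    by (rule C_rot_inner[symmetric, OF \<mu> trig_L2_mult[OF \<phi> H2_L2[OF CF]] H2_L2[OF Ck]])
  also have "\<dots> = L2_inner (\<lambda>z. cnj (\<phi> (\<mu> * cnj z)) * F z) k"
  proof -
    have "C_rot \<mu> (\<lambda>z. \<phi> z * C_rot \<mu> F z) = (\<lambda>z. cnj (\<phi> (\<mu> * cnj z)) * C_rot \<mu> (C_rot \<mu> F) z)"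
      by (simp add: C_rot_def)
    then show ?thesis by (simp add: C_rot_C_rot[OF \<mu>])
  qed
  also have "\<dots> = L2_inner (toeplitz (\<lambda>z. cnj (\<phi> (\<mu> * cnj z))) F) k"
    by (rule toeplitz_trig(2)[OF \<phi>' F k, symmetric])
  finally show "L2_inner (C_rot \<mu> (toeplitz \<phi> (C_rot \<mu> F))) k = L2_inner (toeplitz (\<lambda>z. cnj (\<phi> (\<mu> * cnj z))) F) k" .
qed

lemma fourier_toeplitz:
  assumes "trigonometric_polynomial \<phi>" "F \<in> H2"
  shows "fourier (toeplitz \<phi> F) (int m) = fourier (\<lambda>z. \<phi> z * F z) (int m)"
  using toeplitz_trig(2)[OF assms H2_power[of m]] by (simp add: fourier_def)

text \<open>The matrix entry in row \<open>b\<close> and column \<open>a\<close> is the Fourier coefficient of the symbol at \<open>b - a\<close>. One of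
\<open>a = nat (- n)\<close> and \<open>b = nat n\<close> is \<open>0\<close>.\<close>
lemma toeplitz_determines_symbol:
  assumes \<phi>: "trigonometric_polynomial \<phi>" and \<psi>: "trigonometric_polynomial \<psi>"
    and eq: "\<And>F. F \<in> H2 \<Longrightarrow> toeplitz \<phi> F \<approx> toeplitz \<psi> F" and z: "cmod z = 1"
  shows "\<phi> z = \<psi> z"
proof (rule trig_eqI[OF \<phi> \<psi> _ z])
  fix n
  have coeff: "fourier (toeplitz \<theta> (\<lambda>z. z ^ nat (- n))) (int (nat n)) = fourier \<theta> n"
    if \<theta>: "trigonometric_polynomial \<theta>" for \<theta>
  proof -
    have "fourier (toeplitz \<theta> (\<lambda>z. z ^ nat (- n))) (int (nat n)) = fourier (\<lambda>z. \<theta> z * z ^ nat (- n)) (int (nat n))"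
      by (rule fourier_toeplitz[OF \<theta> H2_power])
    also have "\<dots> = fourier (\<lambda>z. z powi int (nat (- n)) * \<theta> z) (int (nat n))"
      by (simp only: power_int_of_nat mult.commute)
    also have "\<dots> = fourier \<theta> (int (nat n) - int (nat (- n)))" by (rule fourier_powi_mult)
    also have "int (nat n) - int (nat (- n)) = n" by simp
    finally show ?thesis .
  qed
  have "fourier (toeplitz \<phi> (\<lambda>z. z ^ nat (- n))) (int (nat n)) = fourier (toeplitz \<psi> (\<lambda>z. z ^ nat (- n))) (int (nat n))"
    by (intro fourier_cong H2_L2 toeplitz_trig(1) \<phi> \<psi> H2_power eq)
  then show "fourier \<phi> n = fourier \<psi> n" using coeff[OF \<phi>] coeff[OF \<psi>] by simp
qed

text \<open>The operator conjugated by \<open>C_rot \<mu>\<close> has the symbol \<open>cnj (\<phi> (\<mu> * cnj z))\<close>, and the adjoint has the symbol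
\<open>cnj (\<phi> z)\<close>.\<close>
lemma C_rot_symmetric_iff:
  assumes \<phi>: "trigonometric_polynomial \<phi>" and \<mu>: "\<mu> \<in> sphere 0 1"
  shows "C_symmetric (C_rot \<mu>) (toeplitz \<phi>) \<longleftrightarrow> (\<forall>z. cmod z = 1 \<longrightarrow> \<phi> (\<mu> * cnj z) = \<phi> z)"
proof
  assume sym: "C_symmetric (C_rot \<mu>) (toeplitz \<phi>)"
  have eq: "toeplitz (\<lambda>z. cnj (\<phi> (\<mu> * cnj z))) F \<approx> toeplitz (\<lambda>z. cnj (\<phi> z)) F" if F: "F \<in> H2" for F
  proof -
    have "C_rot \<mu> (toeplitz \<phi> (C_rot \<mu> F)) \<approx> adjoint_op (toeplitz \<phi>) F"
      using sym F by (simp add: C_symmetric_def op_eq_def)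
    with C_rot_toeplitz[OF \<phi> \<mu> F] adjoint_toeplitz[OF \<phi> F] show ?thesis
      by eventually_elim simp
  qed
  show "\<forall>z. cmod z = 1 \<longrightarrow> \<phi> (\<mu> * cnj z) = \<phi> z"
  proof (intro allI impI)
    fix z :: complex assume z: "cmod z = 1"
    have "cnj (\<phi> (\<mu> * cnj z)) = cnj (\<phi> z)"
      by (rule toeplitz_determines_symbol[OF trig_cnj[OF trig_reflect[OF \<phi> \<mu>]] trig_cnj[OF \<phi>]]) (erule eq, rule z)
    then show "\<phi> (\<mu> * cnj z) = \<phi> z" by simp
  qed
next
  assume sym: "\<forall>z. cmod z = 1 \<longrightarrow> \<phi> (\<mu> * cnj z) = \<phi> z"
  have "C_rot \<mu> (toeplitz \<phi> (C_rot \<mu> F)) \<approx> adjoint_op (toeplitz \<phi>) F" if F: "F \<in> H2" for F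
  proof -
    note \<phi>' = trig_cnj[OF trig_reflect[OF \<phi> \<mu>]]
    have "toeplitz (\<lambda>z. cnj (\<phi> (\<mu> * cnj z))) F \<approx> toeplitz (\<lambda>z. cnj (\<phi> z)) F"
    proof (rule H2_eqI)
      fix k assume k: "k \<in> H2"
      have "L2_inner (\<lambda>z. cnj (\<phi> (\<mu> * cnj z)) * F z) k = L2_inner (\<lambda>z. cnj (\<phi> z) * F z) k"
        unfolding L2_inner_def using sym by (intro Bochner_Integration.integral_cong refl) auto
      then show "L2_inner (toeplitz (\<lambda>z. cnj (\<phi> (\<mu> * cnj z))) F) k = L2_inner (toeplitz (\<lambda>z. cnj (\<phi> z)) F) k"
        using toeplitz_trig(2)[OF \<phi>' F k] toeplitz_trig(2)[OF trig_cnj[OF \<phi>] F k] by simp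
    qed (intro toeplitz_trig(1) \<phi>' trig_cnj \<phi> F)+
    with C_rot_toeplitz[OF \<phi> \<mu> F] adjoint_toeplitz[OF \<phi> F] show ?thesis
      by eventually_elim simp
  qed
  then show "C_symmetric (C_rot \<mu>) (toeplitz \<phi>)"
    using bounded_operator_toeplitz[OF \<phi>] by (simp add: C_symmetric_def op_eq_def)
qed

section \<open>Bounded analytic functions\<close>

text \<open>The square of a bound for \<open>f\<close> bounds all circular means of \<open>|f|\<^sup>2\<close>.\<close>
lemma hardy_inf_subset: "hardy_inf_disk \<subseteq> hardy2_disk"
proof
  fix f assume f: "f \<in> hardy_inf_disk"
  then have hol: "f holomorphic_on ball 0 1" by (simp add: hardy_inf_disk_def)
  obtain B where "\<forall>y\<in>f ` ball 0 1. cmod y \<le> B"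
    using f unfolding hardy_inf_disk_def bounded_iff by blast
  then have B: "cmod (f w) \<le> B" if "cmod w < 1" for w using that by simp
  have "(LINT z|circle_measure. (cmod (f (of_real r * z)))\<^sup>2) \<le> B\<^sup>2" if r: "0 \<le> r" "r < 1" for r :: real
  proof -
    have cont: "continuous_on (sphere 0 1) (\<lambda>z. f (of_real r * z))"
    proof (rule continuous_on_compose2[OF holomorphic_on_imp_continuous_on[OF hol]])
      show "continuous_on (sphere 0 1) (\<lambda>z. complex_of_real r * z)" by (intro continuous_intros)
      show "(\<lambda>z. complex_of_real r * z) ` sphere 0 1 \<subseteq> ball 0 1" using r by (auto simp: norm_mult)
    qed
    have "(LINT z|circle_measure. (cmod (f (of_real r * z)))\<^sup>2) \<le> (LINT z|circle_measure. B\<^sup>2)"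
    proof (rule integral_mono_AE[OF L2_integrable[OF L2_continuous[OF cont]]])
      show "AE z in circle_measure. (cmod (f (of_real r * z)))\<^sup>2 \<le> B\<^sup>2"
        using r by (intro AE_circleI power_mono B) (auto simp: norm_mult)
    qed simp
    then show ?thesis using circle.prob_space by simp
  qed
  then show "f \<in> hardy2_disk"
    using hol by (auto simp: hardy2_disk_def intro!: exI[of _ "B\<^sup>2"])
qed

lemma Hinf_H2:
  assumes "F \<in> Hinf"
  shows "F \<in> H2"
proof -
  obtain f where "F \<in> borel_measurable circle_measure" "f \<in> hardy_inf_disk" "has_boundary_function f F"
    using assms by (auto simp: Hinf_def)
  then show ?thesis using hardy_inf_subset by (metis H2I hardy2_disk_iff subsetD)
qed

lemma poly_Hinf: "poly p \<in> Hinf"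
proof -
  have "bounded (poly p ` cball 0 1)"
    by (intro compact_imp_bounded compact_continuous_image continuous_intros) auto
  then have "bounded (poly p ` ball 0 1)"
    by (rule bounded_subset) auto
  moreover have "poly p holomorphic_on ball 0 1"
    by (intro holomorphic_intros)
  moreover have "((\<lambda>r::real. poly p (of_real r * z)) \<longlongrightarrow> poly p (of_real 1 * z)) (at_left 1)" for z
    by (intro tendsto_intros)
  then have "has_boundary_function (poly p) (poly p)" by (simp add: has_boundary_function_def)
  ultimately show ?thesis
    using H2_measurable[OF H2_poly] by (auto simp: Hinf_def hardy_inf_disk_def)
qed

lemma H2_polynomial:
  assumes F: "F \<in> H2" and z: "\<And>n. n \<ge> N \<Longrightarrow> fourier F (int n) = 0"
  shows "\<exists>p. F \<approx> poly p"
proof -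
  define p where "p = (\<Sum>n<N. monom (fourier F (int n)) n)"
  have p: "poly p = (\<lambda>z. \<Sum>n<N. fourier F (int n) * z ^ n)"
    by (simp add: p_def poly_sum poly_monom fun_eq_iff)
  have "fourier (\<lambda>z. F z - poly p z) (int n) = 0" for n
    using F H2_poly[of p] z[of n] by (subst fourier_diff) (auto simp: H2_L2 p fourier_truncated)
  then have "(\<lambda>z. F z - poly p z) \<approx> (\<lambda>z. 0)"
    by (intro H2_fourier_zero H2_diff F H2_poly)
  then show ?thesis by (intro exI[of _ p]) simp
qed

section \<open>Analytic parts of a trigonometric symbol\<close>

lemma fourier_cnj: "fourier (\<lambda>z. cnj (F z)) n = cnj (fourier F (- n))"
proof -
  have "fourier (\<lambda>z. cnj (F z)) n = (LINT z|circle_measure. cnj (F z * cnj (z powi (- n))))"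
    unfolding fourier_def L2_inner_def
  proof (rule Bochner_Integration.integral_cong[OF refl])
    fix z assume "z \<in> space circle_measure"
    then have "cmod z = 1" by simp
    then show "cnj (F z) * cnj (z powi n) = cnj (F z * cnj (z powi (- n)))"
      by (simp only: cnj_powi_circle complex_cnj_mult minus_minus)
  qed
  also have "\<dots> = cnj (fourier F (- n))"
    unfolding fourier_def L2_inner_def by (rule Bochner_Integration.integral_cnj)
  finally show ?thesis .
qed

lemma L2_cnj: "F \<in> L2 \<Longrightarrow> (\<lambda>z. cnj (F z)) \<in> L2"
  unfolding L2_def
  by (auto intro!: measurable_compose[OF _ borel_measurable_continuous_onI[of cnj]] continuous_intros)

lemma trig_fourier_bound:
  assumes "trigonometric_polynomial \<phi>"
  shows "\<exists>N. \<forall>n\<ge>N. fourier \<phi> (int n) = 0 \<and> fourier \<phi> (- int n) = 0"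
proof -
  obtain S c where S: "finite S" "\<forall>z\<in>sphere 0 1. \<phi> z = (\<Sum>n\<in>S. c n * z powi n)"
    using assms unfolding trigonometric_polynomial_def by blast
  have \<phi>: "fourier \<phi> m = (if m \<in> S then c m else 0)" for m
  proof -
    have "fourier \<phi> m = fourier (\<lambda>z. \<Sum>n\<in>S. c n * z powi n) m"
      unfolding fourier_def L2_inner_def using S(2)
      by (intro Bochner_Integration.integral_cong refl) auto
    then show ?thesis using S(1) by (simp add: fourier_trig)
  qed
  define N where "N = Suc (nat (\<Sum>n\<in>S. \<bar>n\<bar>))"
  have "int n \<notin> S \<and> - int n \<notin> S" if "n \<ge> N" for n
  proof -
    have "\<bar>m\<bar> \<le> (\<Sum>n\<in>S. \<bar>n\<bar>)" if "m \<in> S" for m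
      using that S(1) by (intro member_le_sum) auto
    then show ?thesis using that unfolding N_def by fastforce
  qed
  then show ?thesis using \<phi> by auto
qed

text \<open>The positive frequencies of \<open>\<phi>\<close> come from \<open>F\<close> alone and the negative ones from \<open>G\<close> alone, so both
functions have finitely many Fourier coefficients.\<close>
lemma analytic_parts_polynomial:
  assumes \<phi>: "trigonometric_polynomial \<phi>" and F: "F \<in> H2" and G: "G \<in> H2"
    and eq: "\<phi> \<approx> (\<lambda>z. F z + cnj (G z))"
  shows "\<exists>p q. F \<approx> poly p \<and> G \<approx> poly q"
proof -
  obtain N where N: "\<And>n. n \<ge> N \<Longrightarrow> fourier \<phi> (int n) = 0 \<and> fourier \<phi> (- int n) = 0"
    using trig_fourier_bound[OF \<phi>] by blast
  have coeff: "fourier \<phi> n = fourier F n + cnj (fourier G (- n))" for n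
  proof -
    have "fourier \<phi> n = fourier (\<lambda>z. 1 * F z + 1 * cnj (G z)) n"
      using eq F G by (intro fourier_cong trig_L2 \<phi> L2_lincomb L2_cnj H2_L2) auto
    also have "\<dots> = 1 * fourier F n + 1 * fourier (\<lambda>z. cnj (G z)) n"
      using F G by (intro fourier_lincomb L2_cnj H2_L2)
    finally show ?thesis by (simp add: fourier_cnj)
  qed
  have "fourier F (int n) = 0" if "n \<ge> Suc N" for n
    using coeff[of "int n"] N[of n] that fourier_H2_neg[OF G, of "- int n"] by simp
  moreover have "fourier G (int n) = 0" if "n \<ge> Suc N" for n
    using coeff[of "- int n"] N[of n] that fourier_H2_neg[OF F, of "- int n"] by simp
  ultimately show ?thesis using H2_polynomial[OF F] H2_polynomial[OF G] by blast
qed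

text \<open>The relation between the analytic parts says that \<open>\<phi>\<close> is \<open>f(z) + f(\<mu> * cnj z)\<close>, and \<open>z \<mapsto> \<mu> * cnj z\<close> is an
involution.\<close>
lemma symmetric_if_analytically_symmetric:
  assumes \<phi>: "trigonometric_polynomial \<phi>" and an: "analytically_symmetric \<phi>"
  shows "\<exists>\<mu>. cmod \<mu> = 1 \<and> (\<forall>z. cmod z = 1 \<longrightarrow> \<phi> (\<mu> * cnj z) = \<phi> z)"
proof -
  obtain F G C where F: "F \<in> Hinf" and G: "G \<in> Hinf" and C: "conjugation C"
    and op: "op_eq (C \<circ> toeplitz F \<circ> C) (toeplitz G)" and eq: "\<phi> \<approx> (\<lambda>z. F z + cnj (G z))"
    using an unfolding analytically_symmetric_def by blast
  interpret H2_conjugation C by unfold_locales (rule C)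
  obtain f g where f: "F \<approx> poly f" and g: "G \<approx> poly g"
    using analytic_parts_polynomial[OF \<phi> Hinf_H2[OF F] Hinf_H2[OF G] eq] by blast
  have "intertwines g f"
    unfolding intertwines_def
  proof
    fix x assume x: "x \<in> H2"
    note Cx = C_H2[OF x]
    have "toeplitz F (C x) \<approx> (\<lambda>z. poly f z * C x z)"
      by (rule toeplitz_poly[OF H2_measurable[OF Hinf_H2[OF F]] f Cx])
    moreover have T: "toeplitz F (C x) \<in> H2"
      by (rule toeplitz_spec(1)[OF H2_measurable[OF Hinf_H2[OF F]] f trig_poly Cx])
    moreover have "toeplitz G x \<approx> (\<lambda>z. poly g z * x z)"
      by (rule toeplitz_poly[OF H2_measurable[OF Hinf_H2[OF G]] g x])
    moreover have "C (toeplitz F (C x)) \<approx> toeplitz G x"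
      using op x by (simp add: op_eq_def)
    ultimately have "C (toeplitz F (C x)) \<approx> (\<lambda>z. poly g z * x z)" and TF: "toeplitz F (C x) \<approx> (\<lambda>z. poly f z * C x z)"
      by auto
    then have "C (C (toeplitz F (C x))) \<approx> C (\<lambda>z. poly g z * x z)"
      by (intro C_cong C_H2 T H2_poly_mult x)
    with C_C[OF T] TF show "C (\<lambda>z. poly g z * x z) \<approx> (\<lambda>z. poly f z * C x z)"
      by eventually_elim simp
  qed
  then obtain \<mu> where \<mu>: "cmod \<mu> = 1" and fg: "\<And>z. poly g z = cnj (poly f (\<mu> * cnj z))"
    using intertwines_rotation[OF intertwines_sym] by blast
  have "\<phi> \<approx> (\<lambda>z. poly f z + cnj (poly g z))"
    using eq f g by eventually_elim simp
  then have \<phi>_eq: "\<phi> z = poly f z + cnj (poly g z)" if "cmod z = 1" for z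
    using that by (intro trig_eq_if_AE[OF \<phi> trig_add[OF trig_poly trig_cnj[OF trig_poly]]])
  have "\<mu> * cnj \<mu> = 1" using \<mu> by (simp flip: complex_norm_square)
  then have inv: "\<mu> * cnj (\<mu> * cnj z) = z" for z by (simp flip: mult.assoc)
  have "\<phi> (\<mu> * cnj z) = \<phi> z" if "cmod z = 1" for z
  proof -
    have "cmod (\<mu> * cnj z) = 1" using that \<mu> by (simp add: norm_mult)
    then have "\<phi> (\<mu> * cnj z) = poly f (\<mu> * cnj z) + poly f (\<mu> * cnj (\<mu> * cnj z))"
      using fg[of "\<mu> * cnj z"] by (simp add: \<phi>_eq)
    then have "\<phi> (\<mu> * cnj z) = poly f (\<mu> * cnj z) + poly f z" unfolding inv .
    then show ?thesis using fg[of z] by (simp add: \<phi>_eq[OF that])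
  qed
  then show ?thesis using \<mu> by blast
qed

text \<open>Symmetry of \<open>\<phi>\<close> determines its negative frequencies from the positive ones: \<open>\<phi>\<close> is \<open>f(z) + f(\<mu> * cnj z)\<close>
for an analytic polynomial \<open>f\<close>, and the second term is the conjugate of \<open>C_rot \<mu> f\<close>. As \<open>C_rot \<mu>\<close> acts on
products factor by factor, it carries multiplication by \<open>f\<close> to multiplication by \<open>C_rot \<mu> f\<close>.\<close>
lemma analytically_symmetric_if_symmetric:
  assumes \<phi>: "trigonometric_polynomial \<phi>" and \<mu>: "\<mu> \<in> sphere 0 1"
    and sym: "\<And>z. cmod z = 1 \<Longrightarrow> \<phi> (\<mu> * cnj z) = \<phi> z"
  shows "analytically_symmetric \<phi>"
proof -
  obtain N where N: "\<And>n. n \<ge> N \<Longrightarrow> fourier \<phi> (int n) = 0 \<and> fourier \<phi> (- int n) = 0"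
    using trig_fourier_bound[OF \<phi>] by blast
  \<comment> \<open>The constant term is fixed by the reflection, so both parts take half of it.\<close>
  define a where "a = (\<lambda>n. if n = 0 then fourier \<phi> 0 / 2 else fourier \<phi> (int n))"
  define f where "f = (\<Sum>n<Suc N. monom (a n) n)"
  have f: "poly f = (\<lambda>z. \<Sum>n<Suc N. a n * z ^ n)"
    by (rule ext) (simp add: f_def poly_sum poly_monom del: sum.lessThan_Suc)
  have ff: "fourier (poly f) n = (if 0 \<le> n then a (nat n) else 0)" for n
    using N[of "nat n"] unfolding f by (subst fourier_truncated) (auto simp: a_def)
  define g where "g = pcompose (map_poly cnj f) [:0, cnj \<mu>:]"
  have g: "poly g z = cnj (poly f (\<mu> * cnj z))" for z
    by (simp add: g_def poly_pcompose mult.commute)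
  have sym_coeff: "fourier \<phi> n = \<mu> powi (- n) * fourier \<phi> (- n)" for n
  proof -
    have "fourier \<phi> n = fourier (\<lambda>z. \<phi> (\<mu> * cnj z)) n"
      unfolding fourier_def L2_inner_def using sym by (intro Bochner_Integration.integral_cong refl) auto
    then show ?thesis using fourier_reflect[OF trig_L2[OF \<phi>] \<mu>] by simp
  qed
  have "\<phi> z = poly f z + cnj (poly g z)" if z: "cmod z = 1" for z
  proof (rule trig_eqI[OF \<phi> trig_add[OF trig_poly trig_cnj[OF trig_poly]] _ z])
    fix n
    have "fourier (\<lambda>z. poly f z + cnj (poly g z)) n = fourier (\<lambda>z. 1 * poly f z + 1 * poly f (\<mu> * cnj z)) n"
      by (simp add: g)
    also have "\<dots> = 1 * fourier (poly f) n + 1 * fourier (\<lambda>z. poly f (\<mu> * cnj z)) n"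
      by (rule fourier_lincomb[OF trig_L2[OF trig_poly] trig_L2[OF trig_reflect[OF trig_poly \<mu>]]])
    also have "fourier (\<lambda>z. poly f (\<mu> * cnj z)) n = \<mu> powi (- n) * fourier (poly f) (- n)"
      by (rule fourier_reflect[OF trig_L2[OF trig_poly] \<mu>])
    also have "1 * fourier (poly f) n + 1 * (\<mu> powi (- n) * fourier (poly f) (- n)) = fourier \<phi> n"
      using sym_coeff[of n] by (cases n "0::int" rule: linorder_cases) (simp_all add: ff a_def)
    finally show "fourier \<phi> n = fourier (\<lambda>z. poly f z + cnj (poly g z)) n" by simp
  qed
  then have eq: "\<phi> \<approx> (\<lambda>z. poly f z + cnj (poly g z))" by (intro AE_circleI)
  interpret H2_conjugation "C_rot \<mu>" by unfold_locales (rule conjugation_C_rot[OF \<mu>])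
  have "op_eq (C_rot \<mu> \<circ> toeplitz (poly f) \<circ> C_rot \<mu>) (toeplitz (poly g))"
    unfolding op_eq_def
  proof
    fix h assume h: "h \<in> H2"
    note Ch = C_H2[OF h]
    note m = H2_measurable[OF H2_poly]
    have "toeplitz (poly f) (C_rot \<mu> h) \<approx> (\<lambda>z. poly f z * C_rot \<mu> h z)"
      by (rule toeplitz_poly[OF m _ Ch]) simp
    then have 1: "C_rot \<mu> (toeplitz (poly f) (C_rot \<mu> h)) \<approx> C_rot \<mu> (\<lambda>z. poly f z * C_rot \<mu> h z)"
      by (rule C_cong[OF toeplitz_trig(1)[OF trig_poly Ch] H2_poly_mult[OF Ch]])
    have 2: "C_rot \<mu> (\<lambda>z. poly f z * C_rot \<mu> h z) = (\<lambda>z. poly g z * h z)"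
    proof -
      have "C_rot \<mu> (\<lambda>z. poly f z * C_rot \<mu> h z) = (\<lambda>z. poly g z * C_rot \<mu> (C_rot \<mu> h) z)"
        by (simp add: C_rot_def g)
      then show ?thesis by (simp only: C_rot_C_rot[OF \<mu>])
    qed
    have 3: "toeplitz (poly g) h \<approx> (\<lambda>z. poly g z * h z)"
      by (rule toeplitz_poly[OF m _ h]) simp
    show "(C_rot \<mu> \<circ> toeplitz (poly f) \<circ> C_rot \<mu>) h \<approx> toeplitz (poly g) h"
      using 1 3 unfolding 2 o_apply by eventually_elim simp
  qed
  then show ?thesis
    unfolding analytically_symmetric_def using poly_Hinf conj eq by blast
qed

theorem theorem4p2:
  fixes \<phi> :: "complex \<Rightarrow> complex"
  assumes "trigonometric_polynomial \<phi>"
  shows "analytically_symmetric \<phi> \<longleftrightarrow>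
         (\<exists>\<mu>\<in>sphere 0 1. C_symmetric (C_rot \<mu>) (toeplitz \<phi>))"
proof
  assume "analytically_symmetric \<phi>"
  then obtain \<mu> where "cmod \<mu> = 1" "\<forall>z. cmod z = 1 \<longrightarrow> \<phi> (\<mu> * cnj z) = \<phi> z"
    using symmetric_if_analytically_symmetric[OF assms] by blast
  then show "\<exists>\<mu>\<in>sphere 0 1. C_symmetric (C_rot \<mu>) (toeplitz \<phi>)"
    using C_rot_symmetric_iff[OF assms, of \<mu>] by (intro bexI[of _ \<mu>]) auto
next
  assume "\<exists>\<mu>\<in>sphere 0 1. C_symmetric (C_rot \<mu>) (toeplitz \<phi>)"
  then obtain \<mu> where "\<mu> \<in> sphere 0 1" "C_symmetric (C_rot \<mu>) (toeplitz \<phi>)" by blast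
  then show "analytically_symmetric \<phi>"
    using C_rot_symmetric_iff[OF assms] analytically_symmetric_if_symmetric[OF assms] by blast
qed

end
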